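(* Let $\mu$ be a probability measure on $\mathbb{R}$ and $\Lambda\subset\mathbb{R}$ a set such that the functions $e_\lambda$, $\lambda\in\Lambda$, form an orthonormal basis of $L^2(\mu)$. Let $U$ be a unitary on $H=L^2(\mu)$ and let $P_U$ be the corresponding selfadjoint extension of $P_0$ in $L^2([0,1])\otimes H$. Let $Q$ be the selfadjoint operator in $L^2([0,1])\otimes L^2(\mu)$ which is the closure of the essentially selfadjoint operator $$\sum_{\lambda}c_\lambda\, g_\lambda\otimes e_\lambda\ \mapsto\ \sum_\lambda\lambda\, c_\lambda\, g_\lambda\otimes e_\lambda$$ defined on all finite sums with $c_\lambda\in\mathbb{C}$, $g_\lambda\in L^2([0,1])$, $\lambda\in\Lambda$. Then $P_U$ and $Q$ commute if and only if the functions $e_\lambda$, $\lambda\in\Lambda$, are eigenfunctions of $U$.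
   Context: All Hilbert spaces are complex; $e(r):=e^{i2\pi r}$, $e_\lambda(y):=e(\lambda y)$. With $\mathscr{H}=L^2([0,1],H)=L^2([0,1])\otimes H$: $P_0f=\frac{1}{i2\pi}f'$ with domain $\{f\in\mathscr{H}\mid f'\in\mathscr{H},\ f(0)=f(1)=0\}$, and $P_Uf=\frac{1}{i2\pi}f'$ with domain $\{f\in\mathscr{H}\mid f'\in\mathscr{H},\ f(1)=Uf(0)\}$ (distributional derivative; endpoint values in $H$ are those of the continuous representative). $P_U$ is a selfadjoint extension of $P_0$. Two (unbounded) selfadjoint operators $A,B$ commute if their spectral measures commute, equivalently $e(aA)e(bB)=e(bB)e(aA)$ for all $a,b\in\mathbb{R}$. *)

theory Defs
  imports "HOL-Probability.Probability"
begin

text \<open>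
  Elements of \<open>L\<^sup>2(M)\<close> are represented by square integrable functions, and equality in
  \<open>L\<^sup>2(M)\<close> is equality almost everywhere.  Maps on \<open>L\<^sup>2(M)\<close> are maps on representatives that
  respect this equality; an unbounded operator is given by its graph, a set of pairs
  that is saturated with respect to it.
\<close>

definition L2 :: "'a measure \<Rightarrow> ('a \<Rightarrow> complex) set" where
  "L2 M = {f \<in> borel_measurable M. integrable M (\<lambda>x. (cmod (f x))\<^sup>2)}"

definition eqL2 :: "'a measure \<Rightarrow> ('a \<Rightarrow> complex) \<Rightarrow> ('a \<Rightarrow> complex) \<Rightarrow> bool" where
  "eqL2 M f g \<longleftrightarrow> (AE x in M. f x = g x)"

definition innerL2 :: "'a measure \<Rightarrow> ('a \<Rightarrow> complex) \<Rightarrow> ('a \<Rightarrow> complex) \<Rightarrow> complex" where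
  "innerL2 M f g = (LINT x|M. f x * cnj (g x))"

definition normL2 :: "'a measure \<Rightarrow> ('a \<Rightarrow> complex) \<Rightarrow> real" where
  "normL2 M f = sqrt (LINT x|M. (cmod (f x))\<^sup>2)"

definition orthonormal_basis :: "'a measure \<Rightarrow> 'i set \<Rightarrow> ('i \<Rightarrow> 'a \<Rightarrow> complex) \<Rightarrow> bool" where
  "orthonormal_basis M I b \<longleftrightarrow>
     (\<forall>i\<in>I. b i \<in> L2 M) \<and>
     (\<forall>i\<in>I. \<forall>j\<in>I. innerL2 M (b i) (b j) = (if i = j then 1 else 0)) \<and>
     (\<forall>f\<in>L2 M. \<forall>\<epsilon>>0. \<exists>F c. finite F \<and> F \<subseteq> I \<and>
        normL2 M (\<lambda>x. f x - (\<Sum>i\<in>F. c i * b i x)) < \<epsilon>)"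

definition linear_map :: "'a measure \<Rightarrow> (('a \<Rightarrow> complex) \<Rightarrow> ('a \<Rightarrow> complex)) \<Rightarrow> bool" where
  "linear_map M T \<longleftrightarrow>
     (\<forall>f\<in>L2 M. T f \<in> L2 M) \<and>
     (\<forall>f\<in>L2 M. \<forall>g\<in>L2 M. eqL2 M f g \<longrightarrow> eqL2 M (T f) (T g)) \<and>
     (\<forall>f\<in>L2 M. \<forall>g\<in>L2 M. eqL2 M (T (\<lambda>x. f x + g x)) (\<lambda>x. T f x + T g x)) \<and>
     (\<forall>f\<in>L2 M. \<forall>c. eqL2 M (T (\<lambda>x. c * f x)) (\<lambda>x. c * T f x))"

definition unitary_map :: "'a measure \<Rightarrow> (('a \<Rightarrow> complex) \<Rightarrow> ('a \<Rightarrow> complex)) \<Rightarrow> bool" where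
  "unitary_map M T \<longleftrightarrow>
     linear_map M T \<and>
     (\<forall>f\<in>L2 M. \<forall>g\<in>L2 M. innerL2 M (T f) (T g) = innerL2 M f g) \<and>
     (\<forall>g\<in>L2 M. \<exists>f\<in>L2 M. eqL2 M (T f) g)"

definition eigenfunction ::
  "'a measure \<Rightarrow> (('a \<Rightarrow> complex) \<Rightarrow> ('a \<Rightarrow> complex)) \<Rightarrow> ('a \<Rightarrow> complex) \<Rightarrow> bool" where
  "eigenfunction M T f \<longleftrightarrow>
     f \<in> L2 M \<and> \<not> eqL2 M f (\<lambda>x. 0) \<and> (\<exists>c. eqL2 M (T f) (\<lambda>x. c * f x))"

definition orthogonal_projection ::
  "'a measure \<Rightarrow> (('a \<Rightarrow> complex) \<Rightarrow> ('a \<Rightarrow> complex)) \<Rightarrow> bool" where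
  "orthogonal_projection M T \<longleftrightarrow>
     linear_map M T \<and>
     (\<forall>f\<in>L2 M. eqL2 M (T (T f)) (T f)) \<and>
     (\<forall>f\<in>L2 M. \<forall>g\<in>L2 M. innerL2 M (T f) g = innerL2 M f (T g))"

type_synonym 'a operator = "(('a \<Rightarrow> complex) \<times> ('a \<Rightarrow> complex)) set"

definition linear_operator :: "'a measure \<Rightarrow> 'a operator \<Rightarrow> bool" where
  "linear_operator M A \<longleftrightarrow>
     A \<subseteq> L2 M \<times> L2 M \<and>
     (\<forall>f\<in>L2 M. \<forall>g\<in>L2 M. \<forall>f' g'. (f', g') \<in> A \<and> eqL2 M f f' \<and> eqL2 M g g' \<longrightarrow> (f, g) \<in> A) \<and>
     (\<forall>f g g'. (f, g) \<in> A \<and> (f, g') \<in> A \<longrightarrow> eqL2 M g g') \<and>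
     (\<lambda>x. 0, \<lambda>x. 0) \<in> A \<and>
     (\<forall>f g f' g'. (f, g) \<in> A \<and> (f', g') \<in> A \<longrightarrow> (\<lambda>x. f x + f' x, \<lambda>x. g x + g' x) \<in> A) \<and>
     (\<forall>f g c. (f, g) \<in> A \<longrightarrow> (\<lambda>x. c * f x, \<lambda>x. c * g x) \<in> A)"

text \<open>The operator whose graph is the closure of the graph of \<open>A\<close>.\<close>

definition operator_closure :: "'a measure \<Rightarrow> 'a operator \<Rightarrow> 'a operator" where
  "operator_closure M A =
     {(f, g). f \<in> L2 M \<and> g \<in> L2 M \<and>
        (\<forall>\<epsilon>>0. \<exists>(f', g')\<in>A. normL2 M (\<lambda>x. f x - f' x) < \<epsilon> \<and> normL2 M (\<lambda>x. g x - g' x) < \<epsilon>)}"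

definition projection_valued_measure ::
  "'a measure \<Rightarrow> (real set \<Rightarrow> ('a \<Rightarrow> complex) \<Rightarrow> ('a \<Rightarrow> complex)) \<Rightarrow> bool" where
  "projection_valued_measure M E \<longleftrightarrow>
     (\<forall>S\<in>sets borel. orthogonal_projection M (E S)) \<and>
     (\<forall>f\<in>L2 M. eqL2 M (E {} f) (\<lambda>x. 0)) \<and>
     (\<forall>f\<in>L2 M. eqL2 M (E UNIV f) f) \<and>
     (\<forall>S\<in>sets borel. \<forall>T\<in>sets borel. \<forall>f\<in>L2 M. eqL2 M (E (S \<inter> T) f) (E S (E T f))) \<and>
     (\<forall>S::nat \<Rightarrow> real set. range S \<subseteq> sets borel \<and> disjoint_family S \<longrightarrow>
        (\<forall>f\<in>L2 M. (\<lambda>N. normL2 M (\<lambda>x. E (\<Union>n. S n) f x - (\<Sum>n<N. E (S n) f x))) \<longlonglongrightarrow> 0))"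

text \<open>The finite Borel measure \<open>S \<mapsto> \<langle>E(S)f, f\<rangle>\<close>, whose values are real and nonnegative.\<close>

definition scalar_measure ::
  "'a measure \<Rightarrow> (real set \<Rightarrow> ('a \<Rightarrow> complex) \<Rightarrow> ('a \<Rightarrow> complex)) \<Rightarrow> ('a \<Rightarrow> complex) \<Rightarrow> real measure"
where
  "scalar_measure M E f =
     measure_of UNIV (sets borel) (\<lambda>S. ennreal (Re (innerL2 M (E S f) f)))"

text \<open>
  \<open>E\<close> is the spectral measure of \<open>A\<close>, that is, \<open>A = \<integral> r dE(r)\<close>: the domain of \<open>A\<close> consists of
  the \<open>f\<close> with \<open>\<integral> r\<^sup>2 d\<langle>E(r)f, f\<rangle> < \<infinity>\<close>, and \<open>\<langle>Af, f\<rangle> = \<integral> r d\<langle>E(r)f, f\<rangle>\<close> on this domain.  By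
  polarization this determines \<open>A\<close> from \<open>E\<close>.  Conversely, by the spectral theorem, \<open>A\<close> has
  such an \<open>E\<close> if and only if it is selfadjoint, and \<open>E\<close> is then unique up to equality
  almost everywhere.
\<close>

definition spectral_measure ::
  "'a measure \<Rightarrow> 'a operator \<Rightarrow> (real set \<Rightarrow> ('a \<Rightarrow> complex) \<Rightarrow> ('a \<Rightarrow> complex)) \<Rightarrow> bool" where
  "spectral_measure M A E \<longleftrightarrow>
     linear_operator M A \<and>
     projection_valued_measure M E \<and>
     (\<forall>f\<in>L2 M. (\<exists>g. (f, g) \<in> A) \<longleftrightarrow> integrable (scalar_measure M E f) (\<lambda>r. r\<^sup>2)) \<and>
     (\<forall>(f, g)\<in>A. innerL2 M g f = complex_of_real (LINT r|scalar_measure M E f. r))"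

text \<open>
  Commutation of (unbounded) selfadjoint operators; selfadjointness of \<open>A\<close> and \<open>B\<close> is
  implied by the existence of their spectral measures \<open>E\<close> and \<open>F\<close>.
\<close>

definition operators_commute :: "'a measure \<Rightarrow> 'a operator \<Rightarrow> 'a operator \<Rightarrow> bool" where
  "operators_commute M A B \<longleftrightarrow>
     (\<exists>E F. spectral_measure M A E \<and> spectral_measure M B F \<and>
        (\<forall>S\<in>sets borel. \<forall>T\<in>sets borel. \<forall>f\<in>L2 M. eqL2 M (E S (F T f)) (F T (E S f))))"

definition unit_interval :: "real measure" where
  "unit_interval = restrict_space lborel {0..1}"

text \<open>
  \<open>L\<^sup>2([0,1], L\<^sup>2(\<mu>)) = L\<^sup>2([0,1]) \<otimes> L\<^sup>2(\<mu>)\<close> is realized as \<open>L\<^sup>2([0,1] \<times> \<real>)\<close> with respect to the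
  product measure; \<open>f\<close> stands for the \<open>L\<^sup>2(\<mu>)\<close>-valued function \<open>x \<mapsto> f(x,\<cdot>)\<close>.
\<close>

definition HH :: "real measure \<Rightarrow> (real \<times> real) measure" where
  "HH \<mu> = unit_interval \<Otimes>\<^sub>M \<mu>"

definition tensor :: "(real \<Rightarrow> complex) \<Rightarrow> (real \<Rightarrow> complex) \<Rightarrow> real \<times> real \<Rightarrow> complex" where
  "tensor g h = (\<lambda>(x, y). g x * h y)"

definition ee :: "real \<Rightarrow> complex" where
  "ee r = exp (\<i> * 2 * of_real pi * of_real r)"

definition e_fun :: "real \<Rightarrow> real \<Rightarrow> complex" where
  "e_fun l = (\<lambda>y. ee (l * y))"

text \<open>Smooth functions with compact support in the open interval \<open>(0,1)\<close>.\<close>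

definition test_function :: "(real \<Rightarrow> real) \<Rightarrow> bool" where
  "test_function \<phi> \<longleftrightarrow>
     (\<exists>\<Phi> :: nat \<Rightarrow> real \<Rightarrow> real. \<Phi> 0 = \<phi> \<and>
        (\<forall>n x. (\<Phi> n has_real_derivative \<Phi> (Suc n) x) (at x))) \<and>
     (\<exists>a b. 0 < a \<and> b < 1 \<and> (\<forall>x. x \<notin> {a..b} \<longrightarrow> \<phi> x = 0))"

text \<open>
  \<open>g = f'\<close> as \<open>L\<^sup>2(\<mu>)\<close>-valued distributions on \<open>(0,1)\<close>: the vector-valued integrals
  \<open>\<integral> \<phi>(x) g(x,\<cdot>) dx\<close> and \<open>- \<integral> \<phi>'(x) f(x,\<cdot>) dx\<close> agree in \<open>L\<^sup>2(\<mu>)\<close>.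
\<close>

definition distributional_derivative ::
  "real measure \<Rightarrow> (real \<times> real \<Rightarrow> complex) \<Rightarrow> (real \<times> real \<Rightarrow> complex) \<Rightarrow> bool" where
  "distributional_derivative \<mu> f g \<longleftrightarrow>
     (\<forall>\<phi>. test_function \<phi> \<longrightarrow>
        eqL2 \<mu> (\<lambda>y. LINT x|unit_interval. of_real (\<phi> x) * g (x, y))
                (\<lambda>y. - (LINT x|unit_interval. of_real (deriv \<phi> x) * f (x, y))))"

definition continuous_representative ::
  "real measure \<Rightarrow> (real \<times> real \<Rightarrow> complex) \<Rightarrow> (real \<Rightarrow> real \<Rightarrow> complex) \<Rightarrow> bool" where
  "continuous_representative \<mu> f F \<longleftrightarrow>
     (\<forall>x\<in>{0..1}. F x \<in> L2 \<mu>) \<and>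
     (\<forall>x\<in>{0..1}. ((\<lambda>t. normL2 \<mu> (\<lambda>y. F t y - F x y)) \<longlongrightarrow> 0) (at x within {0..1})) \<and>
     (AE x in unit_interval. eqL2 \<mu> (\<lambda>y. f (x, y)) (F x))"

definition P_op ::
  "real measure \<Rightarrow> ((real \<Rightarrow> complex) \<Rightarrow> (real \<Rightarrow> complex)) \<Rightarrow> (real \<times> real) operator" where
  "P_op \<mu> U =
     {(f, g). f \<in> L2 (HH \<mu>) \<and> g \<in> L2 (HH \<mu>) \<and>
        (\<exists>f' F. f' \<in> L2 (HH \<mu>) \<and> distributional_derivative \<mu> f f' \<and>
           continuous_representative \<mu> f F \<and> eqL2 \<mu> (F 1) (U (F 0)) \<and>
           eqL2 (HH \<mu>) g (\<lambda>z. 1 / (\<i> * 2 * of_real pi) * f' z))}"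

definition Q0_op :: "real measure \<Rightarrow> real set \<Rightarrow> (real \<times> real) operator" where
  "Q0_op \<mu> \<Lambda> =
     {(f, g). \<exists>I c h. finite I \<and> I \<subseteq> \<Lambda> \<and> (\<forall>l\<in>I. h l \<in> L2 unit_interval) \<and>
        f = (\<lambda>z. \<Sum>l\<in>I. c l * tensor (h l) (e_fun l) z) \<and>
        g = (\<lambda>z. \<Sum>l\<in>I. of_real l * c l * tensor (h l) (e_fun l) z)}"

definition Q_op :: "real measure \<Rightarrow> real set \<Rightarrow> (real \<times> real) operator" where
  "Q_op \<mu> \<Lambda> = operator_closure (HH \<mu>) (Q0_op \<mu> \<Lambda>)"

end

(*
  If U e_l = e(theta_l) e_l for all l, the functions e((theta_l + n) x) e_l(y) form an orthonormal
  basis of L^2([0,1]) tensor L^2(mu) consisting of joint eigenvectors: Q is the diagonal operator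
  with eigenvalues l, and P_U the one with eigenvalues theta_l + n.  For P_U one inclusion is
  integration by parts against the basis, the other one holds because P_U + i is onto.  Diagonal
  operators with respect to a common basis commute.

  Conversely, the spectral projection F({l}) of Q is the projection onto L^2([0,1]) tensor e_l.
  If it commutes with the spectral measure of P_U, it preserves the domain of P_U, in particular it
  maps the element (1 - x) e_l + x U e_l of this domain to (1 - x + c x) e_l, where
  c = <U e_l, e_l>.  The boundary condition for this function reads U e_l = c e_l.
*)
theory Submission
  imports Defs "HOL-Computational_Algebra.Polynomial" "HOL-Real_Asymp.Real_Asymp"
begin

section \<open>The seminormed space of square integrable functions\<close>

text \<open>\<open>operators_commute\<close> supplies arbitrary spectral measures \<open>E\<close>
  and \<open>F\<close>, known only through domains and quadratic forms. That \<open>F {l}\<close>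
  fixes every function f = g(x) e_l(y) is therefore derived from the quadratic form of Q: evaluated
  at f + F(S) f for bounded S on one side of l, it forces F(S) f = 0. Functions g(x) e_m(y) with m
  different from l are killed because \<open>F {l}\<close> after \<open>F {m}\<close> is
  \<open>F {}\<close>. A projection T commuting with \<open>E\<close> preserves the domain of P_U
  since the norm of E(S) T f is at most that of E(S) f, so the integral of r^2 cannot grow. In the
  other direction the spectral measures are written down in coordinates. Surjectivity of P_U + i is
  an initial value problem with growth exp(2 pi x). On the e_l-coordinate the boundary condition
  asks for division by e(theta_l) - exp(2 pi), whose modulus is at least exp(2 pi) - 1 for all l at
  once. Since a diagonal operator with real eigenvalues is injective after adding i, the inclusion
  of P_U in the diagonal operator is then an equality.\<close>

lemma borel_measurable_cnj [measurable]: "cnj \<in> borel_measurable borel"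
  by (intro borel_measurable_continuous_onI continuous_intros)

lemma L2_D: "f \<in> L2 M \<Longrightarrow> f \<in> borel_measurable M" "f \<in> L2 M \<Longrightarrow> integrable M (\<lambda>x. (cmod (f x))\<^sup>2)"
  by (auto simp: L2_def)

lemma L2_I: "f \<in> borel_measurable M \<Longrightarrow> integrable M (\<lambda>x. (cmod (f x))\<^sup>2) \<Longrightarrow> f \<in> L2 M"
  by (auto simp: L2_def)

lemma L2_bound:
  assumes "f \<in> borel_measurable M" "integrable M g" "\<And>x. x \<in> space M \<Longrightarrow> (cmod (f x))\<^sup>2 \<le> g x"
  shows "f \<in> L2 M"
  using assms by (intro L2_I Bochner_Integration.integrable_bound[OF assms(2)]) (force intro!: AE_I2)+

lemma L2_zero [simp]: "(\<lambda>x. 0) \<in> L2 M"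
  by (simp add: L2_def)

lemma L2_cmult [intro]: "f \<in> L2 M \<Longrightarrow> (\<lambda>x. c * f x) \<in> L2 M"
  by (auto simp: L2_def norm_mult power_mult_distrib)

lemma L2_add [intro]:
  assumes "f \<in> L2 M" "g \<in> L2 M" shows "(\<lambda>x. f x + g x) \<in> L2 M"
proof (rule L2_bound)
  show "integrable M (\<lambda>x. 2 * (cmod (f x))\<^sup>2 + 2 * (cmod (g x))\<^sup>2)"
    using assms by (auto simp: L2_def)
  fix x
  have "(cmod (f x + g x))\<^sup>2 \<le> (cmod (f x) + cmod (g x))\<^sup>2"
    by (simp add: norm_triangle_ineq)
  also have "\<dots> \<le> 2 * (cmod (f x))\<^sup>2 + 2 * (cmod (g x))\<^sup>2"
    using sum_squares_bound[of "cmod (f x)" "cmod (g x)"] by (simp add: power2_sum)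
  finally show "(cmod (f x + g x))\<^sup>2 \<le> 2 * (cmod (f x))\<^sup>2 + 2 * (cmod (g x))\<^sup>2" .
qed (use assms in \<open>auto simp: L2_def\<close>)

lemma L2_diff [intro]: "f \<in> L2 M \<Longrightarrow> g \<in> L2 M \<Longrightarrow> (\<lambda>x. f x - g x) \<in> L2 M"
  using L2_add[of f M "\<lambda>x. (-1) * g x"] L2_cmult[of g M "-1"] by simp

lemma L2_sum [intro]: "(\<And>i. i \<in> K \<Longrightarrow> f i \<in> L2 M) \<Longrightarrow> (\<lambda>x. \<Sum>i\<in>K. f i x) \<in> L2 M"
  by (induction K rule: infinite_finite_induct) auto

lemma L2_cong: 
  assumes "f \<in> L2 M" "g \<in> borel_measurable M" "eqL2 M f g" shows "g \<in> L2 M"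
proof -
  have "integrable M (\<lambda>x. (cmod (g x))\<^sup>2) \<longleftrightarrow> integrable M (\<lambda>x. (cmod (f x))\<^sup>2)"
    using assms by (intro integrable_cong_AE) (auto simp: L2_def eqL2_def)
  then show ?thesis using assms by (simp add: L2_def)
qed

lemma L2_inner_integrable:
  assumes "f \<in> L2 M" "g \<in> L2 M" shows "integrable M (\<lambda>x. f x * cnj (g x))"
proof (rule Bochner_Integration.integrable_bound)
  show "integrable M (\<lambda>x. (cmod (f x))\<^sup>2 + (cmod (g x))\<^sup>2)"
    using assms by (auto simp: L2_def)
  have "cmod (f x * cnj (g x)) \<le> norm ((cmod (f x))\<^sup>2 + (cmod (g x))\<^sup>2)" for x
  proof -
    have "cmod (f x * cnj (g x)) = cmod (f x) * cmod (g x)" by (simp add: norm_mult)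
    also have "\<dots> \<le> 2 * cmod (f x) * cmod (g x)" by simp
    also have "\<dots> \<le> (cmod (f x))\<^sup>2 + (cmod (g x))\<^sup>2" by (rule sum_squares_bound)
    finally show ?thesis by simp
  qed
  then show "AE x in M. cmod (f x * cnj (g x)) \<le> norm ((cmod (f x))\<^sup>2 + (cmod (g x))\<^sup>2)" by simp
qed (use assms in \<open>auto simp: L2_def\<close>)

lemma innerL2_add_left:
  "f \<in> L2 M \<Longrightarrow> g \<in> L2 M \<Longrightarrow> h \<in> L2 M \<Longrightarrow>
    innerL2 M (\<lambda>x. f x + g x) h = innerL2 M f h + innerL2 M g h"
  unfolding innerL2_def distrib_right
  by (intro Bochner_Integration.integral_add L2_inner_integrable)

lemma innerL2_cmult_left: "innerL2 M (\<lambda>x. c * f x) h = c * innerL2 M f h"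
  unfolding innerL2_def by (simp add: mult.assoc)

lemma innerL2_commute: "innerL2 M g f = cnj (innerL2 M f g)"
  unfolding innerL2_def by (subst Bochner_Integration.integral_cnj[symmetric]) (simp add: mult.commute)

lemma innerL2_add_right:
  "f \<in> L2 M \<Longrightarrow> g \<in> L2 M \<Longrightarrow> h \<in> L2 M \<Longrightarrow>
    innerL2 M h (\<lambda>x. f x + g x) = innerL2 M h f + innerL2 M h g"
  by (simp add: innerL2_commute[of M h] innerL2_add_left)

lemma innerL2_cmult_right: "innerL2 M h (\<lambda>x. c * f x) = cnj c * innerL2 M h f"
  by (simp add: innerL2_commute[of M h] innerL2_cmult_left)

lemma innerL2_diff_left:
  "f \<in> L2 M \<Longrightarrow> g \<in> L2 M \<Longrightarrow> h \<in> L2 M \<Longrightarrow>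
    innerL2 M (\<lambda>x. f x - g x) h = innerL2 M f h - innerL2 M g h"
  using innerL2_add_left[of f M "\<lambda>x. (-1) * g x" h] innerL2_cmult_left[of M "-1" g h] L2_cmult[of g M "-1"]
  by simp

lemma innerL2_diff_right:
  "f \<in> L2 M \<Longrightarrow> g \<in> L2 M \<Longrightarrow> h \<in> L2 M \<Longrightarrow>
    innerL2 M h (\<lambda>x. f x - g x) = innerL2 M h f - innerL2 M h g"
  by (simp add: innerL2_commute[of M h] innerL2_diff_left)

lemma innerL2_zero [simp]: "innerL2 M (\<lambda>x. 0) f = 0" "innerL2 M f (\<lambda>x. 0) = 0"
  by (simp_all add: innerL2_def)

lemma innerL2_sum_left:
  "(\<And>i. i \<in> K \<Longrightarrow> f i \<in> L2 M) \<Longrightarrow> h \<in> L2 M \<Longrightarrow>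
    innerL2 M (\<lambda>x. \<Sum>i\<in>K. f i x) h = (\<Sum>i\<in>K. innerL2 M (f i) h)"
  by (induction K rule: infinite_finite_induct) (auto simp: innerL2_add_left L2_sum)

lemma innerL2_sum_right:
  "(\<And>i. i \<in> K \<Longrightarrow> f i \<in> L2 M) \<Longrightarrow> h \<in> L2 M \<Longrightarrow>
    innerL2 M h (\<lambda>x. \<Sum>i\<in>K. f i x) = (\<Sum>i\<in>K. innerL2 M h (f i))"
  by (simp add: innerL2_commute[of M h] innerL2_sum_left)

section \<open>Norms, equality almost everywhere and the Cauchy-Schwarz inequality\<close>

lemma normL2_nonneg [simp]: "0 \<le> normL2 M f"
  by (simp add: normL2_def)

lemma normL2_sq: "(normL2 M f)\<^sup>2 = (LINT x|M. (cmod (f x))\<^sup>2)"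
  by (simp add: normL2_def)

lemma innerL2_self: "innerL2 M f f = of_real ((normL2 M f)\<^sup>2)"
  by (simp add: normL2_sq innerL2_def complex_norm_square[symmetric] flip: integral_complex_of_real)

lemma normL2_sq_inner: "(normL2 M f)\<^sup>2 = Re (innerL2 M f f)"
  by (simp add: innerL2_self)

lemma eqL2_refl [simp]: "eqL2 M f f"
  by (simp add: eqL2_def)

lemma eqL2_sym: "eqL2 M f g \<Longrightarrow> eqL2 M g f"
  by (auto simp: eqL2_def)

lemma eqL2_trans [trans]: "eqL2 M f g \<Longrightarrow> eqL2 M g h \<Longrightarrow> eqL2 M f h"
  unfolding eqL2_def by (erule AE_mp, erule AE_mp) simp

lemma innerL2_cong:
  assumes "f \<in> L2 M" "f' \<in> L2 M" "g \<in> L2 M" "g' \<in> L2 M" "eqL2 M f f'" "eqL2 M g g'"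
  shows "innerL2 M f g = innerL2 M f' g'"
  using assms unfolding innerL2_def eqL2_def L2_def by (intro integral_cong_AE) auto

lemma normL2_cong:
  assumes "f \<in> L2 M" "f' \<in> L2 M" "eqL2 M f f'" shows "normL2 M f = normL2 M f'"
  using assms unfolding normL2_def eqL2_def L2_def by (intro arg_cong[of _ _ sqrt] integral_cong_AE) auto

lemma normL2_eq_0_iff:
  assumes "f \<in> L2 M" shows "normL2 M f = 0 \<longleftrightarrow> eqL2 M f (\<lambda>x. 0)"
  using integral_nonneg_eq_0_iff_AE[OF L2_D(2)[OF assms]] by (simp add: normL2_def eqL2_def)

lemma eqL2_iff_norm_diff:
  assumes "f \<in> L2 M" "g \<in> L2 M" shows "eqL2 M f g \<longleftrightarrow> normL2 M (\<lambda>x. f x - g x) = 0"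
  using normL2_eq_0_iff[OF L2_diff[OF assms]] by (simp add: eqL2_def)

lemma normL2_cmult: "normL2 M (\<lambda>x. c * f x) = cmod c * normL2 M f"
  by (simp add: normL2_def norm_mult power_mult_distrib real_sqrt_mult)

lemma normL2_zero [simp]: "normL2 M (\<lambda>x. 0) = 0"
  by (simp add: normL2_def)

lemma normL2_minus_commute: "normL2 M (\<lambda>x. f x - g x) = normL2 M (\<lambda>x. g x - f x)"
  by (simp add: normL2_def norm_minus_commute)

lemma normL2_sq_add:
  assumes "f \<in> L2 M" "g \<in> L2 M"
  shows "(normL2 M (\<lambda>x. f x + g x))\<^sup>2 = (normL2 M f)\<^sup>2 + (normL2 M g)\<^sup>2 + 2 * Re (innerL2 M f g)"
  using assms innerL2_commute[of M f g] by (simp add: normL2_sq_inner innerL2_add_left innerL2_add_right L2_add)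

lemma normL2_sq_diff:
  assumes "f \<in> L2 M" "g \<in> L2 M"
  shows "(normL2 M (\<lambda>x. f x - g x))\<^sup>2 = (normL2 M f)\<^sup>2 + (normL2 M g)\<^sup>2 - 2 * Re (innerL2 M f g)"
  using assms innerL2_commute[of M f g] by (simp add: normL2_sq_inner innerL2_diff_left innerL2_diff_right L2_diff)

lemma Cauchy_Schwarz:
  assumes f: "f \<in> L2 M" and g: "g \<in> L2 M"
  shows "cmod (innerL2 M f g) \<le> normL2 M f * normL2 M g"
proof (cases "normL2 M g = 0")
  case True
  then have "innerL2 M f g = innerL2 M f (\<lambda>x. 0)"
    using f g by (intro innerL2_cong) (auto simp: normL2_eq_0_iff)
  then show ?thesis by (simp add: True)
next
  case False
  define a where "a = innerL2 M f g"
  define n where "n = (normL2 M g)\<^sup>2"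
  have n: "n > 0" using False by (simp add: n_def)
  \<comment> \<open>\<open>(a / n) * g\<close> is the orthogonal projection of \<open>f\<close> onto
    the line spanned by \<open>g\<close>.\<close>
  have "0 \<le> (normL2 M (\<lambda>x. f x - (a / n) * g x))\<^sup>2" by simp
  also have "\<dots> = (normL2 M f)\<^sup>2 + (normL2 M (\<lambda>x. (a / n) * g x))\<^sup>2 - 2 * Re (innerL2 M f (\<lambda>x. (a / n) * g x))"
    by (intro normL2_sq_diff L2_cmult f g)
  also have "innerL2 M f (\<lambda>x. (a / n) * g x) = of_real ((cmod a)\<^sup>2 / n)"
    using n unfolding innerL2_cmult_right a_def[symmetric] by (simp add: mult.commute flip: complex_norm_square)
  also have "(normL2 M (\<lambda>x. (a / n) * g x))\<^sup>2 = (cmod a)\<^sup>2 / n"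
    using n unfolding normL2_cmult power_mult_distrib n_def[symmetric] norm_divide power_divide
    by (simp add: power2_eq_square)
  finally have "(cmod a)\<^sup>2 / n \<le> (normL2 M f)\<^sup>2" by simp
  then have "(cmod a)\<^sup>2 \<le> (normL2 M f)\<^sup>2 * n"
    using n by (simp add: pos_divide_le_eq)
  then show ?thesis
    unfolding a_def n_def by (metis normL2_nonneg mult_nonneg_nonneg power_mult_distrib power2_le_imp_le)
qed

lemma normL2_triangle:
  assumes f: "f \<in> L2 M" and g: "g \<in> L2 M"
  shows "normL2 M (\<lambda>x. f x + g x) \<le> normL2 M f + normL2 M g"
proof (rule power2_le_imp_le)
  have "Re (innerL2 M f g) \<le> normL2 M f * normL2 M g"
    using Cauchy_Schwarz[OF f g] complex_Re_le_cmod order_trans by blast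
  then show "(normL2 M (\<lambda>x. f x + g x))\<^sup>2 \<le> (normL2 M f + normL2 M g)\<^sup>2"
    by (simp add: normL2_sq_add[OF f g] power2_sum)
qed simp

lemma normL2_triangle_diff:
  assumes "f \<in> L2 M" "g \<in> L2 M" "h \<in> L2 M"
  shows "normL2 M (\<lambda>x. f x - h x) \<le> normL2 M (\<lambda>x. f x - g x) + normL2 M (\<lambda>x. g x - h x)"
  using normL2_triangle[OF L2_diff[OF assms(1,2)] L2_diff[OF assms(2,3)]] by simp

lemma innerL2_tendsto_left:
  assumes "\<And>n. s n \<in> L2 M" "f \<in> L2 M" "h \<in> L2 M"
    and "((\<lambda>n. normL2 M (\<lambda>x. s n x - f x)) \<longlongrightarrow> 0) net"
  shows "((\<lambda>n. innerL2 M (s n) h) \<longlongrightarrow> innerL2 M f h) net"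
proof (rule LIM_zero_cancel, rule Lim_null_comparison)
  show "\<forall>\<^sub>F n in net. cmod (innerL2 M (s n) h - innerL2 M f h) \<le> normL2 M (\<lambda>x. s n x - f x) * normL2 M h"
    using Cauchy_Schwarz[OF L2_diff[OF assms(1) assms(2)] assms(3)] assms(1-3)
    by (intro always_eventually allI) (simp add: innerL2_diff_left)
  show "((\<lambda>n. normL2 M (\<lambda>x. s n x - f x) * normL2 M h) \<longlongrightarrow> 0) net"
    using tendsto_mult_left_zero[OF assms(4)] .
qed

text \<open>The epsilon form matches \<open>operator_closure\<close>, which supplies approximants
  without a sequence; through it an orthogonality relation valid on \<open>Q0_op\<close> passes to
  \<open>Q_op\<close>.\<close>

lemma innerL2_approx:
  assumes "f \<in> L2 M" "h \<in> L2 M" "\<And>\<epsilon>. \<epsilon> > 0 \<Longrightarrow> \<exists>g\<in>L2 M. normL2 M (\<lambda>x. f x - g x) < \<epsilon> \<and> innerL2 M g h = 0"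
  shows "innerL2 M f h = 0"
proof (rule ccontr)
  assume ne: "innerL2 M f h \<noteq> 0"
  \<comment> \<open>The \<open>+ 1\<close> keeps the denominator positive when \<open>h\<close> has
    norm 0 and makes the last estimate strict.\<close>
  define d where "d = cmod (innerL2 M f h) / (normL2 M h + 1)"
  have pos: "normL2 M h + 1 > 0" using normL2_nonneg[of M h] by linarith
  have "d > 0" unfolding d_def using ne pos by simp
  then obtain g where g: "g \<in> L2 M" "normL2 M (\<lambda>x. f x - g x) < d" "innerL2 M g h = 0"
    using assms(3) by blast
  have "cmod (innerL2 M f h) = cmod (innerL2 M (\<lambda>x. f x - g x) h)"
    using g assms by (simp add: innerL2_diff_left)
  also have "\<dots> \<le> normL2 M (\<lambda>x. f x - g x) * normL2 M h"
    using g assms by (intro Cauchy_Schwarz) auto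
  also have "\<dots> \<le> d * normL2 M h" using g by (intro mult_right_mono) auto
  also have "\<dots> < d * (normL2 M h + 1)" using \<open>d > 0\<close> by simp
  also have "\<dots> = cmod (innerL2 M f h)" using pos by (simp add: d_def)
  finally show False by simp
qed

text \<open>Cauchy-Schwarz against the constant 1, which has norm 1 because the measure is a
  probability.\<close>

lemma (in prob_space) L1_norm_le:
  assumes f: "f \<in> L2 M" shows "integrable M f" "(LINT x|M. cmod (f x)) \<le> normL2 M f"
proof -
  have 1: "(\<lambda>x. 1) \<in> L2 M" and 2: "(\<lambda>x. of_real (cmod (f x))) \<in> L2 M"
    using f by (auto simp: L2_def)
  have n: "normL2 M (\<lambda>x. 1) = 1" by (simp add: normL2_def prob_space)
  show "integrable M f" using L2_inner_integrable[OF f 1] by simp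
  have "(LINT x|M. cmod (f x)) = Re (innerL2 M (\<lambda>x. of_real (cmod (f x))) (\<lambda>x. 1))"
    by (simp add: innerL2_def)
  also have "\<dots> \<le> cmod (innerL2 M (\<lambda>x. of_real (cmod (f x))) (\<lambda>x. 1))" by (rule complex_Re_le_cmod)
  also have "\<dots> \<le> normL2 M (\<lambda>x. of_real (cmod (f x))) * 1"
    using Cauchy_Schwarz[OF 2 1] n by simp
  finally show "(LINT x|M. cmod (f x)) \<le> normL2 M f" by (simp add: normL2_def)
qed

lemma (in prob_space) L2_bounded:
  assumes "f \<in> borel_measurable M" "\<And>x. x \<in> space M \<Longrightarrow> cmod (f x) \<le> C" shows "f \<in> L2 M"
  using assms by (intro L2_bound[where g = "\<lambda>_. C\<^sup>2"]) (auto simp: power_mono)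

text \<open>The increments are summable in L1 by \<open>L1_norm_le\<close>, so the sequence
  converges almost everywhere; Fatou's lemma upgrades this to convergence in norm.
  \<open>Riesz_Fischer\<close> produces sequences with such geometric increments.\<close>

lemma (in prob_space) L2_complete:
  assumes s: "\<And>n. s n \<in> L2 M" and d: "\<And>n. normL2 M (\<lambda>x. s (Suc n) x - s n x) \<le> (1/2)^n"
  shows "\<exists>g\<in>L2 M. (\<lambda>n. normL2 M (\<lambda>x. s n x - g x)) \<longlonglongrightarrow> 0"
proof -
  have [measurable]: "s n \<in> borel_measurable M" for n using s by (simp add: L2_def)
  define D where "D n x = cmod (s (Suc n) x - s n x)" for n x
  have [measurable]: "D n \<in> borel_measurable M" for n unfolding D_def by measurable
  have "(\<integral>\<^sup>+x. (\<Sum>n. ennreal (D n x)) \<partial>M) = (\<Sum>n. \<integral>\<^sup>+x. ennreal (D n x) \<partial>M)"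
    by (intro nn_integral_suminf) auto
  also have "\<dots> \<le> (\<Sum>n. ennreal ((1/2)^n))"
  proof (intro suminf_le)
    fix n
    have df: "(\<lambda>x. s (Suc n) x - s n x) \<in> L2 M" using s by auto
    show "(\<integral>\<^sup>+x. ennreal (D n x) \<partial>M) \<le> ennreal ((1/2)^n)"
      using L1_norm_le[OF df] d[of n] unfolding D_def
      by (subst nn_integral_eq_integral) (auto intro!: ennreal_leI)
  qed auto
  also have "\<dots> = ennreal (\<Sum>n. (1/2)^n)"
    by (intro suminf_ennreal_eq) (auto intro!: summable_sums)
  also have "\<dots> < \<infinity>" by simp
  finally have "AE x in M. (\<Sum>n. ennreal (D n x)) \<noteq> \<infinity>"
    by (intro nn_integral_noteq_infinite) auto
  then have conv: "AE x in M. (\<lambda>n. s n x) \<longlonglongrightarrow> lim (\<lambda>n. s n x)"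
  proof eventually_elim
    case (elim x)
    then have "summable (\<lambda>n. D n x)"
      by (intro summable_suminf_not_top) (auto simp: D_def)
    then have "summable (\<lambda>n. s (Suc n) x - s n x)"
      unfolding D_def by (rule summable_norm_cancel)
    then have "convergent (\<lambda>n. \<Sum>k<n. s (Suc k) x - s k x)"
      by (simp add: summable_iff_convergent)
    then have "convergent (\<lambda>n. s n x - s 0 x)"
      by (simp only: sum_lessThan_telescope[of "\<lambda>n. s n x"])
    then have "convergent (\<lambda>n. s n x)"
      using convergent_diff_const_right_iff by blast
    then show ?case by (simp add: convergent_LIMSEQ_iff)
  qed
  \<comment> \<open>On the null set of divergence \<open>lim\<close> returns an unspecified value;
    \<open>g\<close> is nevertheless measurable.\<close>
  define g where "g x = lim (\<lambda>n. s n x)" for x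
  have [measurable]: "g \<in> borel_measurable M" unfolding g_def by measurable
  have tail: "normL2 M (\<lambda>x. s (n + k) x - s n x) \<le> 2 * (1/2)^n" for n k
  proof -
    have "normL2 M (\<lambda>x. s (n + k) x - s n x) \<le> (\<Sum>j<k. (1/2)^(n+j))"
    proof (induction k)
      case (Suc k)
      have "normL2 M (\<lambda>x. s (n + Suc k) x - s n x) \<le>
        normL2 M (\<lambda>x. s (Suc (n + k)) x - s (n+k) x) + normL2 M (\<lambda>x. s (n + k) x - s n x)"
        using normL2_triangle_diff[OF s s s, of "Suc (n+k)" n "n+k"] by simp
      then show ?case using Suc d[of "n+k"] by simp
    qed simp
    also have "\<dots> = (1/2)^n * (\<Sum>j<k. (1/2)^j)" by (simp add: power_add sum_distrib_left)
    also have "(\<Sum>j<k. (1/2::real)^j) \<le> (\<Sum>j. (1/2)^j)" by (intro sum_le_suminf) auto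
    also have "(\<Sum>j. (1/2::real)^j) = 2" by (subst suminf_geometric) auto
    finally show ?thesis by (simp add: mult.commute)
  qed
  \<comment> \<open>For fixed \<open>n\<close>, |g - s n|^2 is almost everywhere the limit in
    \<open>k\<close> of |s (n + k) - s n|^2, and \<open>tail\<close> bounds the integrals of the
    latter uniformly in \<open>k\<close>.\<close>
  have fatou: "(\<integral>\<^sup>+x. ennreal ((cmod (g x - s n x))\<^sup>2) \<partial>M) \<le> ennreal ((2 * (1/2)^n)\<^sup>2)" for n
  proof -
    have "(\<integral>\<^sup>+x. ennreal ((cmod (g x - s n x))\<^sup>2) \<partial>M) =
      (\<integral>\<^sup>+x. liminf (\<lambda>k. ennreal ((cmod (s (n + k) x - s n x))\<^sup>2)) \<partial>M)"
    proof (rule nn_integral_cong_AE, use conv in eventually_elim)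
      case (elim x)
      have "(\<lambda>k. s (n + k) x) \<longlonglongrightarrow> g x"
        using LIMSEQ_ignore_initial_segment[OF elim, of n] by (simp add: g_def add.commute)
      then have "(\<lambda>k. ennreal ((cmod (s (n + k) x - s n x))\<^sup>2)) \<longlonglongrightarrow> ennreal ((cmod (g x - s n x))\<^sup>2)"
        by (intro tendsto_intros)
      then show ?case by (intro lim_imp_Liminf[symmetric]) simp_all
    qed
    also have "\<dots> \<le> liminf (\<lambda>k. \<integral>\<^sup>+x. ennreal ((cmod (s (n + k) x - s n x))\<^sup>2) \<partial>M)"
      by (rule nn_integral_liminf) auto
    also have "\<dots> \<le> liminf (\<lambda>k. ennreal ((2 * (1/2)^n)\<^sup>2))"
    proof (intro Liminf_mono always_eventually allI)
      fix k
      have df: "(\<lambda>x. s (n + k) x - s n x) \<in> L2 M" using s by auto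
      show "(\<integral>\<^sup>+x. ennreal ((cmod (s (n + k) x - s n x))\<^sup>2) \<partial>M) \<le> ennreal ((2 * (1/2)^n)\<^sup>2)"
        using L2_D(2)[OF df]
        by (subst nn_integral_eq_integral, simp, simp, unfold normL2_sq[symmetric])
          (intro ennreal_leI power_mono tail normL2_nonneg)
    qed
    also have "\<dots> = ennreal ((2 * (1/2)^n)\<^sup>2)" by (simp add: Liminf_const)
    finally show ?thesis .
  qed
  have dif: "(\<lambda>x. g x - s n x) \<in> L2 M" for n
    using fatou[of n] by (intro L2_I) (auto simp: integrable_iff_bounded less_top[symmetric] top_unique)
  have g: "g \<in> L2 M" using L2_add[OF dif[of 0] s[of 0]] by simp
  have "normL2 M (\<lambda>x. s n x - g x) \<le> 2 * (1/2)^n" for n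
  proof (rule power2_le_imp_le)
    have "ennreal ((normL2 M (\<lambda>x. g x - s n x))\<^sup>2) = (\<integral>\<^sup>+x. ennreal ((cmod (g x - s n x))\<^sup>2) \<partial>M)"
      unfolding normL2_sq using L2_D(2)[OF dif] by (subst nn_integral_eq_integral) auto
    with fatou[of n] have "ennreal ((normL2 M (\<lambda>x. g x - s n x))\<^sup>2) \<le> ennreal ((2 * (1/2)^n)\<^sup>2)" by simp
    then show "(normL2 M (\<lambda>x. s n x - g x))\<^sup>2 \<le> (2 * (1/2)^n)\<^sup>2"
      by (subst normL2_minus_commute) (simp add: ennreal_le_iff)
  qed simp
  moreover have "(\<lambda>n. 2 * (1/2::real)^n) \<longlonglongrightarrow> 0"
    using tendsto_mult_right_zero[OF LIMSEQ_power_zero[of "1/2::real"]] by simp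
  ultimately have "(\<lambda>n. normL2 M (\<lambda>x. s n x - g x)) \<longlonglongrightarrow> 0"
    by (intro Lim_null_comparison[of "\<lambda>n. normL2 M (\<lambda>x. s n x - g x)" "\<lambda>n. 2 * (1/2)^n"]) auto
  with g show ?thesis by blast
qed

section \<open>Orthonormal bases\<close>

text \<open>\<open>orthonormal_basis\<close> without the approximation clause, so that Bessel and
  Riesz-Fischer are at hand while completeness of a system is still to be shown.\<close>

definition orthonormal :: "'a measure \<Rightarrow> 'i set \<Rightarrow> ('i \<Rightarrow> 'a \<Rightarrow> complex) \<Rightarrow> bool" where
  "orthonormal M I b \<longleftrightarrow> (\<forall>i\<in>I. b i \<in> L2 M) \<and>
     (\<forall>i\<in>I. \<forall>j\<in>I. innerL2 M (b i) (b j) = (if i = j then 1 else 0))"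

lemma orthonormal_L2: "orthonormal M I b \<Longrightarrow> i \<in> I \<Longrightarrow> b i \<in> L2 M"
  by (simp add: orthonormal_def)

lemma onb_orthonormal: "orthonormal_basis M I b \<Longrightarrow> orthonormal M I b"
  by (simp add: orthonormal_basis_def orthonormal_def)

lemma onb_L2: "orthonormal_basis M I b \<Longrightarrow> i \<in> I \<Longrightarrow> b i \<in> L2 M"
  by (simp add: orthonormal_basis_def)

lemma onb_approx:
  assumes "orthonormal_basis M I b" "f \<in> L2 M" "\<epsilon> > 0"
  shows "\<exists>K c. finite K \<and> K \<subseteq> I \<and> normL2 M (\<lambda>x. f x - (\<Sum>i\<in>K. c i * b i x)) < \<epsilon>"
proof -
  have "\<forall>f\<in>L2 M. \<forall>\<epsilon>>0. \<exists>K c. finite K \<and> K \<subseteq> I \<and> normL2 M (\<lambda>x. f x - (\<Sum>i\<in>K. c i * b i x)) < \<epsilon>"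
    using assms(1) unfolding orthonormal_basis_def by (elim conjE)
  from this[rule_format, OF assms(2,3)] show ?thesis .
qed

lemma lincomb_L2: "orthonormal M I b \<Longrightarrow> K \<subseteq> I \<Longrightarrow> (\<lambda>x. \<Sum>i\<in>K. c i * b i x) \<in> L2 M"
  by (intro L2_sum L2_cmult) (auto intro: orthonormal_L2)

lemma inner_lincomb:
  assumes "orthonormal M I b" "finite K" "K \<subseteq> I" "j \<in> I"
  shows "innerL2 M (\<lambda>x. \<Sum>i\<in>K. c i * b i x) (b j) = (if j \<in> K then c j else 0)"
proof -
  have "innerL2 M (\<lambda>x. \<Sum>i\<in>K. c i * b i x) (b j) = (\<Sum>i\<in>K. c i * innerL2 M (b i) (b j))"
    using assms by (subst innerL2_sum_left) (auto intro: orthonormal_L2 simp: innerL2_cmult_left)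
  also have "\<dots> = (\<Sum>i\<in>K. if i = j then c j else 0)"
    using assms by (intro sum.cong refl) (auto simp: orthonormal_def)
  finally show ?thesis using assms by simp
qed

lemma norm_sq_lincomb:
  assumes "orthonormal M I b" "finite K" "K \<subseteq> I"
  shows "(normL2 M (\<lambda>x. \<Sum>i\<in>K. c i * b i x))\<^sup>2 = (\<Sum>i\<in>K. (cmod (c i))\<^sup>2)"
proof -
  have "innerL2 M (\<lambda>x. \<Sum>i\<in>K. c i * b i x) (\<lambda>x. \<Sum>i\<in>K. c i * b i x) =
      (\<Sum>j\<in>K. cnj (c j) * innerL2 M (\<lambda>x. \<Sum>i\<in>K. c i * b i x) (b j))"
    using assms lincomb_L2[OF assms(1,3), of c]
    by (subst innerL2_sum_right) (auto intro: orthonormal_L2 simp: innerL2_cmult_right)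
  also have "\<dots> = (\<Sum>j\<in>K. cnj (c j) * c j)"
    using assms by (intro sum.cong refl) (auto simp: inner_lincomb subset_iff)
  also have "\<dots> = of_real (\<Sum>i\<in>K. (cmod (c i))\<^sup>2)"
    unfolding of_real_sum complex_norm_square by (simp add: mult.commute)
  finally show ?thesis unfolding normL2_sq_inner by simp
qed

text \<open>By \<open>inner_lincomb\<close> the Fourier sum has the same inner product with each
  \<open>b j\<close> as \<open>f\<close>. The free coefficients \<open>c\<close> allow both the
  Fourier sum itself, for \<open>norm_sq_residual\<close>, and a difference of two combinations, for
  \<open>best_approximation\<close>.\<close>

lemma inner_residual_lincomb:
  assumes on: "orthonormal M I b" and K: "finite K" "K \<subseteq> I" and f: "f \<in> L2 M"
  shows "innerL2 M (\<lambda>x. f x - (\<Sum>i\<in>K. innerL2 M f (b i) * b i x)) (\<lambda>x. \<Sum>i\<in>K. c i * b i x) = 0"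
proof -
  let ?s = "\<lambda>x. \<Sum>i\<in>K. innerL2 M f (b i) * b i x"
  have s: "?s \<in> L2 M" by (rule lincomb_L2[OF on K(2)])
  have "innerL2 M (\<lambda>x. f x - ?s x) (\<lambda>x. \<Sum>i\<in>K. c i * b i x) =
     (\<Sum>j\<in>K. cnj (c j) * innerL2 M (\<lambda>x. f x - ?s x) (b j))"
    using on K f s by (subst innerL2_sum_right) (auto intro: orthonormal_L2 simp: innerL2_cmult_right)
  also have "\<dots> = 0"
  proof (intro sum.neutral ballI)
    fix j assume j: "j \<in> K"
    have "innerL2 M (\<lambda>x. f x - ?s x) (b j) = innerL2 M f (b j) - innerL2 M ?s (b j)"
      using on K j f s by (intro innerL2_diff_left orthonormal_L2[OF on]) auto
    also have "\<dots> = 0" using inner_lincomb[OF on K, of j "\<lambda>i. innerL2 M f (b i)"] K j by auto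
    finally show "cnj (c j) * innerL2 M (\<lambda>x. f x - ?s x) (b j) = 0" by simp
  qed
  finally show ?thesis .
qed

lemma norm_sq_residual:
  assumes on: "orthonormal M I b" and K: "finite K" "K \<subseteq> I" and f: "f \<in> L2 M"
  shows "(normL2 M (\<lambda>x. f x - (\<Sum>i\<in>K. innerL2 M f (b i) * b i x)))\<^sup>2 =
     (normL2 M f)\<^sup>2 - (\<Sum>i\<in>K. (cmod (innerL2 M f (b i)))\<^sup>2)"
proof -
  let ?s = "\<lambda>x. \<Sum>i\<in>K. innerL2 M f (b i) * b i x"
  have s: "?s \<in> L2 M" by (rule lincomb_L2[OF on K(2)])
  have "(normL2 M (\<lambda>x. (f x - ?s x) + ?s x))\<^sup>2 = (normL2 M (\<lambda>x. f x - ?s x))\<^sup>2 + (normL2 M ?s)\<^sup>2"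
    using normL2_sq_add[OF L2_diff[OF f s] s] inner_residual_lincomb[OF on K f, of "\<lambda>i. innerL2 M f (b i)"]
    by simp
  then show ?thesis using norm_sq_lincomb[OF on K, of "\<lambda>i. innerL2 M f (b i)"] by simp
qed

lemma Bessel:
  assumes "orthonormal M I b" "finite K" "K \<subseteq> I" "f \<in> L2 M"
  shows "(\<Sum>i\<in>K. (cmod (innerL2 M f (b i)))\<^sup>2) \<le> (normL2 M f)\<^sup>2"
  using norm_sq_residual[OF assms]
    zero_le_power2[of "normL2 M (\<lambda>x. f x - (\<Sum>i\<in>K. innerL2 M f (b i) * b i x))"] by linarith

text \<open>Pythagoras: a change of coefficients adds a combination orthogonal to the residual. This
  replaces the unspecified coefficients in \<open>orthonormal_basis\<close> by Fourier
  coefficients.\<close>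

lemma best_approximation:
  assumes on: "orthonormal M I b" and K: "finite K" "K \<subseteq> I" and f: "f \<in> L2 M"
  shows "normL2 M (\<lambda>x. f x - (\<Sum>i\<in>K. innerL2 M f (b i) * b i x)) \<le>
     normL2 M (\<lambda>x. f x - (\<Sum>i\<in>K. c i * b i x))"
proof (rule power2_le_imp_le)
  let ?s = "\<lambda>x. \<Sum>i\<in>K. innerL2 M f (b i) * b i x"
  let ?t = "\<lambda>x. \<Sum>i\<in>K. (innerL2 M f (b i) - c i) * b i x"
  have s: "?s \<in> L2 M" and t: "?t \<in> L2 M" by (rule lincomb_L2[OF on K(2)])+
  have "(normL2 M (\<lambda>x. (f x - ?s x) + ?t x))\<^sup>2 = (normL2 M (\<lambda>x. f x - ?s x))\<^sup>2 + (normL2 M ?t)\<^sup>2"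
    using normL2_sq_add[OF L2_diff[OF f s] t] inner_residual_lincomb[OF on K f] by simp
  also have "(\<lambda>x. (f x - ?s x) + ?t x) = (\<lambda>x. f x - (\<Sum>i\<in>K. c i * b i x))"
    by (simp add: sum_subtractf left_diff_distrib)
  finally show "(normL2 M (\<lambda>x. f x - ?s x))\<^sup>2 \<le> (normL2 M (\<lambda>x. f x - (\<Sum>i\<in>K. c i * b i x)))\<^sup>2"
    by simp
qed simp

text \<open>No enumeration of \<open>I\<close> is available, so the partial sums run over increasing
  finite sets whose energy approaches the supremum \<open>A\<close>. An index left out of such a set
  must have a small coefficient, so in the limit all coefficients come out right.\<close>

lemma (in prob_space) Riesz_Fischer:
  assumes on: "orthonormal M I b"
    and bd: "\<And>K. finite K \<Longrightarrow> K \<subseteq> I \<Longrightarrow> (\<Sum>i\<in>K. (cmod (a i))\<^sup>2) \<le> C"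
  shows "\<exists>g\<in>L2 M. (\<forall>i\<in>I. innerL2 M g (b i) = a i) \<and>
    (\<forall>\<epsilon>>0. \<exists>K. finite K \<and> K \<subseteq> I \<and> normL2 M (\<lambda>x. g x - (\<Sum>i\<in>K. a i * b i x)) < \<epsilon>)"
proof -
  define S where "S K = (\<Sum>i\<in>K. (cmod (a i))\<^sup>2)" for K
  define \<F> where "\<F> = {K. finite K \<and> K \<subseteq> I}"
  define A where "A = (SUP K\<in>\<F>. S K)"
  have bdd: "bdd_above (S ` \<F>)" using bd by (auto simp: bdd_above_def S_def \<F>_def)
  have ne: "S ` \<F> \<noteq> {}" by (auto simp: \<F>_def)
  have le: "S K \<le> A" if "K \<in> \<F>" for K
    unfolding A_def using bdd that by (rule cSUP_upper2) auto
  have "\<exists>K\<in>\<F>. A - (1/4)^n < S K" for n :: nat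
    using less_cSUP_iff[OF _ bdd, of "A - (1/4)^n"] ne unfolding A_def[symmetric] by auto
  then obtain K' where K': "\<And>n. K' n \<in> \<F>" "\<And>n::nat. A - (1/4)^n < S (K' n)" by metis
  \<comment> \<open>An energy gap of (1/4)^n is a norm gap of (1/2)^n, the rate that
    \<open>L2_complete\<close> asks for.\<close>
  have quarter: "(1/4)^n = ((1/2::real)^n)\<^sup>2" for n
    by (induction n) (auto simp: power2_eq_square)
  \<comment> \<open>The unions make the sets increase, so that consecutive sums differ by a sum over
    \<open>K (Suc n) - K n\<close>.\<close>
  define K where "K n = (\<Union>m\<le>n. K' m)" for n
  have K: "K n \<in> \<F>" for n using K'(1) by (auto simp: K_def \<F>_def)
  then have fin: "finite (K n)" and sub: "K n \<subseteq> I" for n by (auto simp: \<F>_def)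
  have mono: "K n \<subseteq> K (Suc n)" for n unfolding K_def by (intro UN_mono) auto
  have big: "A - (1/4)^n < S (K n)" for n
  proof -
    have "S (K' n) \<le> S (K n)" unfolding S_def using fin by (intro sum_mono2) (auto simp: K_def)
    with K'(2)[of n] show ?thesis by linarith
  qed
  define s where "s n = (\<lambda>x. \<Sum>i\<in>K n. a i * b i x)" for n
  have s: "s n \<in> L2 M" for n unfolding s_def by (rule lincomb_L2[OF on sub])
  have d: "normL2 M (\<lambda>x. s (Suc n) x - s n x) \<le> (1/2)^n" for n
  proof (rule power2_le_imp_le)
    have "(\<lambda>x. s (Suc n) x - s n x) = (\<lambda>x. \<Sum>i\<in>K (Suc n) - K n. a i * b i x)"
      unfolding s_def using fin mono by (simp add: sum_diff)
    moreover have "finite (K (Suc n) - K n)" "K (Suc n) - K n \<subseteq> I" using fin sub by blast+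
    ultimately have "(normL2 M (\<lambda>x. s (Suc n) x - s n x))\<^sup>2 = S (K (Suc n) - K n)"
      using norm_sq_lincomb[OF on, of "K (Suc n) - K n" a] by (simp only: S_def)
    also have "\<dots> = S (K (Suc n)) - S (K n)" unfolding S_def using fin mono by (simp add: sum_diff)
    also have "\<dots> \<le> (1/4)^n" using le[OF K, of "Suc n"] big[of n] by linarith
    also have "\<dots> = ((1/2)^n)\<^sup>2" by (rule quarter)
    finally show "(normL2 M (\<lambda>x. s (Suc n) x - s n x))\<^sup>2 \<le> ((1/2)^n)\<^sup>2" .
  qed simp
  obtain g where g: "g \<in> L2 M" and lim: "(\<lambda>n. normL2 M (\<lambda>x. s n x - g x)) \<longlonglongrightarrow> 0"
    using L2_complete[of s, OF s d] by blast
  have "innerL2 M g (b i) = a i" if i: "i \<in> I" for i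
  proof (rule LIMSEQ_unique)
    show "(\<lambda>n. innerL2 M (s n) (b i)) \<longlonglongrightarrow> innerL2 M g (b i)"
      by (intro innerL2_tendsto_left s g lim orthonormal_L2[OF on i])
    have nb: "norm (innerL2 M (s n) (b i) - a i) \<le> (1/2)^n" for n
    proof (cases "i \<in> K n")
      case True
      then show ?thesis using inner_lincomb[OF on fin sub i] by (simp add: s_def)
    next
      case False
      \<comment> \<open>\<open>insert i (K n)\<close> still has energy at most \<open>A\<close>, so
        the left-out coefficient fits into the gap.\<close>
      have "(cmod (a i))\<^sup>2 + S (K n) = S (insert i (K n))" using False fin by (simp add: S_def)
      also have "\<dots> \<le> A" using K i by (intro le) (auto simp: \<F>_def)
      finally have "(cmod (a i))\<^sup>2 \<le> (1/4)^n" using big[of n] by linarith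
      also have "\<dots> = ((1/2)^n)\<^sup>2" by (rule quarter)
      finally have "cmod (a i) \<le> (1/2)^n" by (rule power2_le_imp_le) simp
      then show ?thesis using False inner_lincomb[OF on fin sub i] by (simp add: s_def)
    qed
    have "(\<lambda>n. (1/2::real)^n) \<longlonglongrightarrow> 0" by (rule LIMSEQ_power_zero) simp
    then have "(\<lambda>n. innerL2 M (s n) (b i) - a i) \<longlonglongrightarrow> 0"
      by (rule Lim_null_comparison[rotated]) (rule always_eventually[rule_format, OF nb])
    then show "(\<lambda>n. innerL2 M (s n) (b i)) \<longlonglongrightarrow> a i" by (rule LIM_zero_cancel)
  qed
  moreover have "\<exists>K. finite K \<and> K \<subseteq> I \<and> normL2 M (\<lambda>x. g x - (\<Sum>i\<in>K. a i * b i x)) < \<epsilon>" if "\<epsilon> > 0" for \<epsilon>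
  proof -
    have "eventually (\<lambda>n. normL2 M (\<lambda>x. s n x - g x) < \<epsilon>) sequentially"
      using order_tendstoD(2)[OF lim that] .
    then obtain n where "normL2 M (\<lambda>x. s n x - g x) < \<epsilon>" by (auto simp: eventually_sequentially)
    then show ?thesis using fin sub by (intro exI[of _ "K n"]) (simp add: s_def normL2_minus_commute)
  qed
  ultimately show ?thesis using g by blast
qed

text \<open>Riesz-Fischer yields a limit \<open>g\<close> of finite combinations with the Fourier
  coefficients of \<open>f\<close>; totality applied to \<open>f - g\<close> identifies the
  two.\<close>

lemma (in prob_space) onb_if_total:
  assumes on: "orthonormal M I b"
    and total: "\<And>g. g \<in> L2 M \<Longrightarrow> (\<And>i. i \<in> I \<Longrightarrow> innerL2 M g (b i) = 0) \<Longrightarrow> eqL2 M g (\<lambda>x. 0)"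
  shows "orthonormal_basis M I b"
proof -
  have "\<exists>K c. finite K \<and> K \<subseteq> I \<and> normL2 M (\<lambda>x. f x - (\<Sum>i\<in>K. c i * b i x)) < \<epsilon>"
    if f: "f \<in> L2 M" and \<epsilon>: "\<epsilon> > 0" for f \<epsilon>
  proof -
    have bd: "\<And>K. finite K \<Longrightarrow> K \<subseteq> I \<Longrightarrow> (\<Sum>i\<in>K. (cmod (innerL2 M f (b i)))\<^sup>2) \<le> (normL2 M f)\<^sup>2"
      by (rule Bessel[OF on _ _ f])
    obtain g where g: "g \<in> L2 M"
      and gi: "\<forall>i\<in>I. innerL2 M g (b i) = innerL2 M f (b i)"
      and ge: "\<forall>\<epsilon>>0. \<exists>K. finite K \<and> K \<subseteq> I \<and> normL2 M (\<lambda>x. g x - (\<Sum>i\<in>K. innerL2 M f (b i) * b i x)) < \<epsilon>"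
      using Riesz_Fischer[of I b "\<lambda>i. innerL2 M f (b i)" "(normL2 M f)\<^sup>2", OF on] bd by blast
    from ge \<epsilon> obtain K where K: "finite K" "K \<subseteq> I"
      "normL2 M (\<lambda>x. g x - (\<Sum>i\<in>K. innerL2 M f (b i) * b i x)) < \<epsilon>" by meson
    have "eqL2 M (\<lambda>x. f x - g x) (\<lambda>x. 0)"
    proof (rule total)
      show "(\<lambda>x. f x - g x) \<in> L2 M" using f g by (rule L2_diff)
      show "innerL2 M (\<lambda>x. f x - g x) (b i) = 0" if "i \<in> I" for i
        using innerL2_diff_left[OF f g orthonormal_L2[OF on that]] gi that by simp
    qed
    then have "normL2 M (\<lambda>x. f x - (\<Sum>i\<in>K. innerL2 M f (b i) * b i x)) =
       normL2 M (\<lambda>x. g x - (\<Sum>i\<in>K. innerL2 M f (b i) * b i x))"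
      by (intro normL2_cong L2_diff f g lincomb_L2[OF on K(2)]) (simp add: eqL2_def)
    with K show ?thesis by (intro exI[of _ K] exI[of _ "\<lambda>i. innerL2 M f (b i)"]) simp
  qed
  then have "\<forall>f\<in>L2 M. \<forall>\<epsilon>>0. \<exists>K c. finite K \<and> K \<subseteq> I \<and> normL2 M (\<lambda>x. f x - (\<Sum>i\<in>K. c i * b i x)) < \<epsilon>"
    by (intro ballI allI impI)
  then show ?thesis using on unfolding orthonormal_basis_def orthonormal_def by (intro conjI) simp_all
qed

text \<open>For \<open>f - g\<close> the zero function is the best approximation from every finite
  set of indices, yet approximations are arbitrarily good. Many equalities in L2 below are proved
  through this lemma by comparing coefficients.\<close>

lemma onb_eqI:
  assumes onb: "orthonormal_basis M I b" and f: "f \<in> L2 M" and g: "g \<in> L2 M"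
    and eq: "\<And>i. i \<in> I \<Longrightarrow> innerL2 M f (b i) = innerL2 M g (b i)"
  shows "eqL2 M f g"
proof -
  let ?d = "\<lambda>x. f x - g x"
  have d: "?d \<in> L2 M" using f g by (rule L2_diff)
  have c: "innerL2 M ?d (b i) = 0" if "i \<in> I" for i
    using that eq onb_L2[OF onb that] f g by (simp add: innerL2_diff_left)
  have "normL2 M ?d < \<epsilon>" if "\<epsilon> > 0" for \<epsilon>
  proof -
    obtain K a where K: "finite K" "K \<subseteq> I" "normL2 M (\<lambda>x. ?d x - (\<Sum>i\<in>K. a i * b i x)) < \<epsilon>"
      using onb_approx[OF onb d \<open>\<epsilon> > 0\<close>] by (elim exE conjE)
    have "(\<Sum>i\<in>K. innerL2 M ?d (b i) * b i x) = 0" for x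
      using K c by (intro sum.neutral) auto
    then have "normL2 M ?d \<le> normL2 M (\<lambda>x. ?d x - (\<Sum>i\<in>K. a i * b i x))"
      using best_approximation[OF onb_orthonormal[OF onb] K(1,2) d, of a] by simp
    with K show ?thesis by simp
  qed
  from this[of "normL2 M ?d"] have "\<not> 0 < normL2 M ?d" by (meson less_irrefl)
  then have "normL2 M ?d = 0" using normL2_nonneg[of M ?d] by linarith
  then show ?thesis using f g by (simp add: eqL2_iff_norm_diff)
qed

text \<open>Residuals decrease as the finite set grows, so the whole net of finite subsets
  converges. The net also allows one finite set to serve two expansions at once, as in
  \<open>Q_op_eq_diag_op\<close>.\<close>

lemma onb_expansion:
  assumes onb: "orthonormal_basis M I b" and f: "f \<in> L2 M"
  shows "((\<lambda>K. normL2 M (\<lambda>x. f x - (\<Sum>i\<in>K. innerL2 M f (b i) * b i x))) \<longlongrightarrow> 0) (finite_subsets_at_top I)"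
proof (rule tendstoI)
  fix \<epsilon> :: real assume "\<epsilon> > 0"
  note on = onb_orthonormal[OF onb]
  obtain K a where K: "finite K" "K \<subseteq> I" "normL2 M (\<lambda>x. f x - (\<Sum>i\<in>K. a i * b i x)) < \<epsilon>"
    using onb_approx[OF onb f \<open>\<epsilon> > 0\<close>] by (elim exE conjE)
  have "normL2 M (\<lambda>x. f x - (\<Sum>i\<in>L. innerL2 M f (b i) * b i x)) < \<epsilon>"
    if L: "finite L" "K \<subseteq> L" "L \<subseteq> I" for L
  proof -
    have "(normL2 M (\<lambda>x. f x - (\<Sum>i\<in>L. innerL2 M f (b i) * b i x)))\<^sup>2 \<le>
      (normL2 M (\<lambda>x. f x - (\<Sum>i\<in>K. innerL2 M f (b i) * b i x)))\<^sup>2"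
      using L K f by (simp add: norm_sq_residual[OF on] sum_mono2)
    then have "normL2 M (\<lambda>x. f x - (\<Sum>i\<in>L. innerL2 M f (b i) * b i x)) \<le>
      normL2 M (\<lambda>x. f x - (\<Sum>i\<in>K. innerL2 M f (b i) * b i x))"
      by (rule power2_le_imp_le) simp
    also have "\<dots> < \<epsilon>" using best_approximation[OF on K(1,2) f, of a] K(3) by linarith
    finally show ?thesis .
  qed
  then show "\<forall>\<^sub>F L in finite_subsets_at_top I.
      dist (normL2 M (\<lambda>x. f x - (\<Sum>i\<in>L. innerL2 M f (b i) * b i x))) 0 < \<epsilon>"
    using K by (auto simp: eventually_finite_subsets_at_top intro!: exI[of _ K])
qed

lemma Parseval_inner:
  assumes onb: "orthonormal_basis M I b" and f: "f \<in> L2 M" and g: "g \<in> L2 M"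
  shows "((\<lambda>i. innerL2 M f (b i) * cnj (innerL2 M g (b i))) has_sum innerL2 M f g) I"
proof -
  let ?F = "finite_subsets_at_top I"
  let ?d = "\<lambda>K x. f x - (\<Sum>i\<in>K. innerL2 M f (b i) * b i x)"
  have "((\<lambda>K. innerL2 M f g - (\<Sum>i\<in>K. innerL2 M f (b i) * cnj (innerL2 M g (b i)))) \<longlongrightarrow> 0) ?F"
  proof (rule Lim_null_comparison)
    show "((\<lambda>K. normL2 M (?d K) * normL2 M g) \<longlongrightarrow> 0) ?F"
      by (rule tendsto_mult_left_zero[OF onb_expansion[OF onb f]])
    have "cmod (innerL2 M f g - (\<Sum>i\<in>K. innerL2 M f (b i) * cnj (innerL2 M g (b i)))) \<le> normL2 M (?d K) * normL2 M g"
      if K: "finite K" "K \<subseteq> I" for K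
    proof -
      have L: "(\<lambda>x. \<Sum>i\<in>K. innerL2 M f (b i) * b i x) \<in> L2 M"
        by (rule lincomb_L2[OF onb_orthonormal[OF onb] K(2)])
      have "(\<Sum>i\<in>K. innerL2 M f (b i) * cnj (innerL2 M g (b i))) =
         innerL2 M (\<lambda>x. \<Sum>i\<in>K. innerL2 M f (b i) * b i x) g"
        using K f g onb_L2[OF onb]
        by (subst innerL2_sum_left) (auto simp: innerL2_cmult_left innerL2_commute[of M _ g] intro!: sum.cong)
      then have "innerL2 M f g - (\<Sum>i\<in>K. innerL2 M f (b i) * cnj (innerL2 M g (b i))) = innerL2 M (?d K) g"
        using f g L by (simp add: innerL2_diff_left)
      then show ?thesis using Cauchy_Schwarz[OF L2_diff[OF f L] g] by simp
    qed
    then show "\<forall>\<^sub>F K in ?F. cmod (innerL2 M f g - (\<Sum>i\<in>K. innerL2 M f (b i) * cnj (innerL2 M g (b i)))) \<le> normL2 M (?d K) * normL2 M g"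
      by (rule eventually_finite_subsets_at_top_weakI)
  qed
  from tendsto_diff[OF tendsto_const[of "innerL2 M f g"] this]
  show ?thesis by (simp add: has_sum_def)
qed

lemma Parseval:
  assumes "orthonormal_basis M I b" "f \<in> L2 M"
  shows "((\<lambda>i. (cmod (innerL2 M f (b i)))\<^sup>2) has_sum (normL2 M f)\<^sup>2) I"
proof -
  have "((\<lambda>i. of_real ((cmod (innerL2 M f (b i)))\<^sup>2)) has_sum complex_of_real ((normL2 M f)\<^sup>2)) I"
    using Parseval_inner[OF assms assms(2)] by (simp only: complex_norm_square[symmetric] innerL2_self of_real_power)
  then show ?thesis by (simp only: has_sum_of_real_iff)
qed

text \<open>Bessel's inequality bounds the new energies. Multipliers 0 and 1 give the spectral
  projections of diagonal operators; a multiplier built from the boundary condition gives the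
  initial value in the resolvent equation.\<close>

lemma (in prob_space) coefficient_multiplier:
  assumes onb: "orthonormal_basis M I b" and f: "f \<in> L2 M"
    and m: "\<And>i. i \<in> I \<Longrightarrow> cmod (m i) \<le> C"
  shows "\<exists>g\<in>L2 M. \<forall>i\<in>I. innerL2 M g (b i) = m i * innerL2 M f (b i)"
proof -
  note on = onb_orthonormal[OF onb]
  have "(\<Sum>i\<in>K. (cmod (m i * innerL2 M f (b i)))\<^sup>2) \<le> C\<^sup>2 * (normL2 M f)\<^sup>2" if K: "finite K" "K \<subseteq> I" for K
  proof -
    have "(\<Sum>i\<in>K. (cmod (m i * innerL2 M f (b i)))\<^sup>2) \<le> (\<Sum>i\<in>K. C\<^sup>2 * (cmod (innerL2 M f (b i)))\<^sup>2)"
      using K m by (intro sum_mono) (auto simp: norm_mult power_mult_distrib intro!: mult_right_mono power_mono)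
    also have "\<dots> \<le> C\<^sup>2 * (normL2 M f)\<^sup>2"
      using Bessel[OF on K f] by (simp add: sum_distrib_left[symmetric] mult_left_mono)
    finally show ?thesis .
  qed
  then have "\<exists>g\<in>L2 M. (\<forall>i\<in>I. innerL2 M g (b i) = m i * innerL2 M f (b i)) \<and>
    (\<forall>\<epsilon>>0. \<exists>K. finite K \<and> K \<subseteq> I \<and>
      normL2 M (\<lambda>x. g x - (\<Sum>i\<in>K. m i * innerL2 M f (b i) * b i x)) < \<epsilon>)"
    by (rule Riesz_Fischer[OF on])
  then show ?thesis by blast
qed

section \<open>Diagonal operators and their spectral measures\<close>

text \<open>Parseval is stated with \<open>has_sum\<close>, while the conditions in
  \<open>spectral_measure\<close> are Lebesgue integrals; integration over
  \<open>count_space\<close> joins the two.\<close>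

lemma has_sum_count_space:
  fixes h :: "'i \<Rightarrow> complex"
  assumes "(h has_sum s) I"
  shows "integrable (count_space I) h" "integral\<^sup>L (count_space I) h = s"
proof -
  have "Infinite_Sum.abs_summable_on h I"
    using assms has_sum_imp_summable summable_on_iff_abs_summable_on_complex by blast
  then show "integrable (count_space I) h" "integral\<^sup>L (count_space I) h = s"
    using abs_summable_equivalent[of h I] infsetsum_infsum[of h I] infsumI[OF assms]
    unfolding infsetsum_def Infinite_Set_Sum.abs_summable_on_def by auto
qed

lemma has_sum_count_space_real:
  fixes h :: "'i \<Rightarrow> real"
  assumes "(h has_sum s) I"
  shows "integrable (count_space I) h" "integral\<^sup>L (count_space I) h = s"
proof -
  have s: "((\<lambda>i. complex_of_real (h i)) has_sum of_real s) I"
    using assms by (simp only: has_sum_of_real_iff)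
  show "integrable (count_space I) h" "integral\<^sup>L (count_space I) h = s"
    using has_sum_count_space[OF s] by (simp_all add: complex_of_real_integrable_eq)
qed

lemma finite_sum_le_integral_count_space:
  fixes h :: "'i \<Rightarrow> real"
  assumes "integrable (count_space I) h" "\<And>i. i \<in> I \<Longrightarrow> 0 \<le> h i" "finite K" "K \<subseteq> I"
  shows "sum h K \<le> integral\<^sup>L (count_space I) h"
proof -
  have 1: "Infinite_Set_Sum.abs_summable_on h I"
    using assms(1) by (simp add: Infinite_Set_Sum.abs_summable_on_def)
  then have 2: "Infinite_Sum.abs_summable_on h I" by (simp only: abs_summable_equivalent)
  then have "h summable_on I" by (rule abs_summable_summable)
  then have "sum h K \<le> infsum h I"
    using assms by (intro finite_sum_le_infsum) auto
  then show ?thesis using infsetsum_infsum[OF 1] by (simp add: infsetsum_def)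
qed

section \<open>Scalar measures of a projection-valued measure\<close>

context
  fixes M :: "'a measure" and E
  assumes pvm: "projection_valued_measure M E"
begin

lemma pvm_projection:
  assumes "S \<in> sets borel" shows "orthogonal_projection M (E S)"
proof -
  have "\<forall>S\<in>sets borel. orthogonal_projection M (E S)"
    using pvm unfolding projection_valued_measure_def by (elim conjE)
  with assms show ?thesis by simp
qed

lemma pvm_linear: "S \<in> sets borel \<Longrightarrow> linear_map M (E S)"
  using pvm_projection unfolding orthogonal_projection_def by simp

lemma pvm_L2: "S \<in> sets borel \<Longrightarrow> f \<in> L2 M \<Longrightarrow> E S f \<in> L2 M"
  using pvm_linear unfolding linear_map_def by simp

lemma pvm_cong:
  "S \<in> sets borel \<Longrightarrow> f \<in> L2 M \<Longrightarrow> g \<in> L2 M \<Longrightarrow> eqL2 M f g \<Longrightarrow> eqL2 M (E S f) (E S g)"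
  using pvm_linear unfolding linear_map_def by simp

lemma pvm_add:
  "S \<in> sets borel \<Longrightarrow> f \<in> L2 M \<Longrightarrow> g \<in> L2 M \<Longrightarrow> eqL2 M (E S (\<lambda>x. f x + g x)) (\<lambda>x. E S f x + E S g x)"
  using pvm_linear unfolding linear_map_def by simp

lemma pvm_selfadjoint:
  "S \<in> sets borel \<Longrightarrow> f \<in> L2 M \<Longrightarrow> g \<in> L2 M \<Longrightarrow> innerL2 M (E S f) g = innerL2 M f (E S g)"
  using pvm_projection unfolding orthogonal_projection_def by simp

lemma pvm_idem: "S \<in> sets borel \<Longrightarrow> f \<in> L2 M \<Longrightarrow> eqL2 M (E S (E S f)) (E S f)"
  using pvm_projection unfolding orthogonal_projection_def by simp

lemma pvm_Int:
  assumes "S \<in> sets borel" "T \<in> sets borel" "f \<in> L2 M"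
  shows "eqL2 M (E (S \<inter> T) f) (E S (E T f))"
proof -
  have "\<forall>S\<in>sets borel. \<forall>T\<in>sets borel. \<forall>f\<in>L2 M. eqL2 M (E (S \<inter> T) f) (E S (E T f))"
    using pvm unfolding projection_valued_measure_def by (elim conjE)
  with assms show ?thesis by simp
qed

lemma pvm_empty:
  assumes "f \<in> L2 M" shows "eqL2 M (E {} f) (\<lambda>x. 0)"
proof -
  have "\<forall>f\<in>L2 M. eqL2 M (E {} f) (\<lambda>x. 0)"
    using pvm unfolding projection_valued_measure_def by (elim conjE)
  with assms show ?thesis by simp
qed

lemma pvm_UNIV:
  assumes "f \<in> L2 M" shows "eqL2 M (E UNIV f) f"
proof -
  have "\<forall>f\<in>L2 M. eqL2 M (E UNIV f) f"
    using pvm unfolding projection_valued_measure_def by (elim conjE)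
  with assms show ?thesis by simp
qed

lemma pvm_countably_additive:
  fixes A :: "nat \<Rightarrow> real set"
  assumes "range A \<subseteq> sets borel" "disjoint_family A" "f \<in> L2 M"
  shows "(\<lambda>N. normL2 M (\<lambda>x. E (\<Union>n. A n) f x - (\<Sum>n<N. E (A n) f x))) \<longlonglongrightarrow> 0"
proof -
  have "\<forall>S::nat \<Rightarrow> real set. range S \<subseteq> sets borel \<and> disjoint_family S \<longrightarrow>
        (\<forall>f\<in>L2 M. (\<lambda>N. normL2 M (\<lambda>x. E (\<Union>n. S n) f x - (\<Sum>n<N. E (S n) f x))) \<longlonglongrightarrow> 0)"
    using pvm unfolding projection_valued_measure_def by (elim conjE)
  with assms show ?thesis by auto
qed

lemma pvm_inner_self:
  assumes S: "S \<in> sets borel" and f: "f \<in> L2 M"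
  shows "innerL2 M (E S f) f = of_real ((normL2 M (E S f))\<^sup>2)"
proof -
  note ES = pvm_L2[OF S f]
  have "innerL2 M (E S f) f = innerL2 M (E S (E S f)) f"
    by (intro innerL2_cong pvm_L2 S ES f eqL2_refl eqL2_sym[OF pvm_idem[OF S f]])
  also have "\<dots> = innerL2 M (E S f) (E S f)" by (rule pvm_selfadjoint[OF S ES f])
  finally show ?thesis by (simp only: innerL2_self)
qed

text \<open>Pairing the convergent sums with \<open>f\<close> turns additivity in norm into
  additivity of numbers, since the inner product of E(S) f with f is the squared norm of E(S)
  f.\<close>

lemma pvm_norm_sq_sums:
  fixes A :: "nat \<Rightarrow> real set"
  assumes A: "range A \<subseteq> sets borel" "disjoint_family A" and f: "f \<in> L2 M"
  shows "(\<lambda>n. (normL2 M (E (A n) f))\<^sup>2) sums (normL2 M (E (\<Union>n. A n) f))\<^sup>2"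
proof -
  have An: "A n \<in> sets borel" for n using A by auto
  have U: "(\<Union>n. A n) \<in> sets borel" using An by auto
  have "(\<lambda>N. innerL2 M (\<lambda>x. \<Sum>n<N. E (A n) f x) f) \<longlonglongrightarrow> innerL2 M (E (\<Union>n. A n) f) f"
  proof (rule innerL2_tendsto_left)
    show "(\<lambda>N. normL2 M (\<lambda>x. (\<Sum>n<N. E (A n) f x) - E (\<Union>n. A n) f x)) \<longlonglongrightarrow> 0"
      using pvm_countably_additive[OF A f] by (subst normL2_minus_commute)
  qed (intro L2_sum pvm_L2 An U f)+
  moreover have "innerL2 M (\<lambda>x. \<Sum>n<N. E (A n) f x) f = of_real (\<Sum>n<N. (normL2 M (E (A n) f))\<^sup>2)" for N
    using pvm_L2[OF An f] f by (simp add: innerL2_sum_left pvm_inner_self[OF An f])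
  ultimately have "(\<lambda>N. Re (of_real (\<Sum>n<N. (normL2 M (E (A n) f))\<^sup>2))) \<longlonglongrightarrow>
     Re (of_real ((normL2 M (E (\<Union>n. A n) f))\<^sup>2))"
    unfolding pvm_inner_self[OF U f] by (intro tendsto_Re) simp
  then show ?thesis by (simp add: sums_def)
qed

lemma space_scalar_measure: "space (scalar_measure M E f) = UNIV"
  by (simp add: scalar_measure_def space_measure_of_conv)

lemma sets_scalar_measure: "sets (scalar_measure M E f) = sets borel"
proof -
  have "sigma_sets UNIV (sets (borel :: real measure)) = sets borel"
    using sets.sigma_sets_eq[of "borel :: real measure"] by simp
  then show ?thesis by (simp add: scalar_measure_def)
qed

text \<open>\<open>measure_of\<close> is known to take the prescribed values once they are countably
  additive, which is \<open>pvm_norm_sq_sums\<close>. The squared norm replaces the real part of the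
  inner product from here on.\<close>

lemma emeasure_scalar_measure:
  assumes f: "f \<in> L2 M" and S: "S \<in> sets borel"
  shows "emeasure (scalar_measure M E f) S = ennreal ((normL2 M (E S f))\<^sup>2)"
proof -
  let ?\<mu> = "\<lambda>S. ennreal (Re (innerL2 M (E S f) f))"
  have eq: "?\<mu> T = ennreal ((normL2 M (E T f))\<^sup>2)" if "T \<in> sets borel" for T
    using pvm_inner_self[OF that f] by simp
  have "emeasure (scalar_measure M E f) S = ?\<mu> S"
  proof (rule emeasure_measure_of[OF scalar_measure_def])
    show "sets borel \<subseteq> Pow (UNIV :: real set)" by simp
    show "S \<in> sets (scalar_measure M E f)" using S by (simp add: sets_scalar_measure)
    have "normL2 M (E {} f) = normL2 M (\<lambda>x. 0)"
      using pvm_L2[of "{}" f] f pvm_empty by (intro normL2_cong) auto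
    then have "?\<mu> {} = 0" by (subst eq) auto
    then show "positive (sets (scalar_measure M E f)) ?\<mu>" by (simp add: positive_def)
    show "countably_additive (sets (scalar_measure M E f)) ?\<mu>"
      unfolding sets_scalar_measure countably_additive_def
    proof safe
      fix A :: "nat \<Rightarrow> real set"
      assume A: "range A \<subseteq> sets borel" "disjoint_family A" "\<Union> (range A) \<in> sets borel"
      have An: "A n \<in> sets borel" for n using A by auto
      have "(\<Sum>n. ennreal ((normL2 M (E (A n) f))\<^sup>2)) = ennreal ((normL2 M (E (\<Union>n. A n) f))\<^sup>2)"
        using pvm_norm_sq_sums[OF A(1,2) f] by (intro suminf_ennreal_eq) auto
      then show "(\<Sum>n. ?\<mu> (A n)) = ?\<mu> (\<Union> (range A))"
        unfolding eq[OF An] eq[OF A(3)] .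
    qed
  qed
  then show ?thesis using eq[OF S] by simp
qed

end

text \<open>The maximal multiplication operator in the coordinates of \<open>b\<close>: its domain
  is left implicit in the existence of a function \<open>g\<close> with the multiplied
  coefficients.\<close>

definition diag_op ::
  "'a measure \<Rightarrow> 'i set \<Rightarrow> ('i \<Rightarrow> 'a \<Rightarrow> complex) \<Rightarrow> ('i \<Rightarrow> real) \<Rightarrow> 'a operator" where
  "diag_op M I b evl = {(f, g). f \<in> L2 M \<and> g \<in> L2 M \<and>
     (\<forall>i\<in>I. innerL2 M g (b i) = of_real (evl i) * innerL2 M f (b i))}"

text \<open>Coefficients fix a function only up to a null set, hence the choice of a representative;
  for square integrable \<open>f\<close> it exists by \<open>coefficient_multiplier\<close> with
  bound 1.\<close>

definition diag_proj ::
  "'a measure \<Rightarrow> 'i set \<Rightarrow> ('i \<Rightarrow> 'a \<Rightarrow> complex) \<Rightarrow> ('i \<Rightarrow> real) \<Rightarrow> real set \<Rightarrow>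
    ('a \<Rightarrow> complex) \<Rightarrow> ('a \<Rightarrow> complex)" where
  "diag_proj M I b evl S f = (SOME g. g \<in> L2 M \<and>
     (\<forall>i\<in>I. innerL2 M g (b i) = (if evl i \<in> S then 1 else 0) * innerL2 M f (b i)))"

lemma linear_operator_diag_op:
  assumes onb: "orthonormal_basis M I b" shows "linear_operator M (diag_op M I b evl)"
  unfolding linear_operator_def
proof (intro conjI ballI allI impI)
  note bL = onb_L2[OF onb]
  show "diag_op M I b evl \<subseteq> L2 M \<times> L2 M" by (auto simp: diag_op_def)
  show "(\<lambda>x. 0, \<lambda>x. 0) \<in> diag_op M I b evl" by (simp add: diag_op_def)
  show "(f, g) \<in> diag_op M I b evl"
    if "f \<in> L2 M" "g \<in> L2 M" "(f', g') \<in> diag_op M I b evl \<and> eqL2 M f f' \<and> eqL2 M g g'" for f g f' g'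
  proof -
    have L: "f' \<in> L2 M" "g' \<in> L2 M" using that by (auto simp: diag_op_def)
    have "innerL2 M f (b i) = innerL2 M f' (b i)" "innerL2 M g (b i) = innerL2 M g' (b i)" if "i \<in> I" for i
      using \<open>f \<in> L2 M\<close> \<open>g \<in> L2 M\<close> L bL[OF that] \<open>(f', g') \<in> diag_op M I b evl \<and> eqL2 M f f' \<and> eqL2 M g g'\<close>
      by (auto intro!: innerL2_cong)
    then show ?thesis using that by (simp add: diag_op_def)
  qed
  show "eqL2 M g g'" if "(f, g) \<in> diag_op M I b evl \<and> (f, g') \<in> diag_op M I b evl" for f g g'
    using that by (intro onb_eqI[OF onb]) (auto simp: diag_op_def)
  show "(\<lambda>x. f x + f' x, \<lambda>x. g x + g' x) \<in> diag_op M I b evl"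
    if "(f, g) \<in> diag_op M I b evl \<and> (f', g') \<in> diag_op M I b evl" for f g f' g'
    using that bL by (auto simp: diag_op_def innerL2_add_left distrib_left)
  show "(\<lambda>x. c * f x, \<lambda>x. c * g x) \<in> diag_op M I b evl" if "(f, g) \<in> diag_op M I b evl" for f g c
    using that by (auto simp: diag_op_def innerL2_cmult_left)
qed

context prob_space
begin

context
  fixes I :: "'i set" and b :: "'i \<Rightarrow> 'a \<Rightarrow> complex" and evl :: "'i \<Rightarrow> real"
  assumes onb: "orthonormal_basis M I b"
begin

lemma diag_proj:
  assumes f: "f \<in> L2 M"
  shows diag_proj_L2: "diag_proj M I b evl S f \<in> L2 M"
    and diag_proj_coeff: "\<And>i. i \<in> I \<Longrightarrow>
      innerL2 M (diag_proj M I b evl S f) (b i) = (if evl i \<in> S then 1 else 0) * innerL2 M f (b i)"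
proof -
  have "\<exists>g\<in>L2 M. \<forall>i\<in>I. innerL2 M g (b i) = (if evl i \<in> S then 1 else 0) * innerL2 M f (b i)"
    by (rule coefficient_multiplier[OF onb f, where C = 1]) simp
  then have "\<exists>g. g \<in> L2 M \<and> (\<forall>i\<in>I. innerL2 M g (b i) = (if evl i \<in> S then 1 else 0) * innerL2 M f (b i))"
    by (simp add: Bex_def)
  from someI_ex[OF this] show "diag_proj M I b evl S f \<in> L2 M"
    "\<And>i. i \<in> I \<Longrightarrow> innerL2 M (diag_proj M I b evl S f) (b i) = (if evl i \<in> S then 1 else 0) * innerL2 M f (b i)"
    unfolding diag_proj_def[symmetric] by simp_all
qed

lemma diag_proj_eqI:
  assumes "f \<in> L2 M" "g \<in> L2 M"
    and "\<And>i. i \<in> I \<Longrightarrow> innerL2 M g (b i) = (if evl i \<in> S then 1 else 0) * innerL2 M f (b i)"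
  shows "eqL2 M (diag_proj M I b evl S f) g"
  using assms by (intro onb_eqI[OF onb]) (simp_all add: diag_proj_L2 diag_proj_coeff)

lemma diag_proj_norm_sq:
  assumes f: "f \<in> L2 M"
  shows "((\<lambda>i. if evl i \<in> S then (cmod (innerL2 M f (b i)))\<^sup>2 else 0) has_sum
     (normL2 M (diag_proj M I b evl S f))\<^sup>2) I"
proof -
  have "((\<lambda>i. (cmod (innerL2 M (diag_proj M I b evl S f) (b i)))\<^sup>2) has_sum
     (normL2 M (diag_proj M I b evl S f))\<^sup>2) I"
    by (rule Parseval[OF onb diag_proj_L2[OF f]])
  then show ?thesis
    by (rule has_sum_cong[THEN iffD1, rotated]) (simp add: diag_proj_coeff[OF f])
qed

lemma orthogonal_projection_diag_proj: "orthogonal_projection M (diag_proj M I b evl S)"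
  unfolding orthogonal_projection_def linear_map_def
proof (intro conjI ballI allI impI)
  note bL = onb_L2[OF onb]
  fix f assume f: "f \<in> L2 M"
  show "diag_proj M I b evl S f \<in> L2 M" by (rule diag_proj_L2[OF f])
  show "eqL2 M (diag_proj M I b evl S (diag_proj M I b evl S f)) (diag_proj M I b evl S f)"
    using f by (intro diag_proj_eqI) (auto simp: diag_proj_L2 diag_proj_coeff)
  show "eqL2 M (diag_proj M I b evl S (\<lambda>x. c * f x)) (\<lambda>x. c * diag_proj M I b evl S f x)" for c
    using f by (intro diag_proj_eqI) (auto simp: diag_proj_L2 diag_proj_coeff innerL2_cmult_left)
  fix g assume g: "g \<in> L2 M"
  show "eqL2 M (diag_proj M I b evl S f) (diag_proj M I b evl S g)" if "eqL2 M f g"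
    using f g innerL2_cong[OF f g bL bL that eqL2_refl]
    by (intro diag_proj_eqI) (simp_all add: diag_proj_L2 diag_proj_coeff)
  show "eqL2 M (diag_proj M I b evl S (\<lambda>x. f x + g x)) (\<lambda>x. diag_proj M I b evl S f x + diag_proj M I b evl S g x)"
    using f g bL
    by (intro diag_proj_eqI) (auto simp: diag_proj_L2 diag_proj_coeff innerL2_add_left distrib_left)
  have "((\<lambda>i. innerL2 M (diag_proj M I b evl S f) (b i) * cnj (innerL2 M g (b i))) has_sum
      innerL2 M (diag_proj M I b evl S f) g) I"
    by (rule Parseval_inner[OF onb diag_proj_L2[OF f] g])
  \<comment> \<open>The multiplier is 0 or 1, hence real, and can be moved across \<open>cnj\<close>
    to the other factor.\<close>
  then have 1: "((\<lambda>i. innerL2 M f (b i) * cnj (innerL2 M (diag_proj M I b evl S g) (b i))) has_sum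
      innerL2 M (diag_proj M I b evl S f) g) I"
    by (rule has_sum_cong[THEN iffD1, rotated]) (simp add: diag_proj_coeff f g)
  show "innerL2 M (diag_proj M I b evl S f) g = innerL2 M f (diag_proj M I b evl S g)"
    by (rule has_sum_unique[OF 1 Parseval_inner[OF onb f diag_proj_L2[OF g]]])
qed

lemma pvm_diag_proj: "projection_valued_measure M (diag_proj M I b evl)"
  unfolding projection_valued_measure_def
proof (intro conjI ballI allI impI)
  let ?E = "diag_proj M I b evl"
  note bL = onb_L2[OF onb]
  show "orthogonal_projection M (?E S)" for S by (rule orthogonal_projection_diag_proj)
  fix f assume f: "f \<in> L2 M"
  show "eqL2 M (?E {} f) (\<lambda>x. 0)" "eqL2 M (?E UNIV f) f"
    using f by (auto intro!: diag_proj_eqI)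
  show "eqL2 M (?E (S \<inter> T) f) (?E S (?E T f))" for S T
    using f by (intro diag_proj_eqI) (auto simp: diag_proj_L2 diag_proj_coeff)
  fix A :: "nat \<Rightarrow> real set" assume "range A \<subseteq> sets borel \<and> disjoint_family A"
  then have disj: "disjoint_family A" by simp
  \<comment> \<open>By disjointness the first \<open>N\<close> projections add up to the one for the
    union of \<open>A n\<close> with \<open>n < N\<close>, so the error of the partial sum is the
    projection for \<open>T N\<close>.\<close>
  define T where "T N = (\<Union>n. A n) - (\<Union>n<N. A n)" for N
  have coeff: "(\<Sum>n<N. (if evl i \<in> A n then 1 else 0)) = (if evl i \<in> (\<Union>n<N. A n) then 1 else (0::complex))" for N i
  proof (cases "\<exists>n<N. evl i \<in> A n")
    case True
    then obtain n where n: "n < N" "evl i \<in> A n" by blast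
    then have "evl i \<in> A m \<longleftrightarrow> m = n" for m
      using disj unfolding disjoint_family_on_def by blast
    then show ?thesis using n by auto
  qed auto
  have eq: "normL2 M (\<lambda>x. ?E (\<Union>n. A n) f x - (\<Sum>n<N. ?E (A n) f x)) = normL2 M (?E (T N) f)" for N
  proof (rule normL2_cong)
    have L: "(\<lambda>x. \<Sum>n<N. ?E (A n) f x) \<in> L2 M" using f by (intro L2_sum diag_proj_L2)
    show "(\<lambda>x. ?E (\<Union>n. A n) f x - (\<Sum>n<N. ?E (A n) f x)) \<in> L2 M"
      using f L by (intro L2_diff diag_proj_L2)
    show "?E (T N) f \<in> L2 M" by (rule diag_proj_L2[OF f])
    show "eqL2 M (\<lambda>x. ?E (\<Union>n. A n) f x - (\<Sum>n<N. ?E (A n) f x)) (?E (T N) f)"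
    proof (rule eqL2_sym, rule diag_proj_eqI[OF f])
      show "(\<lambda>x. ?E (\<Union>n. A n) f x - (\<Sum>n<N. ?E (A n) f x)) \<in> L2 M"
        using f L by (intro L2_diff diag_proj_L2)
      fix i assume i: "i \<in> I"
      have "innerL2 M (\<lambda>x. ?E (\<Union>n. A n) f x - (\<Sum>n<N. ?E (A n) f x)) (b i) =
        innerL2 M (?E (\<Union>n. A n) f) (b i) - (\<Sum>n<N. innerL2 M (?E (A n) f) (b i))"
        using f L bL[OF i] by (simp add: innerL2_diff_left innerL2_sum_left diag_proj_L2)
      also have "\<dots> = ((if evl i \<in> (\<Union>n. A n) then 1 else 0) - (\<Sum>n<N. (if evl i \<in> A n then 1 else 0))) * innerL2 M f (b i)"
        unfolding diag_proj_coeff[OF f i] sum_distrib_right[symmetric] left_diff_distrib ..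
      also have "\<dots> = (if evl i \<in> T N then 1 else 0) * innerL2 M f (b i)"
        unfolding coeff by (auto simp: T_def)
      finally show "innerL2 M (\<lambda>x. ?E (\<Union>n. A n) f x - (\<Sum>n<N. ?E (A n) f x)) (b i) =
        (if evl i \<in> T N then 1 else 0) * innerL2 M f (b i)" .
    qed
  qed
  show "(\<lambda>N. normL2 M (\<lambda>x. ?E (\<Union>n. A n) f x - (\<Sum>n<N. ?E (A n) f x))) \<longlonglongrightarrow> 0"
    unfolding eq
  proof (rule LIMSEQ_I)
    fix \<epsilon> :: real assume "\<epsilon> > 0"
    let ?r = "\<lambda>K x. f x - (\<Sum>i\<in>K. innerL2 M f (b i) * b i x)"
    obtain K c where K: "finite K" "K \<subseteq> I" "normL2 M (\<lambda>x. f x - (\<Sum>i\<in>K. c i * b i x)) < \<epsilon>"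
      using onb_approx[OF onb f \<open>\<epsilon> > 0\<close>] by (elim exE conjE)
    note on = onb_orthonormal[OF onb]
    have r: "normL2 M (?r K) < \<epsilon>"
      using best_approximation[OF on K(1,2) f, of c] K(3) by linarith
    \<comment> \<open>Each eigenvalue leaves \<open>T N\<close> for good, and for the finitely many
      indices in \<open>K\<close> a common bound exists. Beyond it the projection for
      \<open>T N\<close> sees only coefficients outside \<open>K\<close>, whose energy is that of
      the residual.\<close>
    have "\<exists>n0. \<forall>N\<ge>n0. evl i \<notin> T N" for i
    proof (cases "\<exists>n. evl i \<in> A n")
      case True
      then obtain n where "evl i \<in> A n" by blast
      then show ?thesis by (intro exI[of _ "Suc n"]) (auto simp: T_def)
    qed (auto simp: T_def)
    then obtain n0 where n0: "\<And>i N. N \<ge> n0 i \<Longrightarrow> evl i \<notin> T N" by metis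
    define n1 where "n1 = Max (insert 0 (n0 ` K))"
    have n1: "evl i \<notin> T N" if "i \<in> K" "N \<ge> n1" for i N
    proof (rule n0)
      have "n0 i \<le> n1" unfolding n1_def using K that by (intro Max_ge) auto
      then show "n0 i \<le> N" using that by simp
    qed
    have "norm (normL2 M (?E (T N) f) - 0) < \<epsilon>" if N: "N \<ge> n1" for N
    proof -
      have "normL2 M (?E (T N) f) \<le> normL2 M (?r K)"
      proof (rule power2_le_imp_le)
        let ?c = "\<lambda>i. (cmod (innerL2 M f (b i)))\<^sup>2"
        have "(normL2 M (?E (T N) f))\<^sup>2 + sum ?c K \<le> (normL2 M f)\<^sup>2"
        proof (rule has_sum_mono[OF has_sum_add[OF diag_proj_norm_sq[OF f, of "T N"], of "\<lambda>i. if i \<in> K then ?c i else 0"] Parseval[OF onb f]])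
          show "((\<lambda>i. if i \<in> K then ?c i else 0) has_sum sum ?c K) I"
            using K by (intro has_sum_cong_neutral[THEN iffD1, OF _ _ _ has_sum_finite[of K]]) auto
          show "(if evl i \<in> T N then ?c i else 0) + (if i \<in> K then ?c i else 0) \<le> ?c i" if "i \<in> I" for i
            using n1[of i N] N by auto
        qed
        then show "(normL2 M (?E (T N) f))\<^sup>2 \<le> (normL2 M (?r K))\<^sup>2"
          unfolding norm_sq_residual[OF on K(1,2) f] by simp
      qed simp
      with r show ?thesis by simp
    qed
    then show "\<exists>no. \<forall>n\<ge>no. norm (normL2 M (?E (T n) f) - 0) < \<epsilon>" by blast
  qed
qed

text \<open>The weights of the coefficients are carried to the line by \<open>evl\<close>;
  \<open>distr\<close> adds the weights of coinciding eigenvalues. Integrals against the scalar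
  measure thereby become sums over \<open>I\<close>.\<close>

lemma scalar_measure_diag_proj:
  assumes f: "f \<in> L2 M"
  shows "scalar_measure M (diag_proj M I b evl) f =
    distr (density (count_space I) (\<lambda>i. ennreal ((cmod (innerL2 M f (b i)))\<^sup>2))) borel evl"
proof (rule measure_eqI)
  let ?c = "\<lambda>i. (cmod (innerL2 M f (b i)))\<^sup>2"
  show "sets (scalar_measure M (diag_proj M I b evl) f) = sets (distr (density (count_space I) ?c) borel evl)"
    by (simp add: sets_scalar_measure[OF pvm_diag_proj])
  fix S assume "S \<in> sets (scalar_measure M (diag_proj M I b evl) f)"
  then have S: "S \<in> sets borel" by (simp add: sets_scalar_measure[OF pvm_diag_proj])
  have "emeasure (distr (density (count_space I) ?c) borel evl) S =
      emeasure (density (count_space I) ?c) (evl -` S \<inter> I)"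
    using S by (subst emeasure_distr) auto
  also have "\<dots> = (\<integral>\<^sup>+i. ennreal (?c i) * indicator (evl -` S \<inter> I) i \<partial>count_space I)"
    by (intro emeasure_density) auto
  also have "\<dots> = (\<integral>\<^sup>+i. ennreal (if evl i \<in> S then ?c i else 0) \<partial>count_space I)"
    by (intro nn_integral_cong) (auto simp: indicator_def)
  also have "\<dots> = ennreal (integral\<^sup>L (count_space I) (\<lambda>i. if evl i \<in> S then ?c i else 0))"
    using has_sum_count_space_real(1)[OF diag_proj_norm_sq[OF f, of S]]
    by (intro nn_integral_eq_integral) auto
  also have "\<dots> = emeasure (scalar_measure M (diag_proj M I b evl) f) S"
    unfolding has_sum_count_space_real(2)[OF diag_proj_norm_sq[OF f, of S]]
    by (rule emeasure_scalar_measure[OF pvm_diag_proj f S, symmetric])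
  finally show "emeasure (scalar_measure M (diag_proj M I b evl) f) S =
    emeasure (distr (density (count_space I) ?c) borel evl) S" ..
qed

text \<open>The integral of r^2 is the sum of the squared multiplied coefficients: its finiteness
  gives an image by \<open>Riesz_Fischer\<close>, and an image gives finiteness by
  \<open>Parseval\<close>.\<close>

theorem spectral_measure_diag_op: "spectral_measure M (diag_op M I b evl) (diag_proj M I b evl)"
  unfolding spectral_measure_def
proof (intro conjI ballI)
  let ?E = "diag_proj M I b evl" and ?D = "diag_op M I b evl"
  show "linear_operator M ?D" by (rule linear_operator_diag_op[OF onb])
  show "projection_valued_measure M ?E" by (rule pvm_diag_proj)
  show "(\<exists>g. (f, g) \<in> ?D) \<longleftrightarrow> integrable (scalar_measure M ?E f) (\<lambda>r. r\<^sup>2)" if f: "f \<in> L2 M" for f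
  proof -
    let ?h = "\<lambda>i. (cmod (of_real (evl i) * innerL2 M f (b i)))\<^sup>2"
    have "integrable (scalar_measure M ?E f) (\<lambda>r. r\<^sup>2) \<longleftrightarrow> integrable (count_space I) ?h"
      unfolding scalar_measure_diag_proj[OF f]
      by (subst integrable_distr_eq, simp, simp, subst integrable_real_density)
        (auto simp: norm_mult power_mult_distrib mult.commute)
    also have "\<dots> \<longleftrightarrow> (\<exists>g. (f, g) \<in> ?D)"
    proof
      assume int: "integrable (count_space I) ?h"
      have bd: "sum ?h K \<le> integral\<^sup>L (count_space I) ?h" if "finite K" "K \<subseteq> I" for K
        using finite_sum_le_integral_count_space[OF int _ that] by simp
      have "\<exists>g\<in>L2 M. (\<forall>i\<in>I. innerL2 M g (b i) = of_real (evl i) * innerL2 M f (b i)) \<and>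
        (\<forall>\<epsilon>>0. \<exists>K. finite K \<and> K \<subseteq> I \<and>
          normL2 M (\<lambda>x. g x - (\<Sum>i\<in>K. of_real (evl i) * innerL2 M f (b i) * b i x)) < \<epsilon>)"
        by (rule Riesz_Fischer[OF onb_orthonormal[OF onb] bd])
      then show "\<exists>g. (f, g) \<in> ?D" using f by (auto simp: diag_op_def)
    next
      assume "\<exists>g. (f, g) \<in> ?D"
      then obtain g where g: "g \<in> L2 M" "\<forall>i\<in>I. innerL2 M g (b i) = of_real (evl i) * innerL2 M f (b i)"
        by (auto simp: diag_op_def)
      have "(?h has_sum (normL2 M g)\<^sup>2) I"
        by (rule has_sum_cong[THEN iffD1, OF _ Parseval[OF onb g(1)]]) (simp add: g(2))
      then show "integrable (count_space I) ?h" by (rule has_sum_count_space_real)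
    qed
    finally show ?thesis ..
  qed
  fix p assume p: "p \<in> ?D"
  obtain f g where fg: "p = (f, g)" by (cases p)
  have f: "f \<in> L2 M" and g: "g \<in> L2 M" "\<forall>i\<in>I. innerL2 M g (b i) = of_real (evl i) * innerL2 M f (b i)"
    using p by (auto simp: diag_op_def fg)
  have "((\<lambda>i. of_real ((cmod (innerL2 M f (b i)))\<^sup>2 * evl i)) has_sum innerL2 M g f) I"
    by (rule has_sum_cong[THEN iffD1, OF _ Parseval_inner[OF onb g(1) f]])
      (simp add: g(2) complex_norm_square mult.commute mult.left_commute flip: of_real_power)
  then have "integral\<^sup>L (count_space I) (\<lambda>i. complex_of_real ((cmod (innerL2 M f (b i)))\<^sup>2 * evl i)) = innerL2 M g f"
    by (rule has_sum_count_space)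
  also have "integral\<^sup>L (count_space I) (\<lambda>i. complex_of_real ((cmod (innerL2 M f (b i)))\<^sup>2 * evl i)) =
      of_real (LINT i|count_space I. (cmod (innerL2 M f (b i)))\<^sup>2 * evl i)"
    by (rule integral_complex_of_real)
  also have "(LINT i|count_space I. (cmod (innerL2 M f (b i)))\<^sup>2 * evl i) = (LINT r|scalar_measure M ?E f. r)"
    unfolding scalar_measure_diag_proj[OF f]
    by (subst integral_distr, simp, simp, subst integral_real_density) auto
  finally show "case p of (f, g) \<Rightarrow> innerL2 M g f = of_real (LINT r|scalar_measure M ?E f. r)"
    by (simp add: fg)
qed

end

end

section \<open>Eigenvectors and invariant domains\<close>

lemma orthogonal_projection_contraction:
  assumes T: "orthogonal_projection M T" and f: "f \<in> L2 M"
  shows "T f \<in> L2 M" "normL2 M (T f) \<le> normL2 M f"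
proof -
  show Tf: "T f \<in> L2 M" using T f by (simp add: orthogonal_projection_def linear_map_def)
  have TTf: "T (T f) \<in> L2 M" using T Tf by (simp add: orthogonal_projection_def linear_map_def)
  have "innerL2 M (T f) (T f) = innerL2 M (T (T f)) f"
    using T f Tf by (simp add: orthogonal_projection_def)
  also have "\<dots> = innerL2 M (T f) f"
    using T f by (intro innerL2_cong TTf Tf f eqL2_refl) (simp add: orthogonal_projection_def)
  finally have "(normL2 M (T f))\<^sup>2 = Re (innerL2 M (T f) f)" by (simp add: normL2_sq_inner)
  also have "\<dots> \<le> normL2 M (T f) * normL2 M f"
    using Cauchy_Schwarz[OF Tf f] complex_Re_le_cmod order_trans by blast
  finally have "normL2 M (T f) * normL2 M (T f) \<le> normL2 M (T f) * normL2 M f"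
    by (simp add: power2_eq_square)
  then show "normL2 M (T f) \<le> normL2 M f"
    using normL2_nonneg[of M "T f"] normL2_nonneg[of M f] by (cases "normL2 M (T f) = 0") auto
qed

text \<open>The domain is an integrability condition on scalar measures. Since \<open>T\<close> is a
  contraction commuting with \<open>E\<close>, the scalar measure of \<open>T f\<close> is dominated
  by that of \<open>f\<close>.\<close>

lemma domain_invariant:
  assumes spec: "spectral_measure M A E" and T: "orthogonal_projection M T"
    and comm: "\<And>S g. S \<in> sets borel \<Longrightarrow> g \<in> L2 M \<Longrightarrow> eqL2 M (E S (T g)) (T (E S g))"
    and fA: "(f, g) \<in> A"
  shows "\<exists>g'. (T f, g') \<in> A"
proof -
  have pvm: "projection_valued_measure M E" using spec by (simp add: spectral_measure_def)
  have f: "f \<in> L2 M" using spec fA by (auto simp: spectral_measure_def linear_operator_def)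
  note Tf = orthogonal_projection_contraction(1)[OF T f]
  have dom: "(\<exists>g. (h, g) \<in> A) \<longleftrightarrow> integrable (scalar_measure M E h) (\<lambda>r. r\<^sup>2)" if "h \<in> L2 M" for h
  proof -
    have "\<forall>h\<in>L2 M. (\<exists>g. (h, g) \<in> A) \<longleftrightarrow> integrable (scalar_measure M E h) (\<lambda>r. r\<^sup>2)"
      using spec unfolding spectral_measure_def by (elim conjE)
    with that show ?thesis by simp
  qed
  have le: "scalar_measure M E (T f) \<le> scalar_measure M E f"
  proof (rule le_measure[THEN iffD2])
    show "sets (scalar_measure M E (T f)) = sets (scalar_measure M E f)"
      by (simp add: sets_scalar_measure[OF pvm])
    show "\<forall>S\<in>sets (scalar_measure M E (T f)). emeasure (scalar_measure M E (T f)) S \<le> emeasure (scalar_measure M E f) S"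
    proof
      fix S assume "S \<in> sets (scalar_measure M E (T f))"
      then have S: "S \<in> sets borel" by (simp add: sets_scalar_measure[OF pvm])
      note ES = pvm_L2[OF pvm S f]
      have "normL2 M (E S (T f)) = normL2 M (T (E S f))"
        by (intro normL2_cong pvm_L2[OF pvm S Tf] orthogonal_projection_contraction(1)[OF T ES] comm[OF S f])
      also have "\<dots> \<le> normL2 M (E S f)" by (rule orthogonal_projection_contraction(2)[OF T ES])
      finally show "emeasure (scalar_measure M E (T f)) S \<le> emeasure (scalar_measure M E f) S"
        unfolding emeasure_scalar_measure[OF pvm f S] emeasure_scalar_measure[OF pvm Tf S]
        by (intro ennreal_leI power_mono normL2_nonneg)
    qed
  qed
  have "integrable (scalar_measure M E f) (\<lambda>r. r\<^sup>2)" using dom[OF f] fA by blast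
  then have fin: "(\<integral>\<^sup>+r. ennreal (norm (r\<^sup>2)) \<partial>scalar_measure M E f) < \<infinity>"
    by (simp add: integrable_iff_bounded)
  have "(\<integral>\<^sup>+r. ennreal (norm (r\<^sup>2)) \<partial>scalar_measure M E (T f)) \<le> (\<integral>\<^sup>+r. ennreal (norm (r\<^sup>2)) \<partial>scalar_measure M E f)"
    by (rule nn_integral_mono_measure[OF _ le]) (simp add: sets_scalar_measure[OF pvm])
  with fin have "(\<integral>\<^sup>+r. ennreal (norm (r\<^sup>2)) \<partial>scalar_measure M E (T f)) < \<infinity>" by (rule order_le_less_trans[rotated])
  then have "integrable (scalar_measure M E (T f)) (\<lambda>r. r\<^sup>2)"
    by (simp add: integrable_iff_bounded measurable_cong_sets[OF sets_scalar_measure[OF pvm] refl])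
  then show ?thesis using dom[OF Tf] by blast
qed

section \<open>Eigenvectors of an operator with an arbitrary spectral measure\<close>

context
  fixes M :: "'a measure" and A E f and l :: real
  assumes spm: "spectral_measure M A E"
    and eigen: "(f, \<lambda>x. of_real l * f x) \<in> A"
    and sym: "\<And>h q. (h, q) \<in> A \<Longrightarrow> innerL2 M q f = of_real l * innerL2 M h f"
begin

private lemma pvm: "projection_valued_measure M E"
  using spm by (simp add: spectral_measure_def)

private lemma lin: "linear_operator M A"
  using spm by (simp add: spectral_measure_def)

private lemma f: "f \<in> L2 M"
  using lin eigen by (auto simp: linear_operator_def)

private lemma dom:
  assumes "h \<in> L2 M"
  shows "(\<exists>g. (h, g) \<in> A) \<longleftrightarrow> integrable (scalar_measure M E h) (\<lambda>r. r\<^sup>2)"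
proof -
  have "\<forall>h\<in>L2 M. (\<exists>g. (h, g) \<in> A) \<longleftrightarrow> integrable (scalar_measure M E h) (\<lambda>r. r\<^sup>2)"
    using spm unfolding spectral_measure_def by (elim conjE)
  with assms show ?thesis by simp
qed

private lemma form:
  assumes "(h, g) \<in> A"
  shows "innerL2 M g h = of_real (LINT r|scalar_measure M E h. r)"
proof -
  have "\<forall>(h, g)\<in>A. innerL2 M g h = of_real (LINT r|scalar_measure M E h. r)"
    using spm unfolding spectral_measure_def by (elim conjE)
  with assms show ?thesis by auto
qed

private lemma add_A: "(h, g) \<in> A \<Longrightarrow> (h', g') \<in> A \<Longrightarrow> (\<lambda>x. h x + h' x, \<lambda>x. g x + g' x) \<in> A"
  using lin unfolding linear_operator_def by (elim conjE) simp

private abbreviation "\<nu> \<equiv> scalar_measure M E f"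

private lemma nu_sets [measurable_cong]: "sets \<nu> = sets borel"
  by (rule sets_scalar_measure[OF pvm])

private lemma nu_space [simp]: "space \<nu> = UNIV"
  by (rule space_scalar_measure[OF pvm])

private lemma nu_finite: "finite_measure \<nu>"
  by (rule finite_measureI) (simp add: emeasure_scalar_measure[OF pvm f])

private lemma E_restrict:
  assumes S: "S \<in> sets borel" and T: "T \<in> sets borel"
  shows "normL2 M (E T (E S f)) = normL2 M (E (T \<inter> S) f)"
  using S T by (intro normL2_cong pvm_L2[OF pvm] f eqL2_sym[OF pvm_Int[OF pvm T S f]]) auto

private lemma scalar_measure_restrict:
  assumes S: "S \<in> sets borel"
  shows "scalar_measure M E (E S f) = density \<nu> (\<lambda>r. ennreal (indicator S r))"
proof (rule measure_eqI)
  show "sets (scalar_measure M E (E S f)) = sets (density \<nu> (\<lambda>r. ennreal (indicator S r)))"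
    by (simp add: sets_scalar_measure[OF pvm])
  fix T assume "T \<in> sets (scalar_measure M E (E S f))"
  then have T: "T \<in> sets borel" by (simp add: sets_scalar_measure[OF pvm])
  have "emeasure (density \<nu> (\<lambda>r. ennreal (indicator S r))) T = (\<integral>\<^sup>+r. ennreal (indicator S r) * indicator T r \<partial>\<nu>)"
    using S T by (intro emeasure_density) (auto simp: nu_sets)
  also have "\<dots> = (\<integral>\<^sup>+r. indicator (T \<inter> S) r \<partial>\<nu>)"
    by (intro nn_integral_cong) (auto simp: indicator_def)
  also have "\<dots> = emeasure \<nu> (T \<inter> S)" using S T by (intro nn_integral_indicator) (auto simp: nu_sets)
  also have "\<dots> = ennreal ((normL2 M (E (T \<inter> S) f))\<^sup>2)"
    using S T by (intro emeasure_scalar_measure[OF pvm f]) auto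
  also have "\<dots> = emeasure (scalar_measure M E (E S f)) T"
    using E_restrict[OF S T] emeasure_scalar_measure[OF pvm pvm_L2[OF pvm S f] T] by simp
  finally show "emeasure (scalar_measure M E (E S f)) T = emeasure (density \<nu> (\<lambda>r. ennreal (indicator S r))) T" ..
qed

text \<open>The component of \<open>f + E S f\<close> in the range of \<open>E S\<close> is twice
  that of \<open>f\<close>, and its squared norm four times: hence 1 + 3 on
  \<open>S\<close>.\<close>

private lemma scalar_measure_add_restrict:
  assumes S: "S \<in> sets borel"
  shows "scalar_measure M E (\<lambda>x. f x + E S f x) = density \<nu> (\<lambda>r. ennreal (1 + 3 * indicator S r))"
proof (rule measure_eqI)
  let ?k = "\<lambda>x. f x + E S f x"
  note h = pvm_L2[OF pvm S f]
  have k: "?k \<in> L2 M" using f h by (rule L2_add)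
  show "sets (scalar_measure M E ?k) = sets (density \<nu> (\<lambda>r. ennreal (1 + 3 * indicator S r)))"
    by (simp add: sets_scalar_measure[OF pvm])
  fix T assume "T \<in> sets (scalar_measure M E ?k)"
  then have T: "T \<in> sets borel" by (simp add: sets_scalar_measure[OF pvm])
  have TS: "T \<inter> S \<in> sets borel" using S T by auto
  note Tf = pvm_L2[OF pvm T f] and Th = pvm_L2[OF pvm T h] and STf = pvm_L2[OF pvm S pvm_L2[OF pvm T f]]
  have 1: "eqL2 M (E T (E S f)) (E S (E T f))"
    using eqL2_trans[OF eqL2_sym[OF pvm_Int[OF pvm T S f]]] pvm_Int[OF pvm S T f] by (simp add: Int_commute)
  have "innerL2 M (E T f) (E T (E S f)) = innerL2 M (E T f) (E S (E T f))"
    by (intro innerL2_cong Tf Th STf eqL2_refl 1)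
  also have "\<dots> = innerL2 M (E S (E T f)) (E T f)" by (rule pvm_selfadjoint[OF pvm S Tf Tf, symmetric])
  also have "\<dots> = of_real ((normL2 M (E S (E T f)))\<^sup>2)" by (rule pvm_inner_self[OF pvm S Tf])
  also have "normL2 M (E S (E T f)) = normL2 M (E (T \<inter> S) f)"
    using normL2_cong[OF Th STf 1] E_restrict[OF S T] by simp
  finally have ip: "innerL2 M (E T f) (E T (E S f)) = of_real ((normL2 M (E (T \<inter> S) f))\<^sup>2)" .
  have "(normL2 M (E T ?k))\<^sup>2 = (normL2 M (\<lambda>x. E T f x + E T (E S f) x))\<^sup>2"
    using normL2_cong[OF pvm_L2[OF pvm T k] L2_add[OF Tf Th] pvm_add[OF pvm T f h]] by simp
  also have "\<dots> = (normL2 M (E T f))\<^sup>2 + 3 * (normL2 M (E (T \<inter> S) f))\<^sup>2"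
    unfolding normL2_sq_add[OF Tf Th] ip E_restrict[OF S T] by simp
  finally have nk: "(normL2 M (E T ?k))\<^sup>2 = (normL2 M (E T f))\<^sup>2 + 3 * (normL2 M (E (T \<inter> S) f))\<^sup>2" .
  have "emeasure (density \<nu> (\<lambda>r. ennreal (1 + 3 * indicator S r))) T =
      (\<integral>\<^sup>+r. ennreal (1 + 3 * indicator S r) * indicator T r \<partial>\<nu>)"
    using S T by (intro emeasure_density) (auto simp: nu_sets)
  also have "\<dots> = (\<integral>\<^sup>+r. indicator T r + 3 * indicator (T \<inter> S) r \<partial>\<nu>)"
    by (intro nn_integral_cong) (auto simp: indicator_def ennreal_plus[symmetric] simp del: ennreal_plus)
  also have "\<dots> = (\<integral>\<^sup>+r. indicator T r \<partial>\<nu>) + (\<integral>\<^sup>+r. 3 * indicator (T \<inter> S) r \<partial>\<nu>)"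
    using T TS by (intro nn_integral_add) (auto simp: nu_sets)
  also have "(\<integral>\<^sup>+r. 3 * indicator (T \<inter> S) r \<partial>\<nu>) = 3 * (\<integral>\<^sup>+r. indicator (T \<inter> S) r \<partial>\<nu>)"
    using TS by (intro nn_integral_cmult) (auto simp: nu_sets)
  also have "(\<integral>\<^sup>+r. indicator T r \<partial>\<nu>) + 3 * (\<integral>\<^sup>+r. indicator (T \<inter> S) r \<partial>\<nu>) = emeasure \<nu> T + 3 * emeasure \<nu> (T \<inter> S)"
    using T TS by (simp add: nn_integral_indicator nu_sets)
  also have "\<dots> = ennreal ((normL2 M (E T f))\<^sup>2) + ennreal 3 * ennreal ((normL2 M (E (T \<inter> S) f))\<^sup>2)"
    by (simp add: emeasure_scalar_measure[OF pvm f T] emeasure_scalar_measure[OF pvm f TS])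
  also have "\<dots> = ennreal ((normL2 M (E T ?k))\<^sup>2)"
    unfolding nk by (simp add: ennreal_mult' ennreal_plus)
  also have "\<dots> = emeasure (scalar_measure M E ?k) T"
    by (rule emeasure_scalar_measure[OF pvm k T, symmetric])
  finally show "emeasure (scalar_measure M E ?k) T = emeasure (density \<nu> (\<lambda>r. ennreal (1 + 3 * indicator S r))) T" ..
qed

text \<open>For a bounded Borel set \<open>S\<close> on one side of \<open>l\<close>, put \<open>h = E S f\<close>.  The quadratic form of \<open>A\<close>
  at \<open>f + h\<close> together with the eigenvalue equation forces the scalar measure of \<open>f\<close> to vanish
  on \<open>S\<close>, so that it is concentrated on \<open>{l}\<close>.\<close>

private lemma eigen_bounded_vanishing:
  assumes S: "S \<in> sets borel" and B: "S \<subseteq> {-B..B}" and side: "S \<subseteq> {l<..} \<or> S \<subseteq> {..<l}"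
  shows "normL2 M (E S f) = 0"
proof -
  interpret finite_measure \<nu> by (rule nu_finite)
  note h = pvm_L2[OF pvm S f]
  have meas [measurable]: "S \<in> sets borel" by (rule S)
  have bd: "\<bar>r\<bar> \<le> B" if "r \<in> S" for r using subsetD[OF B that] by (auto simp: abs_le_iff)
  have int1: "integrable \<nu> (\<lambda>r. indicator S r * r)"
    using bd by (intro integrable_const_bound[where B="\<bar>B\<bar>"]) (auto simp: indicator_def intro!: AE_I2 order_trans[OF _ abs_ge_self])
  have int2: "integrable \<nu> (\<lambda>r. indicator S r * r\<^sup>2)"
    using bd by (intro integrable_const_bound[where B="B\<^sup>2"]) (auto simp: indicator_def intro!: AE_I2 abs_le_square_iff[THEN iffD1] order_trans[OF _ abs_ge_self])
  have intS: "integrable \<nu> (\<lambda>r. indicator S r :: real)"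
    by (intro integrable_const_bound[where B=1]) (auto simp: indicator_def)
  have "integrable \<nu> (\<lambda>r. r\<^sup>2)" using dom[OF f] eigen by blast
  then have "integrable \<nu> (\<lambda>r. 1 + r\<^sup>2)" by simp
  then have int0: "integrable \<nu> (\<lambda>r. r)"
  proof (rule Bochner_Integration.integrable_bound)
    have "\<bar>r\<bar> \<le> 1 + r\<^sup>2" for r :: real
      using sum_squares_bound[of 1 "\<bar>r\<bar>"] by (simp add: power2_eq_square)
    then show "AE r in \<nu>. norm r \<le> norm (1 + r\<^sup>2)" by simp
  qed simp
  \<comment> \<open>Boundedness of \<open>S\<close> puts \<open>E S f\<close> into the domain of
    \<open>A\<close>.\<close>
  have "integrable (scalar_measure M E (E S f)) (\<lambda>r. r\<^sup>2)"
    unfolding scalar_measure_restrict[OF S] using int2 by (subst integrable_real_density) auto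
  then obtain q where q: "(E S f, q) \<in> A" using dom[OF h] by blast
  have qL: "q \<in> L2 M" using lin q by (auto simp: linear_operator_def)
  have lf: "(\<lambda>x. of_real l * f x) \<in> L2 M" using f by (rule L2_cmult)
  have q1: "innerL2 M q (E S f) = of_real (LINT r|\<nu>. indicator S r * r)"
    unfolding form[OF q] scalar_measure_restrict[OF S] by (subst integral_real_density) auto
  have q2: "innerL2 M (\<lambda>x. of_real l * f x + q x) (\<lambda>x. f x + E S f x) = of_real (LINT r|\<nu>. (1 + 3 * indicator S r) * r)"
    unfolding form[OF add_A[OF eigen q]] scalar_measure_add_restrict[OF S] by (subst integral_real_density) auto
  have "(LINT r|\<nu>. (1 + 3 * indicator S r) * r) = (LINT r|\<nu>. r + 3 * (indicator S r * r))"
    by (simp add: algebra_simps)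
  also have "\<dots> = (LINT r|\<nu>. r) + 3 * (LINT r|\<nu>. indicator S r * r)"
    using int0 int1 by simp
  finally have q3: "innerL2 M (\<lambda>x. of_real l * f x + q x) (\<lambda>x. f x + E S f x) =
    of_real ((LINT r|\<nu>. r) + 3 * (LINT r|\<nu>. indicator S r * r))" using q2 by simp
  have hf: "innerL2 M (E S f) f = of_real ((normL2 M (E S f))\<^sup>2)" by (rule pvm_inner_self[OF pvm S f])
  have fh: "innerL2 M f (E S f) = of_real ((normL2 M (E S f))\<^sup>2)"
    using hf by (subst innerL2_commute) simp
  \<comment> \<open>The mixed terms pair Af with h and Ah with f; the eigenvalue equation and
    \<open>sym\<close> turn each into \<open>l\<close> times the squared norm of h. Comparison with
    the density 1 + 3 leaves the integral of r over \<open>S\<close> equal to \<open>l\<close> times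
    the measure of \<open>S\<close>.\<close>
  have "innerL2 M (\<lambda>x. of_real l * f x + q x) (\<lambda>x. f x + E S f x) =
    innerL2 M (\<lambda>x. of_real l * f x) f + of_real l * innerL2 M f (E S f) + innerL2 M q f + innerL2 M q (E S f)"
    using lf qL f h by (simp add: innerL2_add_left innerL2_add_right innerL2_cmult_left L2_add distrib_left)
  also have "innerL2 M (\<lambda>x. of_real l * f x) f = of_real (LINT r|\<nu>. r)" by (rule form[OF eigen])
  finally have "of_real (2 * (LINT r|\<nu>. indicator S r * r)) = complex_of_real (2 * (l * (normL2 M (E S f))\<^sup>2))"
    unfolding q3 q1 sym[OF q] hf fh by (simp add: algebra_simps)
  then have *: "(LINT r|\<nu>. indicator S r * r) = l * (normL2 M (E S f))\<^sup>2"
    unfolding of_real_eq_iff by simp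
  have "measure \<nu> S = (normL2 M (E S f))\<^sup>2"
    by (simp add: measure_def emeasure_scalar_measure[OF pvm f S])
  then have mS: "(LINT r|\<nu>. indicator S r) = (normL2 M (E S f))\<^sup>2" by simp
  have int3: "integrable \<nu> (\<lambda>r. indicator S r * (r - l))"
    using Bochner_Integration.integrable_diff[OF int1 integrable_mult_left[OF intS, of l]]
    by (simp add: algebra_simps)
  have zero: "(LINT r|\<nu>. indicator S r * (r - l)) = 0"
    using * mS int1 intS by (simp add: right_diff_distrib)
  \<comment> \<open>On \<open>S\<close> the factor r - l has a constant sign, so a vanishing
    integral makes the integrand vanish; as \<open>S\<close> misses \<open>l\<close>, the indicator
    itself then vanishes almost everywhere.\<close>
  have "AE r in \<nu>. indicator S r * (r - l) = 0"
  proof (cases "S \<subseteq> {l<..}")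
    case True
    then have "AE r in \<nu>. 0 \<le> indicator S r * (r - l)" by (intro AE_I2) (auto simp: indicator_def)
    then show ?thesis using integral_nonneg_eq_0_iff_AE[OF int3] zero by simp
  next
    case False
    then have "AE r in \<nu>. 0 \<le> - (indicator S r * (r - l))" using side by (intro AE_I2) (auto simp: indicator_def)
    then have "AE r in \<nu>. - (indicator S r * (r - l)) = 0"
      using integral_nonneg_eq_0_iff_AE[OF Bochner_Integration.integrable_minus[OF int3]] zero by simp
    then show ?thesis by simp
  qed
  then have "AE r in \<nu>. indicator S r = (0::real)"
    by eventually_elim (use side in \<open>auto simp: indicator_def split: if_splits\<close>)
  then have "(LINT r|\<nu>. indicator S r) = (LINT r|\<nu>. 0::real)"
    by (intro integral_cong_AE) auto
  with mS show ?thesis by simp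
qed

text \<open>The complement of {l} is a countable union of bounded sets on one side of
  \<open>l\<close>, whose projections all annihilate \<open>f\<close>. By additivity the norm of
  \<open>E {l} f\<close> is that of \<open>f\<close>, and a projection that keeps the norm of a
  vector fixes it.\<close>

lemma spectral_measure_eigenvector: "eqL2 M (E {l} f) f"
proof -
  \<comment> \<open>Apart from {l} itself these are the unit intervals from l + k to l + k + 1 with
    \<open>l\<close> removed, listed by \<open>int_decode\<close>; those with k \<ge> 0 lie to the
    right of \<open>l\<close>, the others to the left.\<close>
  define A' :: "nat \<Rightarrow> real set" where
    "A' n = (case n of 0 \<Rightarrow> {l} | Suc m \<Rightarrow> {r. r \<noteq> l \<and> \<lfloor>r - l\<rfloor> = int_decode m})" for n
  have A'_sets: "A' n \<in> sets borel" for n by (cases n) (auto simp: A'_def)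
  have disj: "disjoint_family A'"
    unfolding disjoint_family_on_def
  proof (intro ballI impI)
    fix m n :: nat assume "m \<noteq> n"
    then show "A' m \<inter> A' n = {}"
      by (cases m; cases n) (auto simp: A'_def dest: injD[OF inj_int_decode])
  qed
  have U: "(\<Union>n. A' n) = UNIV"
  proof -
    have "r \<in> A' (if r = l then 0 else Suc (int_encode \<lfloor>r - l\<rfloor>))" for r
      by (simp add: A'_def)
    then show ?thesis by blast
  qed
  have zero: "normL2 M (E (A' (Suc m)) f) = 0" for m
  proof (rule eigen_bounded_vanishing[OF A'_sets])
    let ?k = "int_decode m"
    have r: "r \<noteq> l \<and> of_int ?k \<le> r - l \<and> r - l < of_int ?k + 1" if "r \<in> A' (Suc m)" for r
      using that floor_correct[of "r - l"] by (auto simp: A'_def)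
    show "A' (Suc m) \<subseteq> {-(\<bar>l\<bar> + \<bar>of_int ?k\<bar> + 1)..\<bar>l\<bar> + \<bar>of_int ?k\<bar> + 1}"
      using r by (force simp: abs_if)
    show "A' (Suc m) \<subseteq> {l<..} \<or> A' (Suc m) \<subseteq> {..<l}"
    proof (cases "?k \<ge> 0")
      case True
      then have "(0::real) \<le> of_int ?k" by simp
      then show ?thesis using r by force
    next
      case False
      then have "?k + 1 \<le> 0" by simp
      then have "of_int ?k + 1 \<le> (0::real)" by (metis of_int_1 of_int_add of_int_le_0_iff)
      then show ?thesis using r by force
    qed
  qed
  have "(\<lambda>n. (normL2 M (E (A' n) f))\<^sup>2) sums (normL2 M (E UNIV f))\<^sup>2"
    using pvm_norm_sq_sums[OF pvm _ disj f] A'_sets unfolding U by blast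
  moreover have "(\<lambda>n. (normL2 M (E (A' n) f))\<^sup>2) sums (\<Sum>n\<in>{0}. (normL2 M (E (A' n) f))\<^sup>2)"
    using zero by (intro sums_finite) (auto simp: gr0_conv_Suc)
  ultimately have "(normL2 M (E UNIV f))\<^sup>2 = (normL2 M (E {l} f))\<^sup>2"
    using sums_unique2 by (fastforce simp: A'_def)
  moreover have "normL2 M (E UNIV f) = normL2 M f"
    by (intro normL2_cong pvm_L2[OF pvm] f pvm_UNIV[OF pvm f]) auto
  ultimately have n: "(normL2 M f)\<^sup>2 = (normL2 M (E {l} f))\<^sup>2" by simp
  have sl: "{l} \<in> sets borel" by simp
  note El = pvm_L2[OF pvm sl f]
  have "(normL2 M (\<lambda>x. E {l} f x - f x))\<^sup>2 = 0"
    unfolding normL2_sq_diff[OF El f] pvm_inner_self[OF pvm sl f] using n by simp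
  then show ?thesis using El f by (simp add: eqL2_iff_norm_diff)
qed

end

section \<open>Completeness of the trigonometric system\<close>

lemma ee_0 [simp]: "ee 0 = 1"
  by (simp add: ee_def)

lemma ee_add: "ee (a + b) = ee a * ee b"
  by (simp add: ee_def distrib_left exp_add)

lemma ee_cis: "ee r = cis (2 * pi * r)"
  by (simp add: ee_def cis_conv_exp mult.assoc)

lemma norm_ee [simp]: "cmod (ee r) = 1"
  by (simp add: ee_cis)

lemma cnj_ee: "cnj (ee r) = ee (- r)"
  by (simp add: ee_cis cis_cnj)

lemma ee_mult_minus [simp]: "ee r * ee (- r) = 1" "ee (- r) * ee r = 1"
  by (simp_all flip: ee_add)

lemma ee_int [simp]: "ee (of_int n) = 1"
  by (simp add: ee_cis cis_multiple_2pi)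

lemma ee_eq_iff: "ee a = ee b \<longleftrightarrow> (\<exists>n::int. a = b + of_int n)"
proof -
  have "ee a = ee b \<longleftrightarrow> (\<exists>n::int. 2 * pi * a = 2 * pi * b + of_int n * (2 * pi))"
    using exp_eq[of "\<i> * of_real (2 * pi * a)" "\<i> * of_real (2 * pi * b)"]
    by (simp add: ee_cis cis_conv_exp complex_eq_iff mult_ac)
  also have "\<dots> \<longleftrightarrow> (\<exists>n::int. 2 * pi * a = 2 * pi * (b + of_int n))" by (simp add: algebra_simps)
  finally show ?thesis by simp
qed

lemma ee_continuous [continuous_intros]: "continuous_on A f \<Longrightarrow> continuous_on A (\<lambda>x. ee (f x))"
  unfolding ee_def by (intro continuous_intros)

lemma ee_measurable [measurable]: "ee \<in> borel_measurable borel"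
  by (intro borel_measurable_continuous_onI continuous_intros)

lemma ee_has_vector_derivative:
  "((\<lambda>x. ee (a * x)) has_vector_derivative (\<i> * 2 * of_real pi * of_real a * ee (a * x))) (at x within A)"
proof -
  have "((\<lambda>z. exp (\<i> * 2 * of_real pi * of_real a * z)) has_field_derivative
      (\<i> * 2 * of_real pi * of_real a * exp (\<i> * 2 * of_real pi * of_real a * of_real x))) (at (of_real x))"
    by (auto intro!: derivative_eq_intros)
  from has_vector_derivative_real_field[OF this, of A] show ?thesis
    by (simp add: ee_def mult.assoc)
qed

section \<open>The unit interval as a probability space\<close>

lemma space_unit_interval [simp]: "space unit_interval = {0..1}"
  by (simp add: unit_interval_def space_restrict_space)

lemma prob_space_unit_interval: "prob_space unit_interval"
  by (rule prob_spaceI) (simp add: unit_interval_def space_restrict_space emeasure_restrict_space)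

interpretation UI: prob_space unit_interval
  by (rule prob_space_unit_interval)

lemma measurable_unit_interval: "f \<in> measurable borel N \<Longrightarrow> f \<in> measurable unit_interval N"
  unfolding unit_interval_def by (intro measurable_restrict_space1) simp

lemma integral_unit_interval:
  "integral\<^sup>L unit_interval f = set_lebesgue_integral lborel {0..1} f"
  for f :: "real \<Rightarrow> 'b :: {banach, second_countable_topology}"
  unfolding unit_interval_def set_lebesgue_integral_def by (subst integral_restrict_space) auto

lemma integrable_unit_interval:
  "integrable unit_interval f \<longleftrightarrow> set_integrable lborel {0..1} f"
  for f :: "real \<Rightarrow> 'b :: {banach, second_countable_topology}"
  unfolding unit_interval_def set_integrable_def by (subst integrable_restrict_space) auto

lemma integral_unit_interval_FTC:
  fixes F f :: "real \<Rightarrow> 'b :: euclidean_space"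
  assumes "\<And>x. x \<in> {0..1} \<Longrightarrow> (F has_vector_derivative f x) (at x within {0..1})"
    and "continuous_on {0..1} f"
  shows "integral\<^sup>L unit_interval f = F 1 - F 0"
  unfolding integral_unit_interval set_lebesgue_integral_def
  using integral_FTC_Icc[of 0 1 F f] assms by simp

lemma integral_ee_int: "(LINT x|unit_interval. ee (of_int m * x)) = (if m = 0 then 1 else 0)"
proof (cases "m = 0")
  case True
  then show ?thesis using UI.prob_space by simp
next
  case False
  define c where "c = \<i> * 2 * of_real pi * of_int m"
  have c: "c \<noteq> 0" using False by (simp add: c_def)
  have "(LINT x|unit_interval. ee (of_int m * x)) = ee (of_int m * 1) / c - ee (of_int m * 0) / c"
  proof (rule integral_unit_interval_FTC)
    fix x :: real
    show "((\<lambda>x. ee (of_int m * x) / c) has_vector_derivative ee (of_int m * x)) (at x within {0..1})"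
      using has_vector_derivative_divide[OF ee_has_vector_derivative[of "of_int m" x "{0..1}"], of c] c
      by (simp add: c_def)
  qed (intro continuous_intros)
  also have "\<dots> = 0" using ee_int[of m] by simp
  finally show ?thesis using False by simp
qed

text \<open>Dynkin's argument for the complex measure with density \<open>f\<close>. It is used with
  the open sets of the line and with measurable rectangles.\<close>

lemma AE_zero_if_integral_zero_on_generator:
  fixes f :: "'a \<Rightarrow> complex"
  assumes "sigma_finite_measure M" and int: "integrable M f" and G: "sets M = sigma_sets (space M) G" "Int_stable G" "G \<subseteq> Pow (space M)" "space M \<in> G"
    and zero: "\<And>A. A \<in> G \<Longrightarrow> set_lebesgue_integral M A f = 0"
  shows "AE x in M. f x = 0"
proof (rule sigma_finite_measure.density_zero[OF assms(1) int])
  have si: "set_integrable M A f" if "A \<in> sets M" for A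
    unfolding set_integrable_def by (rule integrable_mult_indicator[OF that int])
  fix A assume "A \<in> sets M"
  then have "A \<in> sigma_sets (space M) G" by (simp only: G(1))
  with G(2,3) show "set_lebesgue_integral M A f = 0"
  proof (induction rule: sigma_sets_induct_disjoint)
    case (basic A)
    then show ?case by (rule zero)
  next
    case empty
    show ?case by (simp add: set_lebesgue_integral_def)
  next
    case (compl A)
    then have A: "A \<in> sets M" by (simp add: G(1))
    have "set_lebesgue_integral M (space M) f =
       set_lebesgue_integral M A f + set_lebesgue_integral M (space M - A) f"
      using A sets.sets_into_space[OF A] by (subst set_integral_Un[symmetric]) (auto intro!: si simp: Un_absorb1)
    then show ?case using compl zero[OF G(4)] by simp
  next
    case (union A)
    have A: "A i \<in> sets M" for i using union(2) by (auto simp: G(1))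
    have "set_lebesgue_integral M (\<Union>i. A i) f = (\<Sum>i. set_lebesgue_integral M (A i) f)"
      using A union(1) by (intro lebesgue_integral_countable_add si) (auto simp: disjoint_family_on_def)
    then show ?case using union(3) by simp
  qed
qed

text \<open>An inductive closure rather than a class of explicit finite sums: products and integral
  identities then follow by rule induction.\<close>

inductive trig_poly :: "(real \<Rightarrow> complex) \<Rightarrow> bool" where
  trig_monom: "trig_poly (\<lambda>x. c * ee (of_int n * x))"
| trig_add: "trig_poly g \<Longrightarrow> trig_poly h \<Longrightarrow> trig_poly (\<lambda>x. g x + h x)"

lemma trig_mult:
  assumes "trig_poly g" "trig_poly h" shows "trig_poly (\<lambda>x. g x * h x)"
  using assms(1)
proof induction
  case (trig_monom c n)
  show ?case using assms(2)
  proof induction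
    case (trig_monom d m)
    have "(\<lambda>x. c * ee (of_int n * x) * (d * ee (of_int m * x))) = (\<lambda>x. (c * d) * ee (of_int (n + m) * x))"
      by (simp add: ee_add distrib_right distrib_left mult_ac)
    then show ?case using trig_poly.trig_monom[of "c * d" "n + m"] by (simp only:)
  next
    case (trig_add g h)
    then show ?case using trig_poly.trig_add by (simp add: distrib_left)
  qed
next
  case (trig_add g h)
  then show ?case using trig_poly.trig_add by (simp add: distrib_right)
qed

lemma trig_cmult: "trig_poly g \<Longrightarrow> trig_poly (\<lambda>x. c * g x)"
  using trig_mult[OF trig_monom[of c 0], of g] by simp

text \<open>On the unit circle the real and imaginary parts are combinations of e(x) and e(-x), so
  the polynomials supplied by Stone-Weierstrass become trigonometric polynomials.\<close>

lemma trig_polynomial: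
  assumes "real_polynomial_function p" shows "trig_poly (\<lambda>x. of_real (p (ee x)))"
  using assms
proof induction
  case (linear f)
  have re: "trig_poly (\<lambda>x. of_real (Re (ee x)))"
  proof -
    have "(\<lambda>x. of_real (Re (ee x))) = (\<lambda>x. 1/2 * ee (of_int 1 * x) + 1/2 * ee (of_int (-1) * x))"
      by (auto simp: ee_cis complex_eq_iff fun_eq_iff)
    then show ?thesis using trig_add[OF trig_monom[of "1/2" 1] trig_monom[of "1/2" "-1"]] by (simp only:)
  qed
  have im: "trig_poly (\<lambda>x. of_real (Im (ee x)))"
  proof -
    have "(\<lambda>x. of_real (Im (ee x))) = (\<lambda>x. (- \<i> / 2) * ee (of_int 1 * x) + (\<i> / 2) * ee (of_int (-1) * x))"
      by (auto simp: ee_cis complex_eq_iff fun_eq_iff)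
    then show ?thesis using trig_add[OF trig_monom[of "- \<i> / 2" 1] trig_monom[of "\<i> / 2" "-1"]] by (simp only:)
  qed
  have "f z = f 1 * Re z + f \<i> * Im z" for z
  proof -
    have "z = Re z *\<^sub>R 1 + Im z *\<^sub>R \<i>" by (simp add: complex_eq_iff)
    then have "f z = f (Re z *\<^sub>R 1 + Im z *\<^sub>R \<i>)" by (rule arg_cong)
    also have "\<dots> = f 1 * Re z + f \<i> * Im z"
      using linear by (simp add: linear_add bounded_linear.linear linear_cmul mult.commute)
    finally show ?thesis .
  qed
  then have "(\<lambda>x. of_real (f (ee x))) =
      (\<lambda>x. of_real (f 1) * of_real (Re (ee x)) + of_real (f \<i>) * complex_of_real (Im (ee x)))"
    by (metis of_real_add of_real_mult)
  then show ?case
    using trig_add[OF trig_cmult[OF re, of "of_real (f 1)"] trig_cmult[OF im, of "of_real (f \<i>)"]] by (simp only:)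
next
  case (const c)
  show ?case using trig_monom[of "of_real c" 0] by simp
next
  case (add f g)
  then show ?case using trig_add by simp
next
  case (mult f g)
  then show ?case using trig_mult by simp
qed

lemma trig_integral_zero:
  assumes f: "integrable unit_interval f"
    and zero: "\<And>n::int. (LINT x|unit_interval. f x * ee (of_int n * x)) = 0"
    and "trig_poly g"
  shows "integrable unit_interval (\<lambda>x. f x * g x) \<and> (LINT x|unit_interval. f x * g x) = 0"
  using assms(3)
proof induction
  case (trig_monom c n)
  have m: "(\<lambda>x. ee (of_int n * x)) \<in> borel_measurable unit_interval"
    by (rule measurable_unit_interval) measurable
  have "integrable unit_interval (\<lambda>x. f x * ee (of_int n * x))"
    by (rule Bochner_Integration.integrable_bound[OF f]) (use m f in \<open>auto simp: norm_mult\<close>)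
  then have "integrable unit_interval (\<lambda>x. c * (f x * ee (of_int n * x)))" by simp
  moreover have "(LINT x|unit_interval. c * (f x * ee (of_int n * x))) = 0" using zero[of n] by simp
  moreover have "(\<lambda>x. c * (f x * ee (of_int n * x))) = (\<lambda>x. f x * (c * ee (of_int n * x)))" by (simp add: mult_ac)
  ultimately show ?case by (simp only:)
next
  case (trig_add g h)
  then show ?case by (simp add: distrib_left)
qed

text \<open>Stone-Weierstrass on the circle: uniform approximation of \<open>G\<close> suffices
  because \<open>f\<close> is integrable.\<close>

lemma continuous_circle_integral_zero:
  fixes G :: "complex \<Rightarrow> real"
  assumes f: "integrable unit_interval f"
    and zero: "\<And>n::int. (LINT x|unit_interval. f x * ee (of_int n * x)) = 0"
    and G: "continuous_on UNIV G"
  shows "(LINT x|unit_interval. f x * of_real (G (ee x))) = 0"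
proof -
  let ?I = "LINT x|unit_interval. f x * of_real (G (ee x))"
  have "cmod ?I \<le> 0"
  proof (rule field_le_epsilon)
    fix e :: real assume e: "e > 0"
    \<comment> \<open>The \<open>+ 1\<close> makes \<open>N\<close> positive even if
      \<open>f\<close> vanishes.\<close>
    define N where "N = (LINT x|unit_interval. cmod (f x)) + 1"
    have N: "N > 0" unfolding N_def by (intro add_nonneg_pos integral_nonneg) auto
    obtain p where p: "real_polynomial_function p" "\<And>z. z \<in> sphere 0 1 \<Longrightarrow> \<bar>G z - p z\<bar> < e / N"
      using Stone_Weierstrass_real_polynomial_function[of "sphere 0 1" G "e / N"] e N continuous_on_subset[OF G]
      by (metis compact_sphere divide_pos_pos subset_UNIV)
    note t = trig_integral_zero[OF f zero trig_polynomial[OF p(1)]]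
    have bd: "\<bar>G (ee x) - p (ee x)\<bar> < e / N" for x by (rule p) simp
    have pc: "continuous_on UNIV p"
      using p(1) by (simp add: continuous_on_polymonial_function real_polynomial_function_eq)
    have m: "(\<lambda>x. G (ee x) - p (ee x)) \<in> borel_measurable unit_interval"
      by (intro measurable_unit_interval borel_measurable_diff measurable_compose[OF ee_measurable]
        borel_measurable_continuous_onI G pc)
    have fm: "f \<in> borel_measurable unit_interval" using f by auto
    have id: "integrable unit_interval (\<lambda>x. f x * of_real (G (ee x) - p (ee x)))"
    proof (rule Bochner_Integration.integrable_bound)
      show "integrable unit_interval (\<lambda>x. (e / N) *\<^sub>R f x)" using f by simp
      have "cmod (f x * of_real (G (ee x) - p (ee x))) \<le> norm ((e / N) *\<^sub>R f x)" for x
      proof -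
        have "cmod (f x * of_real (G (ee x) - p (ee x))) = \<bar>G (ee x) - p (ee x)\<bar> * cmod (f x)"
          unfolding norm_mult norm_of_real by simp
        also have "\<dots> \<le> (e / N) * cmod (f x)" using bd[of x] by (intro mult_right_mono) auto
        finally show ?thesis using e N by simp
      qed
      then show "AE x in unit_interval. cmod (f x * of_real (G (ee x) - p (ee x))) \<le> norm ((e / N) *\<^sub>R f x)" by simp
    qed (use m fm in measurable)
    have "?I = (LINT x|unit_interval. f x * of_real (G (ee x) - p (ee x)) + f x * of_real (p (ee x)))"
      by (simp add: algebra_simps)
    also have "\<dots> = (LINT x|unit_interval. f x * of_real (G (ee x) - p (ee x)))"
      using id t by simp
    also have "cmod \<dots> \<le> (LINT x|unit_interval. cmod (f x * of_real (G (ee x) - p (ee x))))"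
      by (rule integral_norm_bound)
    also have "\<dots> \<le> (LINT x|unit_interval. (e / N) * cmod (f x))"
    proof (rule integral_mono)
      show "integrable unit_interval (\<lambda>x. (e / N) * cmod (f x))" using f by simp
      show "integrable unit_interval (\<lambda>x. cmod (f x * of_real (G (ee x) - p (ee x))))"
        using id by (rule integrable_norm)
      fix x
      show "cmod (f x * of_real (G (ee x) - p (ee x))) \<le> e / N * cmod (f x)"
        using mult_right_mono[OF less_imp_le[OF bd[of x]], of "cmod (f x)"]
        unfolding norm_mult norm_of_real by (simp add: mult.commute)
    qed
    also have "\<dots> = e * (N - 1) / N" by (simp add: N_def)
    also have "\<dots> \<le> e" using e N by (simp add: field_simps)
    finally show "cmod ?I \<le> 0 + e" by simp
  qed
  then show ?thesis by simp
qed

text \<open>An open set \<open>W\<close> inside \<open>(0,1)\<close> is the preimage of an open subset of the circle, whose indicator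
  is a limit of continuous functions on the circle.\<close>

lemma Fourier_total:
  assumes f: "integrable unit_interval f"
    and zero: "\<And>n::int. (LINT x|unit_interval. f x * ee (of_int n * x)) = 0"
  shows "AE x in unit_interval. f x = 0"
proof -
  define F where "F x = indicator {0..1} x *\<^sub>R f x" for x
  have F: "integrable lborel F" using f unfolding F_def integrable_unit_interval set_integrable_def .
  have "AE x in lborel. F x = 0"
  proof (rule AE_zero_if_integral_zero_on_generator[OF sigma_finite_lborel F])
    show "sets lborel = sigma_sets (space lborel) {S :: real set. open S}"
      by (simp add: borel_def)
    show "Int_stable {S :: real set. open S}" by (auto simp: Int_stable_def)
    fix V :: "real set" assume "V \<in> {S. open S}"
    then have V: "open V" by simp
    \<comment> \<open>The points 0 and 1 have the same image on the circle and are removed; a point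
      of the open interval shares its image with no other point of [0,1], so \<open>W\<close> can be
      recovered from \<open>C\<close>.\<close>
    define W where "W = V \<inter> {0<..<1}"
    have W: "open W" using V by (auto simp: W_def)
    define C where "C = ee ` ({0..1} - W)"
    have "compact ({0..1} - W)" using W by (intro compact_diff compact_Icc)
    then have C: "closed C" unfolding C_def
      by (intro compact_imp_closed compact_continuous_image continuous_intros)
    have C0: "C \<noteq> {}" unfolding C_def W_def by force
    have iff: "ee x \<in> C \<longleftrightarrow> x \<notin> W" if x: "x \<in> {0..1}" for x
    proof
      assume "ee x \<in> C"
      then obtain y where y: "y \<in> {0..1}" "y \<notin> W" "ee x = ee y" by (auto simp: C_def)
      then obtain n :: int where n: "x = y + of_int n" by (auto simp: ee_eq_iff)
      show "x \<notin> W"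
      proof
        assume xW: "x \<in> W"
        then have "0 < x" "x < 1" by (auto simp: W_def)
        then have "of_int n < (1::real)" "(-1::real) < of_int n" using n y(1) by auto
        then have "n = 0" by linarith
        with n y xW show False by simp
      qed
    qed (use x in \<open>auto simp: C_def\<close>)
    \<comment> \<open>Zero on \<open>C\<close> and, at a point off the closed set \<open>C\<close>,
      equal to 1 as soon as \<open>k\<close> exceeds the reciprocal of its distance to
      \<open>C\<close>.\<close>
    define G where "G k z = min 1 (real k * infdist z C)" for k :: nat and z
    have Gc: "continuous_on UNIV (G k)" for k unfolding G_def by (intro continuous_intros)
    have fm: "f \<in> borel_measurable unit_interval" using f by auto
    have "(\<lambda>k. LINT x|unit_interval. f x * of_real (G k (ee x))) \<longlonglongrightarrow> (LINT x|unit_interval. f x * indicator W x)"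
    proof (rule integral_dominated_convergence)
      show "(\<lambda>x. f x * indicator W x) \<in> borel_measurable unit_interval"
        using W by (intro borel_measurable_times fm measurable_unit_interval[OF borel_measurable_indicator]) auto
      show "(\<lambda>x. f x * of_real (G k (ee x))) \<in> borel_measurable unit_interval" for k
        using fm measurable_unit_interval[OF measurable_compose[OF ee_measurable borel_measurable_continuous_onI[OF Gc[of k]]]]
        by measurable
      show "integrable unit_interval (\<lambda>x. cmod (f x))" using f by simp
      have "0 \<le> G k z \<and> G k z \<le> 1" for k z by (auto simp: G_def infdist_nonneg)
      then show "AE x in unit_interval. cmod (f x * of_real (G k (ee x))) \<le> cmod (f x)" for k
        by (auto simp: norm_mult mult_left_le)
      show "AE x in unit_interval. (\<lambda>k. f x * of_real (G k (ee x))) \<longlonglongrightarrow> f x * indicator W x"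
      proof (rule AE_I2)
        fix x assume "x \<in> space unit_interval"
        then have x: "x \<in> {0..1}" by simp
        have "(\<lambda>k. G k (ee x)) \<longlonglongrightarrow> indicator W x"
        proof (cases "x \<in> W")
          case True
          then have "ee x \<notin> C" using iff[OF x] by simp
          then have d: "infdist (ee x) C > 0" using C C0 by (metis infdist_pos_not_in_closed)
          obtain k0 :: nat where k0: "1 / infdist (ee x) C < real k0" using reals_Archimedean2 by blast
          have "G k (ee x) = 1" if "k \<ge> k0" for k
          proof -
            have "1 / infdist (ee x) C < real k" using k0 that by (metis of_nat_le_iff order_less_le_trans)
            then have "1 < real k * infdist (ee x) C" using d by (simp add: pos_divide_less_eq)
            then show ?thesis by (simp add: G_def)
          qed
          then have "eventually (\<lambda>k. G k (ee x) = 1) sequentially" by (auto simp: eventually_sequentially)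
          then show ?thesis using True by (auto intro: tendsto_eventually)
        next
          case False
          then have "ee x \<in> C" using iff[OF x] by simp
          then have "G k (ee x) = 0" for k by (simp add: G_def)
          then show ?thesis using False by simp
        qed
        then have "(\<lambda>k. f x * of_real (G k (ee x))) \<longlonglongrightarrow> f x * of_real (indicator W x)"
          by (intro tendsto_intros)
        then show "(\<lambda>k. f x * of_real (G k (ee x))) \<longlonglongrightarrow> f x * indicator W x"
          by (auto simp: indicator_def split: if_splits)
      qed
    qed
    then have "(LINT x|unit_interval. f x * indicator W x) = 0"
      unfolding continuous_circle_integral_zero[OF f zero Gc] by (simp add: LIMSEQ_const_iff)
    moreover have "set_lebesgue_integral lborel V F = (LINT x|unit_interval. f x * indicator W x)"
      unfolding integral_unit_interval set_lebesgue_integral_def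
    proof (rule integral_cong_AE)
      have "AE x in lborel. x \<noteq> (0::real)" "AE x in lborel. x \<noteq> (1::real)"
        by (rule AE_lborel_singleton)+
      then show "AE x in lborel. indicator V x *\<^sub>R F x = indicator {0..1} x *\<^sub>R (f x * indicator W x)"
        by eventually_elim (auto simp: F_def W_def indicator_def)
      have [measurable]: "F \<in> borel_measurable borel" using F by auto
      have [measurable]: "V \<in> sets borel" "W \<in> sets borel" using V W by auto
      show "(\<lambda>x. indicator V x *\<^sub>R F x) \<in> borel_measurable lborel" by measurable
      have "indicator {0..1} x *\<^sub>R (f x * indicator W x) = F x * indicator W x" for x by (simp add: F_def)
      then show "(\<lambda>x. indicator {0..1} x *\<^sub>R (f x * indicator W x)) \<in> borel_measurable lborel"
        by simp measurable
    qed
    ultimately show "set_lebesgue_integral lborel V F = 0" by simp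
  qed auto
  then have "AE x in lborel. x \<in> {0..1} \<longrightarrow> f x = 0"
    by eventually_elim (auto simp: F_def)
  then show ?thesis unfolding unit_interval_def by (subst AE_restrict_space_iff) auto
qed

section \<open>Product bases and the operator Q\<close>

locale borel_prob_space = prob_space \<mu> for \<mu> :: "real measure" +
  assumes sets_mu: "sets \<mu> = sets borel"
begin

lemma space_mu [simp]: "space \<mu> = UNIV"
  using sets_eq_imp_space_eq[OF sets_mu] by simp

sublocale pair: pair_prob_space unit_interval \<mu>
  by (intro pair_prob_space.intro pair_sigma_finite.intro UI.prob_space_axioms prob_space_axioms
    UI.sigma_finite_measure_axioms sigma_finite_measure_axioms)

lemma prob_space_HH: "prob_space (HH \<mu>)"
  unfolding HH_def by (rule pair.P.prob_space_axioms)

lemma HH_D: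
  assumes "f \<in> L2 (HH \<mu>)" shows "f \<in> borel_measurable (unit_interval \<Otimes>\<^sub>M \<mu>)"
  using assms by (simp add: L2_def HH_def)

lemma tensor_measurable [measurable (raw)]:
  "g \<in> borel_measurable unit_interval \<Longrightarrow> h \<in> borel_measurable \<mu> \<Longrightarrow>
    tensor g h \<in> borel_measurable (unit_interval \<Otimes>\<^sub>M \<mu>)"
  unfolding tensor_def split_beta'
  by (intro borel_measurable_times measurable_compose[OF measurable_fst] measurable_compose[OF measurable_snd])

lemma tensor_L2:
  assumes g: "g \<in> L2 unit_interval" and h: "h \<in> L2 \<mu>" shows "tensor g h \<in> L2 (HH \<mu>)"
proof (rule L2_I)
  have [measurable]: "g \<in> borel_measurable unit_interval" "h \<in> borel_measurable \<mu>"
    using g h by (auto simp: L2_def)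
  show "tensor g h \<in> borel_measurable (HH \<mu>)" unfolding HH_def by measurable
  show "integrable (HH \<mu>) (\<lambda>z. (cmod (tensor g h z))\<^sup>2)"
    unfolding HH_def
  proof (rule pair.Fubini_integrable)
    show "integrable unit_interval (\<lambda>x. LINT y|\<mu>. norm ((cmod (tensor g h (x, y)))\<^sup>2))"
      using g by (simp add: tensor_def norm_mult power_mult_distrib L2_def)
    show "AE x in unit_interval. integrable \<mu> (\<lambda>y. (cmod (tensor g h (x, y)))\<^sup>2)"
      using h by (simp add: tensor_def norm_mult power_mult_distrib L2_def)
  qed measurable
qed

text \<open>Fubini in one order; \<open>inner_HH_tensor_snd\<close> is the other. Passing between
  them moves an argument from sections in \<open>x\<close> to partial integrals in
  \<open>y\<close>.\<close>

lemma inner_HH_tensor_fst: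
  assumes f: "f \<in> L2 (HH \<mu>)" and g: "g \<in> L2 unit_interval" and h: "h \<in> L2 \<mu>"
  shows "innerL2 (HH \<mu>) f (tensor g h) = (LINT x|unit_interval. (LINT y|\<mu>. f (x, y) * cnj (h y)) * cnj (g x))"
    and "integrable unit_interval (\<lambda>x. (LINT y|\<mu>. f (x, y) * cnj (h y)) * cnj (g x))"
proof -
  have int: "integrable (unit_interval \<Otimes>\<^sub>M \<mu>) (\<lambda>z. f z * cnj (tensor g h z))"
    using L2_inner_integrable[OF f tensor_L2[OF g h]] by (simp add: HH_def)
  have eq: "(LINT y|\<mu>. f (x, y) * cnj (tensor g h (x, y))) = (LINT y|\<mu>. f (x, y) * cnj (h y)) * cnj (g x)" for x
    unfolding integral_mult_left_zero[symmetric] by (simp add: tensor_def mult_ac)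
  show "innerL2 (HH \<mu>) f (tensor g h) = (LINT x|unit_interval. (LINT y|\<mu>. f (x, y) * cnj (h y)) * cnj (g x))"
    using pair.integral_fst'[OF int] by (simp add: innerL2_def HH_def eq)
  show "integrable unit_interval (\<lambda>x. (LINT y|\<mu>. f (x, y) * cnj (h y)) * cnj (g x))"
    using pair.integrable_fst'[OF int] by (simp add: eq)
qed

lemma inner_HH_tensor_snd:
  assumes f: "f \<in> L2 (HH \<mu>)" and g: "g \<in> L2 unit_interval" and h: "h \<in> L2 \<mu>"
  shows "innerL2 (HH \<mu>) f (tensor g h) = (LINT y|\<mu>. (LINT x|unit_interval. f (x, y) * cnj (g x)) * cnj (h y))"
proof -
  have int: "integrable (unit_interval \<Otimes>\<^sub>M \<mu>) (\<lambda>z. f z * cnj (tensor g h z))"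
    using L2_inner_integrable[OF f tensor_L2[OF g h]] by (simp add: HH_def)
  have eq: "(LINT x|unit_interval. f (x, y) * cnj (tensor g h (x, y))) = (LINT x|unit_interval. f (x, y) * cnj (g x)) * cnj (h y)" for y
    unfolding integral_mult_left_zero[symmetric] by (simp add: tensor_def mult_ac)
  show ?thesis
    using pair.integral_snd[of "\<lambda>x y. f (x, y) * cnj (tensor g h (x, y))"] int
    by (simp add: innerL2_def HH_def eq split_beta')
qed

lemma inner_tensor:
  assumes "g \<in> L2 unit_interval" "h \<in> L2 \<mu>" "g' \<in> L2 unit_interval" "h' \<in> L2 \<mu>"
  shows "innerL2 (HH \<mu>) (tensor g h) (tensor g' h') = innerL2 unit_interval g g' * innerL2 \<mu> h h'"
proof -
  have eq: "(LINT y|\<mu>. tensor g h (x, y) * cnj (h' y)) * cnj (g' x) = g x * cnj (g' x) * innerL2 \<mu> h h'" for x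
    by (simp add: tensor_def innerL2_def mult.assoc)
  show ?thesis
    unfolding inner_HH_tensor_fst(1)[OF tensor_L2[OF assms(1,2)] assms(3,4)] eq
    by (simp add: innerL2_def)
qed

text \<open>Cauchy-Schwarz in \<open>x\<close> for almost every \<open>y\<close>, then integration
  in \<open>y\<close>. The choice of \<open>w\<close> makes the bound cover both integrals against
  test functions and primitives in \<open>x\<close>.\<close>

lemma partial_integral_L2:
  assumes f: "f \<in> L2 (HH \<mu>)" and w: "w \<in> L2 unit_interval"
  shows "(\<lambda>y. LINT x|unit_interval. f (x, y) * cnj (w x)) \<in> L2 \<mu>"
    and "normL2 \<mu> (\<lambda>y. LINT x|unit_interval. f (x, y) * cnj (w x)) \<le> normL2 unit_interval w * normL2 (HH \<mu>) f"
proof -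
  let ?K = "\<lambda>y. LINT x|unit_interval. f (x, y) * cnj (w x)"
  let ?n = "\<lambda>y. LINT x|unit_interval. (cmod (f (x, y)))\<^sup>2"
  have [measurable]: "f \<in> borel_measurable (unit_interval \<Otimes>\<^sub>M \<mu>)" "w \<in> borel_measurable unit_interval"
    using HH_D[OF f] w by (auto simp: L2_def)
  have K [measurable]: "?K \<in> borel_measurable \<mu>" by measurable
  have int: "integrable (unit_interval \<Otimes>\<^sub>M \<mu>) (\<lambda>(x, y). (cmod (f (x, y)))\<^sup>2)"
    using f by (simp add: L2_def HH_def split_beta')
  have nint: "integrable \<mu> ?n" and neq: "(LINT y|\<mu>. ?n y) = (normL2 (HH \<mu>) f)\<^sup>2"
    using pair.integrable_snd[OF int] pair.integral_snd[OF int]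
    by (simp_all add: normL2_sq HH_def split_beta')
  have bd: "AE y in \<mu>. (cmod (?K y))\<^sup>2 \<le> (normL2 unit_interval w)\<^sup>2 * ?n y"
    using pair.AE_integrable_snd[OF int]
  proof eventually_elim
    case (elim y)
    have fy: "(\<lambda>x. f (x, y)) \<in> L2 unit_interval" using elim by (intro L2_I) (auto simp: space_pair_measure)
    have "cmod (?K y) \<le> normL2 unit_interval (\<lambda>x. f (x, y)) * normL2 unit_interval w"
      using Cauchy_Schwarz[OF fy w] by (simp add: innerL2_def)
    then have "(cmod (?K y))\<^sup>2 \<le> (normL2 unit_interval (\<lambda>x. f (x, y)) * normL2 unit_interval w)\<^sup>2"
      by (rule power_mono) simp
    then show ?case by (simp add: power_mult_distrib normL2_sq[of unit_interval "\<lambda>x. f (x, y)"] mult.commute)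
  qed
  have nint': "integrable \<mu> (\<lambda>y. (normL2 unit_interval w)\<^sup>2 * ?n y)" using nint by simp
  have iK: "integrable \<mu> (\<lambda>y. (cmod (?K y))\<^sup>2)"
    by (rule Bochner_Integration.integrable_bound[OF nint']) (use bd in \<open>auto elim!: eventually_mono\<close>)
  then show "?K \<in> L2 \<mu>" using K by (intro L2_I)
  show "normL2 \<mu> ?K \<le> normL2 unit_interval w * normL2 (HH \<mu>) f"
  proof (rule power2_le_imp_le)
    have "(normL2 \<mu> ?K)\<^sup>2 \<le> (LINT y|\<mu>. (normL2 unit_interval w)\<^sup>2 * ?n y)"
      unfolding normL2_sq[of \<mu>] by (rule integral_mono_AE[OF iK nint' bd])
    then show "(normL2 \<mu> ?K)\<^sup>2 \<le> (normL2 unit_interval w * normL2 (HH \<mu>) f)\<^sup>2"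
      by (simp add: neq power_mult_distrib)
  qed simp
qed

lemma ee_L2: "(\<lambda>x. ee (a * x)) \<in> L2 unit_interval"
  by (rule UI.L2_bounded[where C = 1]) (auto intro!: measurable_unit_interval)

lemma HH_AE_zero:
  assumes f: "integrable (HH \<mu>) f"
    and zero: "\<And>A B. A \<in> sets unit_interval \<Longrightarrow> B \<in> sets \<mu> \<Longrightarrow> set_lebesgue_integral (HH \<mu>) (A \<times> B) f = 0"
  shows "eqL2 (HH \<mu>) f (\<lambda>x. 0)"
  unfolding eqL2_def
proof (rule AE_zero_if_integral_zero_on_generator[OF _ f])
  interpret H: prob_space "HH \<mu>" by (rule prob_space_HH)
  show "sigma_finite_measure (HH \<mu>)" by unfold_locales
  let ?G = "{A \<times> B |A B. A \<in> sets unit_interval \<and> B \<in> sets \<mu>}"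
  have sp: "space (HH \<mu>) = space unit_interval \<times> space \<mu>" by (simp add: HH_def space_pair_measure)
  show "sets (HH \<mu>) = sigma_sets (space (HH \<mu>)) ?G"
    unfolding sp by (simp add: HH_def sets_pair_measure)
  show "Int_stable ?G" by (rule Int_stable_pair_measure_generator)
  show "?G \<subseteq> Pow (space (HH \<mu>))" unfolding sp by (rule pair_measure_closed)
  show "space (HH \<mu>) \<in> ?G" unfolding sp by blast
  show "set_lebesgue_integral (HH \<mu>) C f = 0" if "C \<in> ?G" for C using that zero by blast
qed

end

text \<open>The shift \<open>\<theta> l\<close> varies with the second factor, so this need not be a
  tensor product of two bases; it makes each element satisfy f(1) = e(\<theta> l) f(0).\<close>

definition product_basis :: "(real \<Rightarrow> real) \<Rightarrow> int \<times> real \<Rightarrow> real \<times> real \<Rightarrow> complex" where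
  "product_basis \<theta> = (\<lambda>(n, l). tensor (\<lambda>x. ee ((\<theta> l + of_int n) * x)) (e_fun l))"

locale spectral_pair = borel_prob_space +
  fixes \<Lambda> :: "real set"
  assumes onb: "orthonormal_basis \<mu> \<Lambda> e_fun"
begin

lemma product_basis_orthonormal: "orthonormal (HH \<mu>) (UNIV \<times> \<Lambda>) (product_basis \<theta>)"
  unfolding orthonormal_def
proof (intro conjI ballI)
  fix i :: "int \<times> real" assume "i \<in> UNIV \<times> \<Lambda>"
  then obtain n l where i: "i = (n, l)" "l \<in> \<Lambda>" by auto
  show "product_basis \<theta> i \<in> L2 (HH \<mu>)"
    using onb_L2[OF onb] i by (auto simp: product_basis_def intro!: tensor_L2 ee_L2)
  fix j :: "int \<times> real" assume "j \<in> UNIV \<times> \<Lambda>"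
  then obtain m k where j: "j = (m, k)" "k \<in> \<Lambda>" by auto
  have "innerL2 (HH \<mu>) (product_basis \<theta> i) (product_basis \<theta> j) =
     innerL2 unit_interval (\<lambda>x. ee ((\<theta> l + of_int n) * x)) (\<lambda>x. ee ((\<theta> k + of_int m) * x)) * (if l = k then 1 else 0)"
    using onb_L2[OF onb] i j onb by (auto simp: product_basis_def inner_tensor ee_L2 orthonormal_basis_def)
  also have "\<dots> = (if i = j then 1 else 0)"
  proof (cases "l = k")
    case True
    have "innerL2 unit_interval (\<lambda>x. ee ((\<theta> l + of_int n) * x)) (\<lambda>x. ee ((\<theta> l + of_int m) * x)) =
       (LINT x|unit_interval. ee (of_int (n - m) * x))"
      unfolding innerL2_def cnj_ee ee_add[symmetric]
      by (intro Bochner_Integration.integral_cong refl arg_cong[of _ _ ee]) (simp add: algebra_simps)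
    also have "\<dots> = (if n = m then 1 else 0)" by (subst integral_ee_int) simp
    finally show ?thesis using True i j by simp
  qed (use i j in simp)
  finally show "innerL2 (HH \<mu>) (product_basis \<theta> i) (product_basis \<theta> j) = (if i = j then 1 else 0)" .
qed

text \<open>For each \<open>l\<close> the section coefficient times e(-\<theta> l x) has vanishing
  Fourier coefficients, so it is zero almost everywhere. The exceptional null sets depend on
  \<open>l\<close> and are never united: integrating over a set \<open>A\<close> first gives one
  function of \<open>y\<close> whose coefficients all vanish, and rectangles suffice.\<close>

lemma product_basis_onb: "orthonormal_basis (HH \<mu>) (UNIV \<times> \<Lambda>) (product_basis \<theta>)"
proof (rule prob_space.onb_if_total[OF prob_space_HH product_basis_orthonormal])
  fix g assume g: "g \<in> L2 (HH \<mu>)"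
    and zero: "\<And>i. i \<in> UNIV \<times> \<Lambda> \<Longrightarrow> innerL2 (HH \<mu>) g (product_basis \<theta> i) = 0"
  have UIone: "(\<lambda>x. 1) \<in> L2 unit_interval" by (rule UI.L2_bounded[where C = 1]) auto
  have section_zero: "AE x in unit_interval. (LINT y|\<mu>. g (x, y) * cnj (e_fun l y)) = 0" if l: "l \<in> \<Lambda>" for l
  proof -
    let ?g = "\<lambda>x. LINT y|\<mu>. g (x, y) * cnj (e_fun l y)"
    have el: "e_fun l \<in> L2 \<mu>" by (rule onb_L2[OF onb l])
    have int: "integrable unit_interval (\<lambda>x. ?g x * cnj (ee (\<theta> l * x)))"
      by (rule inner_HH_tensor_fst(2)[OF g ee_L2 el])
    have "AE x in unit_interval. ?g x * cnj (ee (\<theta> l * x)) = 0"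
    proof (rule Fourier_total[OF int])
      fix n :: int
      have "(LINT x|unit_interval. ?g x * cnj (ee (\<theta> l * x)) * ee (of_int n * x)) =
        (LINT x|unit_interval. ?g x * cnj (ee ((\<theta> l + of_int (- n)) * x)))"
        unfolding mult.assoc cnj_ee ee_add[symmetric]
        by (intro Bochner_Integration.integral_cong refl arg_cong2[of _ _ _ _ "(*)"] arg_cong[of _ _ ee]) (simp add: algebra_simps)
      also have "\<dots> = innerL2 (HH \<mu>) g (product_basis \<theta> (- n, l))"
        by (simp add: product_basis_def inner_HH_tensor_fst(1)[OF g ee_L2 el])
      also have "\<dots> = 0" using zero l by simp
      finally show "(LINT x|unit_interval. ?g x * cnj (ee (\<theta> l * x)) * ee (of_int n * x)) = 0" .
    qed
    moreover have "ee r \<noteq> 0" for r using norm_ee[of r] by (metis norm_zero zero_neq_one)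
    ultimately show ?thesis by simp
  qed
  show "eqL2 (HH \<mu>) g (\<lambda>x. 0)"
  proof (rule HH_AE_zero)
    show "integrable (HH \<mu>) g" by (rule prob_space.L1_norm_le(1)[OF prob_space_HH g])
    fix A B assume A: "A \<in> sets unit_interval" and B: "B \<in> sets \<mu>"
    let ?A = "\<lambda>x. indicator A x :: complex" and ?B = "\<lambda>y. indicator B y :: complex"
    have AL: "?A \<in> L2 unit_interval" using A by (intro UI.L2_bounded[where C = 1]) (auto simp: indicator_def)
    have BL: "?B \<in> L2 \<mu>" using B by (intro L2_bounded[where C = 1]) (auto simp: indicator_def)
    let ?k = "\<lambda>y. LINT x|unit_interval. g (x, y) * cnj (?A x)"
    have k: "?k \<in> L2 \<mu>" by (rule partial_integral_L2(1)[OF g AL])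
    have "eqL2 \<mu> ?k (\<lambda>y. 0)"
    proof (rule onb_eqI[OF onb k L2_zero])
      fix l assume l: "l \<in> \<Lambda>"
      have el: "e_fun l \<in> L2 \<mu>" by (rule onb_L2[OF onb l])
      have "innerL2 \<mu> ?k (e_fun l) = innerL2 (HH \<mu>) g (tensor ?A (e_fun l))"
        unfolding inner_HH_tensor_snd[OF g AL el] by (simp add: innerL2_def)
      also have "\<dots> = (LINT x|unit_interval. (LINT y|\<mu>. g (x, y) * cnj (e_fun l y)) * cnj (?A x))"
        by (rule inner_HH_tensor_fst(1)[OF g AL el])
      also have "\<dots> = (LINT x|unit_interval. 0)"
        using section_zero[OF l] inner_HH_tensor_fst(2)[OF g AL el]
        by (intro integral_cong_AE) (auto elim!: eventually_mono)
      finally show "innerL2 \<mu> ?k (e_fun l) = innerL2 \<mu> (\<lambda>y. 0) (e_fun l)" by simp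
    qed
    then have "innerL2 \<mu> ?k ?B = innerL2 \<mu> (\<lambda>y. 0) ?B"
      by (intro innerL2_cong k BL L2_zero) auto
    then have "innerL2 (HH \<mu>) g (tensor ?A ?B) = 0"
      unfolding inner_HH_tensor_snd[OF g AL BL] by (simp add: innerL2_def)
    moreover have "innerL2 (HH \<mu>) g (tensor ?A ?B) = set_lebesgue_integral (HH \<mu>) (A \<times> B) g"
      unfolding innerL2_def set_lebesgue_integral_def
      by (intro Bochner_Integration.integral_cong refl) (auto simp: tensor_def indicator_def split: prod.splits)
    ultimately show "set_lebesgue_integral (HH \<mu>) (A \<times> B) g = 0" by simp
  qed
qed

section \<open>The closure Q in coordinates\<close>

lemma inner_Q0:
  assumes I: "finite I" "I \<subseteq> \<Lambda>" "\<And>m. m \<in> I \<Longrightarrow> h m \<in> L2 unit_interval"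
    and g: "g \<in> L2 unit_interval" and l: "l \<in> \<Lambda>"
  shows "innerL2 (HH \<mu>) (\<lambda>z. \<Sum>m\<in>I. c m * tensor (h m) (e_fun m) z) (tensor g (e_fun l)) =
    (if l \<in> I then c l * innerL2 unit_interval (h l) g else 0)"
proof -
  have e: "e_fun m \<in> L2 \<mu>" if "m \<in> \<Lambda>" for m by (rule onb_L2[OF onb that])
  have "innerL2 (HH \<mu>) (\<lambda>z. \<Sum>m\<in>I. c m * tensor (h m) (e_fun m) z) (tensor g (e_fun l)) =
    (\<Sum>m\<in>I. innerL2 (HH \<mu>) (\<lambda>z. c m * tensor (h m) (e_fun m) z) (tensor g (e_fun l)))"
    using I g l by (intro innerL2_sum_left L2_cmult tensor_L2 e) auto
  also have "\<dots> = (\<Sum>m\<in>I. if m = l then c l * innerL2 unit_interval (h l) g else 0)"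
  proof (intro sum.cong refl)
    fix m assume m: "m \<in> I"
    then have "innerL2 \<mu> (e_fun m) (e_fun l) = (if m = l then 1 else 0)"
      using onb l I(2) by (auto simp: orthonormal_basis_def)
    then show "innerL2 (HH \<mu>) (\<lambda>z. c m * tensor (h m) (e_fun m) z) (tensor g (e_fun l)) =
        (if m = l then c l * innerL2 unit_interval (h l) g else 0)"
      using I m l by (simp add: innerL2_cmult_left inner_tensor g e subset_iff)
  qed
  also have "\<dots> = (if l \<in> I then c l * innerL2 unit_interval (h l) g else 0)" using I(1) by simp
  finally show ?thesis .
qed

lemma Q0_opE:
  assumes "(f, g) \<in> Q0_op \<mu> \<Lambda>"
  obtains I c h where "finite I" "I \<subseteq> \<Lambda>" "\<And>l. l \<in> I \<Longrightarrow> h l \<in> L2 unit_interval"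
    "f = (\<lambda>z. \<Sum>l\<in>I. c l * tensor (h l) (e_fun l) z)"
    "g = (\<lambda>z. \<Sum>l\<in>I. of_real l * c l * tensor (h l) (e_fun l) z)"
  using assms unfolding Q0_op_def mem_Collect_eq prod.case by (elim exE conjE) (rule that, blast+)

lemma Q0_L2:
  assumes "(f, g) \<in> Q0_op \<mu> \<Lambda>" shows "f \<in> L2 (HH \<mu>)" "g \<in> L2 (HH \<mu>)"
proof -
  obtain I c h where I: "finite I" "I \<subseteq> \<Lambda>" "\<And>l. l \<in> I \<Longrightarrow> h l \<in> L2 unit_interval"
    "f = (\<lambda>z. \<Sum>l\<in>I. c l * tensor (h l) (e_fun l) z)"
    "g = (\<lambda>z. \<Sum>l\<in>I. of_real l * c l * tensor (h l) (e_fun l) z)"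
    using assms by (rule Q0_opE) (rule that)
  show "f \<in> L2 (HH \<mu>)" unfolding I(4)
    by (intro L2_sum L2_cmult tensor_L2 I(3) onb_L2[OF onb]) (use I in auto)
  show "g \<in> L2 (HH \<mu>)" unfolding I(5)
    by (intro L2_sum L2_cmult tensor_L2 I(3) onb_L2[OF onb]) (use I in auto)
qed

text \<open>A linear relation between \<open>f\<close> and \<open>q\<close> that is continuous in
  both survives the closure. Allowing arbitrary \<open>g\<close> makes it independent of a choice of
  \<open>\<theta>\<close>.\<close>

lemma inner_Q:
  assumes Q: "(f, q) \<in> Q_op \<mu> \<Lambda>" and g: "g \<in> L2 unit_interval" and l: "l \<in> \<Lambda>"
  shows "innerL2 (HH \<mu>) q (tensor g (e_fun l)) = of_real l * innerL2 (HH \<mu>) f (tensor g (e_fun l))"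
proof -
  let ?t = "tensor g (e_fun l)"
  have t: "?t \<in> L2 (HH \<mu>)" by (intro tensor_L2 g onb_L2[OF onb l])
  have f: "f \<in> L2 (HH \<mu>)" and q: "q \<in> L2 (HH \<mu>)"
    and appr: "\<And>\<epsilon>. \<epsilon> > 0 \<Longrightarrow> \<exists>(f', q')\<in>Q0_op \<mu> \<Lambda>.
      normL2 (HH \<mu>) (\<lambda>x. f x - f' x) < \<epsilon> \<and> normL2 (HH \<mu>) (\<lambda>x. q x - q' x) < \<epsilon>"
    using Q by (auto simp: Q_op_def operator_closure_def)
  have lf: "(\<lambda>x. of_real l * f x) \<in> L2 (HH \<mu>)" using f by (rule L2_cmult)
  have "innerL2 (HH \<mu>) (\<lambda>x. q x - of_real l * f x) ?t = 0"
  proof (rule innerL2_approx[OF L2_diff[OF q lf] t])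
    fix \<epsilon> :: real assume \<epsilon>: "\<epsilon> > 0"
    \<comment> \<open>The error of \<open>q - l f\<close> is at most that of \<open>q\<close> plus
      |l| times that of \<open>f\<close>, hence the factor 1 + |l|.\<close>
    define \<delta> where "\<delta> = \<epsilon> / (1 + \<bar>l\<bar>)"
    have \<delta>: "\<delta> > 0" using \<epsilon> by (simp add: \<delta>_def add_pos_nonneg)
    obtain f' q' where Q0: "(f', q') \<in> Q0_op \<mu> \<Lambda>"
      and n: "normL2 (HH \<mu>) (\<lambda>x. f x - f' x) < \<delta>" "normL2 (HH \<mu>) (\<lambda>x. q x - q' x) < \<delta>"
      using appr[OF \<delta>] by blast
    note f' = Q0_L2(1)[OF Q0] and q' = Q0_L2(2)[OF Q0]
    have lf': "(\<lambda>x. of_real l * f' x) \<in> L2 (HH \<mu>)" using f' by (rule L2_cmult)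
    obtain I c h where I: "finite I" "I \<subseteq> \<Lambda>" "\<And>l. l \<in> I \<Longrightarrow> h l \<in> L2 unit_interval"
      "f' = (\<lambda>z. \<Sum>l\<in>I. c l * tensor (h l) (e_fun l) z)"
      "q' = (\<lambda>z. \<Sum>l\<in>I. of_real l * c l * tensor (h l) (e_fun l) z)"
      using Q0 by (rule Q0_opE) (rule that)
    have "innerL2 (HH \<mu>) q' ?t = of_real l * innerL2 (HH \<mu>) f' ?t"
      unfolding I(4,5) using inner_Q0[OF I(1,2,3) g l, where c = c]
        inner_Q0[OF I(1,2,3) g l, where c = "\<lambda>l. of_real l * c l"] by simp
    then have z: "innerL2 (HH \<mu>) (\<lambda>x. q' x - of_real l * f' x) ?t = 0"
      using q' lf' t by (simp add: innerL2_diff_left innerL2_cmult_left)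
    have "normL2 (HH \<mu>) (\<lambda>x. (q x - of_real l * f x) - (q' x - of_real l * f' x)) =
      normL2 (HH \<mu>) (\<lambda>x. (q x - q' x) + of_real (- l) * (f x - f' x))"
      by (simp add: algebra_simps)
    also have "\<dots> \<le> normL2 (HH \<mu>) (\<lambda>x. q x - q' x) + normL2 (HH \<mu>) (\<lambda>x. of_real (- l) * (f x - f' x))"
      by (intro normL2_triangle L2_diff L2_cmult f f' q q')
    also have "\<dots> = normL2 (HH \<mu>) (\<lambda>x. q x - q' x) + \<bar>l\<bar> * normL2 (HH \<mu>) (\<lambda>x. f x - f' x)"
      unfolding normL2_cmult norm_of_real by simp
    also have "\<dots> < \<delta> + \<bar>l\<bar> * \<delta>" using n by (intro add_less_le_mono mult_left_mono) auto
    also have "\<dots> = \<delta> * (1 + \<bar>l\<bar>)" by (simp add: algebra_simps)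
    also have "\<dots> = \<epsilon>" unfolding \<delta>_def by simp
    finally have *: "normL2 (HH \<mu>) (\<lambda>x. (q x - of_real l * f x) - (q' x - of_real l * f' x)) < \<epsilon>" .
    show "\<exists>k\<in>L2 (HH \<mu>). normL2 (HH \<mu>) (\<lambda>x. (q x - of_real l * f x) - k x) < \<epsilon> \<and> innerL2 (HH \<mu>) k ?t = 0"
      by (rule bexI[of _ "\<lambda>x. q' x - of_real l * f' x"]) (intro conjI * z, rule L2_diff[OF q' lf'])
  qed
  then show ?thesis using q lf t by (simp add: innerL2_diff_left innerL2_cmult_left)
qed

lemma Q_tensor:
  assumes g: "g \<in> L2 unit_interval" and l: "l \<in> \<Lambda>"
  shows "(tensor g (e_fun l), \<lambda>z. of_real l * tensor g (e_fun l) z) \<in> Q_op \<mu> \<Lambda>"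
proof -
  have "(tensor g (e_fun l), \<lambda>z. of_real l * tensor g (e_fun l) z) \<in> Q0_op \<mu> \<Lambda>"
    unfolding Q0_op_def using g l
    by (auto intro!: exI[of _ "{l}"] exI[of _ "\<lambda>_. 1"] exI[of _ "\<lambda>_. g"])
  moreover have "tensor g (e_fun l) \<in> L2 (HH \<mu>)" by (intro tensor_L2 g onb_L2[OF onb l])
  ultimately show ?thesis by (force simp: Q_op_def operator_closure_def)
qed

text \<open>Any \<open>\<theta>\<close> is possible, as the eigenvalue depends on \<open>l\<close>
  alone; it is later taken from \<open>U\<close>. For the inclusion into \<open>Q_op\<close>, one
  finite set truncates the expansions of \<open>f\<close> and \<open>q\<close> simultaneously, and
  the truncations form a pair in \<open>Q0_op\<close>.\<close>

lemma Q_op_eq_diag_op: "Q_op \<mu> \<Lambda> = diag_op (HH \<mu>) (UNIV \<times> \<Lambda>) (product_basis \<theta>) snd"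
proof (intro equalityI subrelI)
  fix f q assume Q: "(f, q) \<in> Q_op \<mu> \<Lambda>"
  then have "f \<in> L2 (HH \<mu>)" "q \<in> L2 (HH \<mu>)" by (auto simp: Q_op_def operator_closure_def)
  then show "(f, q) \<in> diag_op (HH \<mu>) (UNIV \<times> \<Lambda>) (product_basis \<theta>) snd"
    using inner_Q[OF Q ee_L2] by (auto simp: diag_op_def product_basis_def)
next
  let ?b = "product_basis \<theta>"
  fix f q assume D: "(f, q) \<in> diag_op (HH \<mu>) (UNIV \<times> \<Lambda>) ?b snd"
  then have f: "f \<in> L2 (HH \<mu>)" and q: "q \<in> L2 (HH \<mu>)"
    and c: "\<And>i. i \<in> UNIV \<times> \<Lambda> \<Longrightarrow> innerL2 (HH \<mu>) q (?b i) = of_real (snd i) * innerL2 (HH \<mu>) f (?b i)"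
    unfolding diag_op_def by blast+
  have "\<exists>(f', q')\<in>Q0_op \<mu> \<Lambda>. normL2 (HH \<mu>) (\<lambda>x. f x - f' x) < \<epsilon> \<and> normL2 (HH \<mu>) (\<lambda>x. q x - q' x) < \<epsilon>"
    if \<epsilon>: "\<epsilon> > 0" for \<epsilon>
  proof -
    have "\<forall>\<^sub>F K in finite_subsets_at_top (UNIV \<times> \<Lambda>).
        normL2 (HH \<mu>) (\<lambda>x. f x - (\<Sum>i\<in>K. innerL2 (HH \<mu>) f (?b i) * ?b i x)) < \<epsilon> \<and>
        normL2 (HH \<mu>) (\<lambda>x. q x - (\<Sum>i\<in>K. innerL2 (HH \<mu>) q (?b i) * ?b i x)) < \<epsilon>"
      by (intro eventually_conj order_tendstoD(2)[OF onb_expansion[OF product_basis_onb f] \<epsilon>]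
        order_tendstoD(2)[OF onb_expansion[OF product_basis_onb q] \<epsilon>])
    then obtain K where K: "finite K" "K \<subseteq> UNIV \<times> \<Lambda>"
      and n: "normL2 (HH \<mu>) (\<lambda>x. f x - (\<Sum>i\<in>K. innerL2 (HH \<mu>) f (?b i) * ?b i x)) < \<epsilon>"
        "normL2 (HH \<mu>) (\<lambda>x. q x - (\<Sum>i\<in>K. innerL2 (HH \<mu>) q (?b i) * ?b i x)) < \<epsilon>"
      unfolding eventually_finite_subsets_at_top by blast
    \<comment> \<open>Grouping by the second index gives one factor for each \<open>l\<close>. The
      same factors serve for \<open>q\<close>, whose coefficients are \<open>l\<close> times those
      of \<open>f\<close>.\<close>
    define h where "h l = (\<lambda>x. \<Sum>i\<in>{i\<in>K. snd i = l}. innerL2 (HH \<mu>) f (?b i) * ee ((\<theta> l + of_int (fst i)) * x))" for l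
    have h: "h l \<in> L2 unit_interval" for l unfolding h_def by (intro L2_sum L2_cmult ee_L2)
    have fib: "tensor (h l) (e_fun l) z = (\<Sum>i\<in>{i\<in>K. snd i = l}. innerL2 (HH \<mu>) f (?b i) * ?b i z)" for l z
      by (auto simp: tensor_def h_def product_basis_def sum_distrib_right split_beta mult.assoc intro!: sum.cong)
    have f': "(\<Sum>i\<in>K. innerL2 (HH \<mu>) f (?b i) * ?b i z) = (\<Sum>l\<in>snd ` K. 1 * tensor (h l) (e_fun l) z)" for z
      unfolding fib using K(1) by (simp add: sum.image_gen[of K _ snd])
    have q': "(\<Sum>i\<in>K. innerL2 (HH \<mu>) q (?b i) * ?b i z) = (\<Sum>l\<in>snd ` K. of_real l * 1 * tensor (h l) (e_fun l) z)" for z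
    proof -
      have "(\<Sum>i\<in>K. innerL2 (HH \<mu>) q (?b i) * ?b i z) =
        (\<Sum>l\<in>snd ` K. \<Sum>i\<in>{i\<in>K. snd i = l}. innerL2 (HH \<mu>) q (?b i) * ?b i z)"
        by (rule sum.image_gen[OF K(1)])
      also have "\<dots> = (\<Sum>l\<in>snd ` K. of_real l * 1 * tensor (h l) (e_fun l) z)"
        unfolding fib sum_distrib_left using K(2) c by (intro sum.cong refl) (auto simp: subset_iff)
      finally show ?thesis .
    qed
    have "((\<lambda>z. \<Sum>l\<in>snd ` K. 1 * tensor (h l) (e_fun l) z),
        (\<lambda>z. \<Sum>l\<in>snd ` K. of_real l * 1 * tensor (h l) (e_fun l) z)) \<in> Q0_op \<mu> \<Lambda>"
      unfolding Q0_op_def mem_Collect_eq prod.case using K h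
      by (intro exI[of _ "snd ` K"] exI[of _ "\<lambda>_. 1"] exI[of _ h] conjI refl) auto
    then show ?thesis by (rule rev_bexI) (use n in \<open>simp only: f' q' prod.case\<close>)
  qed
  then show "(f, q) \<in> Q_op \<mu> \<Lambda>" using f q by (simp add: Q_op_def operator_closure_def)
qed

end

section \<open>Weak derivatives on the unit interval\<close>

text \<open>The functions \<open>p(x) / (x (1 - x))^m * exp (-1 / (x (1 - x)))\<close> on \<open>(0,1)\<close>, encoded by the
  pairs \<open>(p, m)\<close>, are closed under differentiation, which makes all of them smooth.\<close>

definition bump :: "real poly \<times> nat \<Rightarrow> real \<Rightarrow> real" where
  "bump pm x = (if 0 < x \<and> x < 1
     then poly (fst pm) x / (x * (1 - x)) ^ snd pm * exp (- 1 / (x * (1 - x))) else 0)"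

text \<open>With w = x(1 - x), this is the derivative of p w^(-m) exp(-1/w) written over the
  denominator w^(m+2).\<close>

definition bump_deriv :: "real poly \<times> nat \<Rightarrow> real poly \<times> nat" where
  "bump_deriv pm = (let w = [:0, 1, -1:]; w' = [:1, -2:]; p = fst pm; m = snd pm in
     (pderiv p * w\<^sup>2 - smult (real m) (p * w' * w) + p * w', m + 2))"

lemma power_le_fact_exp: "0 \<le> t \<Longrightarrow> t ^ k \<le> fact k * exp (t::real)"
proof -
  assume t: "0 \<le> t"
  have "(\<Sum>n\<in>{k}. t ^ n /\<^sub>R fact n) \<le> (\<Sum>n. t ^ n /\<^sub>R fact n)"
    using t by (intro sum_le_suminf summable_exp_generic) auto
  then show ?thesis by (simp add: exp_def field_simps)
qed

text \<open>Powers of 1/w are dominated by exp(1/w); the exponent m + 2 absorbs the denominator and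
  leaves w^2, and w is at most the distance to any point outside (0,1). Quadratic vanishing gives
  derivative 0 at such points, the endpoints included.\<close>

lemma bump_bound: "\<exists>C. \<forall>x y. \<not> (0 < x \<and> x < 1) \<longrightarrow> \<bar>bump pm y\<bar> \<le> C * (y - x)\<^sup>2"
proof -
  obtain p m where pm: "pm = (p, m)" by (cases pm)
  have "compact (poly p ` {0..1})" by (intro compact_continuous_image continuous_intros) auto
  then obtain B where B: "\<And>y. y \<in> {0..1} \<Longrightarrow> \<bar>poly p y\<bar> \<le> B"
    by (force dest!: compact_imp_bounded simp: bounded_iff)
  have B0: "0 \<le> B" using B[of 0] by simp
  have "\<bar>bump pm y\<bar> \<le> B * fact (m + 2) * (y - x)\<^sup>2" if x: "\<not> (0 < x \<and> x < 1)" for x y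
  proof (cases "0 < y \<and> y < 1")
    case True
    define w where "w = y * (1 - y)"
    have w: "0 < w" using True by (simp add: w_def)
    have wle: "w \<le> y" "w \<le> 1 - y" using True by (auto simp: w_def mult_left_le mult_left_le_one_le)
    have "(1 / w) ^ (m + 2) \<le> fact (m + 2) * exp (1 / w)" using w by (intro power_le_fact_exp) simp
    then have "1 / w ^ m * exp (- 1 / w) \<le> fact (m + 2) * w\<^sup>2"
      using w by (simp add: power_one_over power_add exp_minus divide_simps mult_ac power2_eq_square)
    then have "\<bar>poly p y\<bar> * (1 / w ^ m * exp (- 1 / w)) \<le> B * (fact (m + 2) * w\<^sup>2)"
      by (rule mult_mono[rotated]) (use B[of y] B0 True w in auto)
    also have "\<dots> \<le> B * (fact (m + 2) * (y - x)\<^sup>2)"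
    proof (intro mult_left_mono B0)
      have "\<bar>w\<bar> \<le> \<bar>y - x\<bar>" using w wle x True by (auto simp: not_less)
      then show "w\<^sup>2 \<le> (y - x)\<^sup>2" by (simp add: abs_le_square_iff)
    qed simp_all
    also have "\<bar>poly p y\<bar> * (1 / w ^ m * exp (- 1 / w)) = \<bar>bump pm y\<bar>"
      using True w by (simp add: bump_def pm abs_mult w_def)
    finally show ?thesis by (simp add: mult.assoc)
  next
    case False
    then have "bump pm y = 0" by (auto simp: bump_def)
    moreover have "0 \<le> B * fact (m + 2) * (y - x)\<^sup>2" using B0 by (intro mult_nonneg_nonneg) auto
    ultimately show ?thesis by simp
  qed
  then show ?thesis by blast
qed

lemma DERIV_zero_if_quadratic:
  fixes f :: "real \<Rightarrow> real"
  assumes "\<And>y. \<bar>f y - f x\<bar> \<le> C * (y - x)\<^sup>2"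
  shows "(f has_real_derivative 0) (at x)"
  unfolding has_field_derivative_iff
proof (rule Lim_null_comparison)
  have "norm ((f y - f x) / (y - x)) \<le> C * \<bar>y - x\<bar>" if "y \<noteq> x" for y
    using assms[of y] that by (simp add: abs_divide power2_eq_square divide_simps abs_mult[symmetric])
  then show "\<forall>\<^sub>F y in at x. norm ((f y - f x) / (y - x)) \<le> C * \<bar>y - x\<bar>"
    by (auto simp: eventually_at_filter)
  have "((\<lambda>y. C * \<bar>y - x\<bar>) \<longlongrightarrow> C * \<bar>x - x\<bar>) (at x)" by (intro tendsto_intros)
  then show "((\<lambda>y. C * \<bar>y - x\<bar>) \<longlongrightarrow> 0) (at x)" by simp
qed

lemma bump_DERIV: "(bump pm has_real_derivative bump (bump_deriv pm) x) (at x)"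
proof (cases "0 < x \<and> x < 1")
  case False
  obtain C where "\<And>y. \<bar>bump pm y\<bar> \<le> C * (y - x)\<^sup>2" using bump_bound[of pm] False by blast
  moreover have "bump pm x = 0" using False by (auto simp: bump_def)
  ultimately have "(bump pm has_real_derivative 0) (at x)"
    by (intro DERIV_zero_if_quadratic) simp
  moreover have "bump (bump_deriv pm) x = 0" using False by (auto simp: bump_def)
  ultimately show ?thesis by simp
next
  case True
  obtain p m where pm: "pm = (p, m)" by (cases pm)
  let ?g = "\<lambda>x. poly p x * inverse (x * (1 - x)) ^ m * exp (- inverse (x * (1 - x)))"
  define w where "w = x * (1 - x)"
  have w: "w > 0" using True by (simp add: w_def)
  let ?u = "inverse w"
  have D: "(?g has_real_derivative
     (poly (pderiv p) x * ?u ^ m * exp (- ?u)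
       + poly p x * (real m * ?u ^ (m - 1) * (- ((1 - 2 * x) * ?u\<^sup>2))) * exp (- ?u)
       + poly p x * ?u ^ m * (exp (- ?u) * ((1 - 2 * x) * ?u\<^sup>2)))) (at x)"
    using w unfolding w_def
    by (auto intro!: derivative_eq_intros simp: power2_eq_square algebra_simps)
  have um: "real m * ?u ^ (m - 1) = real m * ?u ^ m * w"
    using w by (cases m) auto
  have "poly (pderiv p) x * ?u ^ m * exp (- ?u)
       + poly p x * (real m * ?u ^ (m - 1) * (- ((1 - 2 * x) * ?u\<^sup>2))) * exp (- ?u)
       + poly p x * ?u ^ m * (exp (- ?u) * ((1 - 2 * x) * ?u\<^sup>2))
     = (poly (pderiv p) x * w\<^sup>2 - real m * (poly p x * (1 - 2 * x) * w) + poly p x * (1 - 2 * x))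
        * ?u ^ (m + 2) * exp (- ?u)"
    unfolding um using w by (simp add: power_add power2_eq_square field_simps)
  also have "\<dots> = bump (bump_deriv pm) x"
  proof -
    have "poly [:0, 1, -1:] x = w" "poly [:1, -2:] x = 1 - 2 * x" by (simp_all add: w_def algebra_simps)
    then show ?thesis
      unfolding bump_def bump_deriv_def pm Let_def fst_conv snd_conv poly_add poly_diff poly_mult
        poly_power poly_smult w_def[symmetric]
      using True by (simp add: divide_inverse power_inverse mult.commute[of x 2])
  qed
  finally have "(?g has_real_derivative bump (bump_deriv pm) x) (at x)" using D by simp
  then show ?thesis
  proof (rule has_field_derivative_transform_within_open[of _ _ _ "{0<..<1}"])
    show "?g y = bump pm y" if "y \<in> {0<..<1}" for y
      using that by (simp add: bump_def pm divide_inverse power_inverse[symmetric])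
  qed (use True in auto)
qed

text \<open>The normalised primitive of a bump: \<open>\<Psi> 0\<close> cuts off smoothly, and
  \<open>\<Psi> 1\<close> is a kernel of mass 1 for an approximate identity.\<close>

lemma smooth_step:
  obtains \<Psi> :: "nat \<Rightarrow> real \<Rightarrow> real"
  where "\<And>n x. (\<Psi> n has_real_derivative \<Psi> (Suc n) x) (at x)"
    and "\<And>x. x \<le> 0 \<Longrightarrow> \<Psi> 0 x = 0" and "\<And>x. 1 \<le> x \<Longrightarrow> \<Psi> 0 x = 1"
    and "\<And>x. 0 \<le> \<Psi> 0 x \<and> \<Psi> 0 x \<le> 1"
    and "\<And>x. 0 \<le> \<Psi> 1 x" and "\<And>x. \<not> (0 < x \<and> x < 1) \<Longrightarrow> \<Psi> 1 x = 0"
proof -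
  define \<Phi> where "\<Phi> n = bump ((bump_deriv ^^ n) ([:1:], 0))" for n
  have \<Phi>: "(\<Phi> n has_real_derivative \<Phi> (Suc n) x) (at x)" for n x
    using bump_DERIV[of "(bump_deriv ^^ n) ([:1:], 0)" x] by (simp add: \<Phi>_def)
  have \<Phi>0: "\<Phi> 0 x = (if 0 < x \<and> x < 1 then exp (- 1 / (x * (1 - x))) else 0)" for x
    by (simp add: \<Phi>_def bump_def)
  have "isCont (\<Phi> 0) x" for x using \<Phi>[of 0 x] by (rule DERIV_isCont)
  then have "\<exists>F. \<forall>x. - \<infinity> < ereal x \<longrightarrow> ereal x < \<infinity> \<longrightarrow> (F has_vector_derivative \<Phi> 0 x) (at x)"
    by (intro einterval_antiderivative) auto
  then obtain F where F: "\<And>x. (F has_real_derivative \<Phi> 0 x) (at x)"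
    by (auto simp: has_real_derivative_iff_has_vector_derivative)
  have mvt: "\<exists>z. a < z \<and> z < b \<and> F b - F a = (b - a) * \<Phi> 0 z" if "a < b" for a b
    using MVT2[OF that, of F "\<Phi> 0"] F by auto
  have left: "F x = F 0" if "x \<le> 0" for x
    using mvt[of x 0] that by (cases "x = 0") (auto simp: \<Phi>0)
  have right: "F x = F 1" if "1 \<le> x" for x
    using mvt[of 1 x] that by (cases "x = 1") (auto simp: \<Phi>0)
  have nonneg: "0 \<le> \<Phi> 0 x" for x by (simp add: \<Phi>0)
  have mono: "F a \<le> F b" if "a \<le> b" for a b
    using mvt[of a b] that nonneg by (cases "a = b") (auto, smt (verit) mult_nonneg_nonneg)
  define c where "c = F 1 - F 0"
  \<comment> \<open>The mean value theorem identifies the total increase of \<open>F\<close> with a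
    positive value of the bump, so it can be divided out.\<close>
  obtain z where "0 < z" "z < 1" "F 1 - F 0 = (1 - 0) * \<Phi> 0 z" using mvt[of 0 1] by auto
  then have "c = exp (- 1 / (z * (1 - z)))" by (simp add: c_def \<Phi>0)
  then have c: "c > 0" by simp
  have between: "F 0 \<le> F x \<and> F x \<le> F 1" for x
    using mono[of 0 x] mono[of x 1] left[of x] right[of x] mono[of 0 1] by linarith
  define \<Psi> where "\<Psi> n x = (case n of 0 \<Rightarrow> (F x - F 0) / c | Suc m \<Rightarrow> \<Phi> m x / c)" for n x
  show thesis
  proof
    show "(\<Psi> n has_real_derivative \<Psi> (Suc n) x) (at x)" for n x
    proof (cases n)
      case 0
      show ?thesis unfolding 0 \<Psi>_def using F[of x] c by (auto intro!: derivative_eq_intros)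
    next
      case (Suc m)
      show ?thesis unfolding Suc \<Psi>_def using \<Phi>[of m x] c by (auto intro!: derivative_eq_intros)
    qed
    show "\<Psi> 0 x = 0" if "x \<le> 0" for x using left[OF that] by (simp add: \<Psi>_def)
    show "\<Psi> 0 x = 1" if "1 \<le> x" for x using right[OF that] c by (simp add: \<Psi>_def c_def)
    show "0 \<le> \<Psi> 0 x \<and> \<Psi> 0 x \<le> 1" for x using between[of x] c by (simp add: \<Psi>_def c_def)
    show "0 \<le> \<Psi> 1 x" for x using nonneg[of x] c by (simp add: \<Psi>_def)
    show "\<Psi> 1 x = 0" if "\<not> (0 < x \<and> x < 1)" for x using that by (auto simp: \<Psi>_def \<Phi>0)
  qed
qed

lemma continuous_unit_interval_integrable:
  "continuous_on {0..1} p \<Longrightarrow> integrable unit_interval p" for p :: "real \<Rightarrow> 'b :: {banach, second_countable_topology}"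
  unfolding integrable_unit_interval by (rule borel_integrable_atLeastAtMost') simp

text \<open>A one-sided kernel: rescaled to the interval from s to s + \<epsilon> k, it has total
  mass 1 by the fundamental theorem applied to \<open>F\<close>, and no mass leaves the unit
  interval because s + \<epsilon> k < 1.\<close>

lemma approximate_identity:
  fixes p :: "real \<Rightarrow> complex"
  assumes F: "\<And>x. (F has_real_derivative F' x) (at x)" and F'cont: "continuous_on UNIV F'"
    and F0: "\<And>x. x \<le> 0 \<Longrightarrow> F x = 0" and F1: "\<And>x. 1 \<le> x \<Longrightarrow> F x = 1"
    and F'nonneg: "\<And>x. 0 \<le> F' x" and F'zero: "\<And>x. \<not> (0 < x \<and> x < 1) \<Longrightarrow> F' x = 0"
    and p: "continuous_on {0..1} p" and s: "0 < s" "s < 1"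
    and \<epsilon>: "\<epsilon> \<longlonglongrightarrow> 0" "\<And>k. 0 < \<epsilon> k" "\<And>k. s + \<epsilon> k < 1"
  shows "(\<lambda>k. LINT x|unit_interval. of_real (F' ((x - s) / \<epsilon> k) / \<epsilon> k) * p x) \<longlonglongrightarrow> p s"
proof (rule LIMSEQ_I)
  fix e :: real assume e: "e > 0"
  let ?\<delta> = "\<lambda>k x. F' ((x - s) / \<epsilon> k) / \<epsilon> k"
  obtain d where d: "d > 0" "\<And>x. x \<in> {0..1} \<Longrightarrow> dist x s < d \<Longrightarrow> dist (p x) (p s) < e / 2"
    using p s e unfolding continuous_on_iff by (metis atLeastAtMost_iff half_gt_zero less_eq_real_def)
  obtain N where N: "\<And>k. k \<ge> N \<Longrightarrow> \<epsilon> k < d"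
    using order_tendstoD(2)[OF \<epsilon>(1) d(1)] unfolding eventually_sequentially by blast
  have "norm ((LINT x|unit_interval. of_real (?\<delta> k x) * p x) - p s) < e" if k: "k \<ge> N" for k
  proof -
    have ek: "\<epsilon> k > 0" "\<epsilon> k < d" "s + \<epsilon> k < 1" using \<epsilon> N k by auto
    have \<delta>c: "continuous_on A (?\<delta> k)" for A
      using ek by (intro continuous_intros continuous_on_compose2[OF F'cont]) auto
    have int: "integrable unit_interval (\<lambda>x. of_real (?\<delta> k x) * p x)"
      by (intro continuous_unit_interval_integrable continuous_on_mult continuous_on_of_real[OF \<delta>c] p)
    have int1: "integrable unit_interval (?\<delta> k)"
      using \<delta>c by (rule continuous_unit_interval_integrable)
    have int2: "integrable unit_interval (\<lambda>x. of_real (?\<delta> k x) * (p x - p s))"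
      by (intro continuous_unit_interval_integrable continuous_on_mult continuous_on_of_real[OF \<delta>c]
        continuous_on_diff p continuous_on_const)
    have "integral\<^sup>L unit_interval (?\<delta> k) = F ((1 - s) / \<epsilon> k) - F ((0 - s) / \<epsilon> k)"
    proof (rule integral_unit_interval_FTC[OF _ \<delta>c])
      fix x :: real
      have "((\<lambda>x. F ((x - s) / \<epsilon> k)) has_real_derivative ?\<delta> k x) (at x within {0..1})"
      proof -
        have "((\<lambda>x. (x - s) / \<epsilon> k) has_real_derivative 1 / \<epsilon> k) (at x within {0..1})"
          using ek by (auto intro!: derivative_eq_intros)
        from DERIV_chain2[OF F this] show ?thesis by simp
      qed
      then show "((\<lambda>x. F ((x - s) / \<epsilon> k)) has_vector_derivative ?\<delta> k x) (at x within {0..1})"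
        by (simp add: has_real_derivative_iff_has_vector_derivative)
    qed
    also have "F ((1 - s) / \<epsilon> k) = 1" using ek by (intro F1) (simp add: pos_le_divide_eq)
    also have "F ((0 - s) / \<epsilon> k) = 0" using ek s by (intro F0) (simp add: divide_nonpos_pos)
    finally have one: "integral\<^sup>L unit_interval (?\<delta> k) = 1" by simp
    have "(LINT x|unit_interval. of_real (?\<delta> k x) * p s) = of_real (integral\<^sup>L unit_interval (?\<delta> k)) * p s"
      by (simp add: integral_complex_of_real del: of_real_divide)
    then have "(LINT x|unit_interval. of_real (?\<delta> k x) * p x) - p s =
      (LINT x|unit_interval. of_real (?\<delta> k x) * p x) - (LINT x|unit_interval. of_real (?\<delta> k x) * p s)"
      using one by simp
    also have "\<dots> = (LINT x|unit_interval. of_real (?\<delta> k x) * (p x - p s))"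
      unfolding right_diff_distrib
      by (rule Bochner_Integration.integral_diff[symmetric, OF int])
        (use int1 in \<open>simp add: complex_of_real_integrable_eq del: of_real_divide\<close>)
    also have "norm \<dots> \<le> (LINT x|unit_interval. norm (of_real (?\<delta> k x) * (p x - p s)))"
      by (rule integral_norm_bound)
    also have "\<dots> \<le> (LINT x|unit_interval. ?\<delta> k x * (e / 2))"
    proof (rule integral_mono)
      show "integrable unit_interval (\<lambda>x. norm (of_real (?\<delta> k x) * (p x - p s)))"
        using int2 by (rule integrable_norm)
      show "integrable unit_interval (\<lambda>x. ?\<delta> k x * (e / 2))" by (rule integrable_mult_left, rule int1)
      fix x assume x: "x \<in> space unit_interval"
      show "norm (of_real (?\<delta> k x) * (p x - p s)) \<le> ?\<delta> k x * (e / 2)"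
      proof (cases "0 < (x - s) / \<epsilon> k \<and> (x - s) / \<epsilon> k < 1")
        case True
        then have "dist x s < d" using ek by (auto simp: dist_real_def zero_less_divide_iff pos_divide_less_eq)
        then have "norm (p x - p s) \<le> e / 2" using d(2)[of x] x by (simp add: dist_norm)
        moreover have "0 \<le> ?\<delta> k x" using F'nonneg ek by simp
        ultimately show ?thesis
          unfolding norm_mult norm_of_real by (metis abs_of_nonneg mult_left_mono)
      next
        case False
        then have "F' ((x - s) / \<epsilon> k) = 0" by (rule F'zero)
        then show ?thesis by simp
      qed
    qed
    also have "\<dots> = e / 2" using one by simp
    finally show ?thesis using e by simp
  qed
  then show "\<exists>no. \<forall>n\<ge>no. norm ((LINT x|unit_interval. of_real (?\<delta> n x) * p x) - p s) < e" by blast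
qed

text \<open>The test functions rise smoothly from 0 to 1 just to the right of \<open>s\<close> and fall back to 0 just
  to the right of \<open>r\<close>, so that their derivatives are a difference of approximate identities.\<close>

lemma weak_derivative_increment:
  fixes p q :: "real \<Rightarrow> complex"
  assumes q: "integrable unit_interval q" and p: "continuous_on {0..1} p"
    and weak: "\<And>\<phi>. test_function \<phi> \<Longrightarrow>
      (LINT x|unit_interval. of_real (\<phi> x) * q x) = - (LINT x|unit_interval. of_real (deriv \<phi> x) * p x)"
    and sr: "0 < s" "s < r" "r < 1"
  shows "p r - p s = (LINT x|unit_interval. indicator {s<..r} x *\<^sub>R q x)"
proof -
  obtain \<Psi> :: "nat \<Rightarrow> real \<Rightarrow> real"
    where D: "\<And>n x. (\<Psi> n has_real_derivative \<Psi> (Suc n) x) (at x)"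
    and P0: "\<And>x. x \<le> 0 \<Longrightarrow> \<Psi> 0 x = 0" and P1: "\<And>x. 1 \<le> x \<Longrightarrow> \<Psi> 0 x = 1"
    and Pb: "\<And>x. 0 \<le> \<Psi> 0 x \<and> \<Psi> 0 x \<le> 1"
    and Dn: "\<And>x. 0 \<le> \<Psi> 1 x" and Dz: "\<And>x. \<not> (0 < x \<and> x < 1) \<Longrightarrow> \<Psi> 1 x = 0"
    using smooth_step by blast
  have cont: "continuous_on A (\<Psi> n)" for n A
    using D by (meson DERIV_isCont continuous_at_imp_continuous_on)
  \<comment> \<open>The \<open>+ 2\<close> keeps r + \<epsilon> k below 1 already for k = 0, so the
    supports stay inside (0,1).\<close>
  define \<epsilon> where "\<epsilon> k = (1 - r) / (real k + 2)" for k
  have \<epsilon>pos: "0 < \<epsilon> k" for k using sr by (simp add: \<epsilon>_def)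
  have \<epsilon>small: "\<epsilon> k < 1 - r" for k using sr by (simp add: \<epsilon>_def pos_divide_less_eq)
  have \<epsilon>lim: "\<epsilon> \<longlonglongrightarrow> 0"
    unfolding \<epsilon>_def by real_asymp
  define \<phi> where "\<phi> k x = \<Psi> 0 ((x - s) / \<epsilon> k) - \<Psi> 0 ((x - r) / \<epsilon> k)" for k x
  have \<phi>D: "((\<lambda>x. (\<Psi> n ((x - s) / \<epsilon> k) - \<Psi> n ((x - r) / \<epsilon> k)) / \<epsilon> k ^ n) has_real_derivative
     (\<Psi> (Suc n) ((x - s) / \<epsilon> k) - \<Psi> (Suc n) ((x - r) / \<epsilon> k)) / \<epsilon> k ^ Suc n) (at x)" for n k x
    using \<epsilon>pos[of k]
    by (auto intro!: derivative_eq_intros DERIV_chain2[OF D] simp: field_simps)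
  have test: "test_function (\<phi> k)" for k
    unfolding test_function_def
  proof (intro conjI)
    show "\<exists>\<Phi>. \<Phi> 0 = \<phi> k \<and> (\<forall>n x. (\<Phi> n has_real_derivative \<Phi> (Suc n) x) (at x))"
      using \<phi>D by (intro exI[of _ "\<lambda>n x. (\<Psi> n ((x - s) / \<epsilon> k) - \<Psi> n ((x - r) / \<epsilon> k)) / \<epsilon> k ^ n"])
        (auto simp: \<phi>_def fun_eq_iff)
    have "\<phi> k x = 0" if "x \<notin> {s..r + \<epsilon> k}" for x
    proof (cases "x < s")
      case True
      then show ?thesis using sr \<epsilon>pos[of k] by (simp add: \<phi>_def P0 divide_nonpos_pos)
    next
      case False
      then have "r + \<epsilon> k < x" using that by auto
      then have "1 \<le> (x - r) / \<epsilon> k" "1 \<le> (x - s) / \<epsilon> k"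
        using \<epsilon>pos[of k] sr by (auto simp: pos_le_divide_eq)
      then show ?thesis by (simp add: \<phi>_def P1)
    qed
    then show "\<exists>a b. 0 < a \<and> b < 1 \<and> (\<forall>x. x \<notin> {a..b} \<longrightarrow> \<phi> k x = 0)"
      using sr \<epsilon>small[of k] by (intro exI[of _ s] exI[of _ "r + \<epsilon> k"]) auto
  qed
  have deriv: "deriv (\<phi> k) x = \<Psi> 1 ((x - s) / \<epsilon> k) / \<epsilon> k - \<Psi> 1 ((x - r) / \<epsilon> k) / \<epsilon> k" for k x
    using \<phi>D[of 0 k x] by (intro DERIV_imp_deriv) (simp add: \<phi>_def[abs_def] diff_divide_distrib)
  have int: "integrable unit_interval (\<lambda>x. of_real (\<Psi> 1 ((x - t) / \<epsilon> k) / \<epsilon> k) * p x)" for t k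
    using p cont \<epsilon>pos[of k]
    by (intro continuous_unit_interval_integrable continuous_intros continuous_on_compose2[OF cont[of UNIV]]) (auto simp: less_imp_neq[symmetric])
  have ai: "(\<lambda>k. LINT x|unit_interval. of_real (\<Psi> 1 ((x - t) / \<epsilon> k) / \<epsilon> k) * p x) \<longlonglongrightarrow> p t"
    if "0 < t" "t \<le> r" for t
  proof (rule approximate_identity[where F = "\<Psi> 0"])
    show "(\<Psi> 0 has_real_derivative \<Psi> 1 x) (at x)" for x using D[of 0 x] by simp
    show "t + \<epsilon> k < 1" for k using \<epsilon>small[of k] that by simp
  qed (use that sr cont P0 P1 Dn Dz p \<epsilon>lim \<epsilon>pos in auto)
  have "(\<lambda>k. - (LINT x|unit_interval. of_real (deriv (\<phi> k) x) * p x)) \<longlonglongrightarrow> - (p s - p r)"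
  proof (intro tendsto_minus)
    have "(LINT x|unit_interval. of_real (deriv (\<phi> k) x) * p x) =
      (LINT x|unit_interval. of_real (\<Psi> 1 ((x - s) / \<epsilon> k) / \<epsilon> k) * p x) -
      (LINT x|unit_interval. of_real (\<Psi> 1 ((x - r) / \<epsilon> k) / \<epsilon> k) * p x)" for k
      unfolding deriv of_real_diff left_diff_distrib
      by (rule Bochner_Integration.integral_diff[OF int int])
    then show "(\<lambda>k. LINT x|unit_interval. of_real (deriv (\<phi> k) x) * p x) \<longlonglongrightarrow> p s - p r"
      using ai[of s] ai[of r] sr by (simp only:) (intro tendsto_diff; simp)
  qed
  then have l1: "(\<lambda>k. LINT x|unit_interval. of_real (\<phi> k x) * q x) \<longlonglongrightarrow> p r - p s"
    using weak[OF test] by simp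
  have "(\<lambda>k. LINT x|unit_interval. of_real (\<phi> k x) * q x) \<longlonglongrightarrow> (LINT x|unit_interval. indicator {s<..r} x *\<^sub>R q x)"
  proof (rule integral_dominated_convergence)
    show "integrable unit_interval (\<lambda>x. norm (q x))" using q by simp
    have qm: "q \<in> borel_measurable unit_interval" using q by auto
    have \<phi>c: "continuous_on UNIV (\<phi> k)" for k
      unfolding \<phi>_def using \<epsilon>pos[of k]
      by (intro continuous_intros continuous_on_compose2[OF cont[of UNIV]]) (auto simp: less_imp_neq[symmetric])
    have m: "\<phi> k \<in> borel_measurable unit_interval" for k
      by (intro measurable_unit_interval borel_measurable_continuous_onI \<phi>c)
    show "(\<lambda>x. of_real (\<phi> k x) * q x) \<in> borel_measurable unit_interval" for k
      using m[of k] qm by measurable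
    have "{s<..r} \<in> sets borel" by simp
    then show "(\<lambda>x. indicator {s<..r} x *\<^sub>R q x) \<in> borel_measurable unit_interval"
      by (intro borel_measurable_scaleR qm measurable_unit_interval[OF borel_measurable_indicator])
    have "\<bar>\<phi> k x\<bar> \<le> 1" for k x unfolding \<phi>_def using Pb[of "(x - s) / \<epsilon> k"] Pb[of "(x - r) / \<epsilon> k"] by linarith
    then show "AE x in unit_interval. norm (of_real (\<phi> k x) * q x) \<le> norm (q x)" for k
      by (auto simp: norm_mult mult_left_le_one_le)
    \<comment> \<open>The step at \<open>t\<close> vanishes at \<open>t\<close> itself, so the
      difference of the two steps tends to the indicator of a half-open interval.\<close>
    have step: "(\<lambda>k. \<Psi> 0 ((x - t) / \<epsilon> k)) \<longlonglongrightarrow> (if t < x then 1 else 0)" for x t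
    proof (cases "t < x")
      case True
      have "eventually (\<lambda>k. \<epsilon> k < x - t) sequentially" using order_tendstoD(2)[OF \<epsilon>lim] True by simp
      then have "eventually (\<lambda>k. \<Psi> 0 ((x - t) / \<epsilon> k) = 1) sequentially"
        by eventually_elim (use \<epsilon>pos in \<open>auto intro!: P1 simp: pos_le_divide_eq\<close>)
      then show ?thesis using True by (simp add: tendsto_eventually)
    next
      case False
      then have "\<Psi> 0 ((x - t) / \<epsilon> k) = 0" for k using \<epsilon>pos[of k] by (intro P0) (simp add: divide_nonpos_pos)
      then show ?thesis using False by simp
    qed
    have "(\<lambda>k. \<phi> k x) \<longlonglongrightarrow> indicator {s<..r} x" for x
      using tendsto_diff[OF step[of x s] step[of x r]] sr
      by (auto simp: \<phi>_def indicator_def split: if_splits)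
    then have "(\<lambda>k. of_real (\<phi> k x) * q x) \<longlonglongrightarrow> of_real (indicator {s<..r} x) * q x" for x
      by (intro tendsto_intros)
    then show "AE x in unit_interval. (\<lambda>k. of_real (\<phi> k x) * q x) \<longlonglongrightarrow> indicator {s<..r} x *\<^sub>R q x"
      by (simp add: scaleR_conv_of_real)
  qed
  with l1 show ?thesis by (rule LIMSEQ_unique)
qed

text \<open>Test functions only reach increments inside (0,1); continuity of \<open>p\<close> and
  dominated convergence extend the formula to the closed interval.\<close>

lemma weak_derivative_FTC:
  fixes p q :: "real \<Rightarrow> complex"
  assumes q: "integrable unit_interval q" and p: "continuous_on {0..1} p"
    and weak: "\<And>\<phi>. test_function \<phi> \<Longrightarrow>
      (LINT x|unit_interval. of_real (\<phi> x) * q x) = - (LINT x|unit_interval. of_real (deriv \<phi> x) * p x)"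
    and x: "x \<in> {0..1}"
  shows "p x = p 0 + (LINT t|unit_interval. indicator {0..x} t *\<^sub>R q t)"
proof (cases "x = 0")
  case True
  have "AE t in lborel. t \<noteq> (0::real)" by (rule AE_lborel_singleton)
  then have "AE t in unit_interval. t \<noteq> 0"
    unfolding unit_interval_def by (subst AE_restrict_space_iff) (auto elim: eventually_mono)
  then have "(LINT t|unit_interval. indicator {0..x} t *\<^sub>R q t) = (LINT t|unit_interval. 0)"
    using q True
    by (intro integral_cong_AE borel_measurable_scaleR measurable_unit_interval[OF borel_measurable_indicator])
      (auto elim!: eventually_mono)
  then show ?thesis using True by simp
next
  case False
  then have x0: "0 < x" "x \<le> 1" using x by auto
  \<comment> \<open>The points \<open>s k\<close> and \<open>r k\<close> approach 0 and
    \<open>x\<close> from inside; the \<open>+ 3\<close> makes r k - s k = x (1 - 2/(k + 3))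
    positive for all \<open>k\<close>.\<close>
  define s where "s k = x / (real k + 3)" for k
  define r where "r k = x * (1 - 1 / (real k + 3))" for k
  have s: "0 < s k" for k using x0 by (simp add: s_def)
  have rx: "r k < x" for k using x0 by (simp add: r_def)
  have sr: "s k < r k" for k
  proof -
    have "r k - s k = x * (1 - 2 / (real k + 3))" by (simp add: r_def s_def right_diff_distrib)
    also have "\<dots> > 0" using x0 by (intro mult_pos_pos) auto
    finally show ?thesis by simp
  qed
  have slim: "s \<longlonglongrightarrow> 0" unfolding s_def by real_asymp
  have rlim: "r \<longlonglongrightarrow> x"
  proof -
    have "(\<lambda>k. x * (1 - 1 / (real k + 3))) \<longlonglongrightarrow> x * 1"
      by (intro tendsto_mult_left) real_asymp
    then show ?thesis by (simp add: r_def[abs_def])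
  qed
  have in01: "s k \<in> {0..1}" "r k \<in> {0..1}" for k
    using s[of k] sr[of k] rx[of k] x0 by auto
  have "(\<lambda>k. p (r k) - p (s k)) \<longlonglongrightarrow> p x - p 0"
    using in01 x by (intro tendsto_diff continuous_on_tendsto_compose[OF p] rlim slim) auto
  moreover have "(\<lambda>k. p (r k) - p (s k)) \<longlonglongrightarrow> (LINT t|unit_interval. indicator {0..x} t *\<^sub>R q t)"
  proof -
    have "p (r k) - p (s k) = (LINT t|unit_interval. indicator {s k<..r k} t *\<^sub>R q t)" for k
      using weak_derivative_increment[OF q p weak s[of k] sr[of k]] rx[of k] x0 by simp
    moreover have "(\<lambda>k. LINT t|unit_interval. indicator {s k<..r k} t *\<^sub>R q t) \<longlonglongrightarrow>
      (LINT t|unit_interval. indicator {0..x} t *\<^sub>R q t)"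
    proof (rule integral_dominated_convergence)
      have qm: "q \<in> borel_measurable unit_interval" using q by auto
      show "integrable unit_interval (\<lambda>x. norm (q x))" using q by simp
      show "(\<lambda>t. indicator {s k<..r k} t *\<^sub>R q t) \<in> borel_measurable unit_interval"
        "(\<lambda>t. indicator {0..x} t *\<^sub>R q t) \<in> borel_measurable unit_interval" for k
        by (intro borel_measurable_scaleR qm measurable_unit_interval[OF borel_measurable_indicator]; simp)+
      show "AE t in unit_interval. norm (indicator {s k<..r k} t *\<^sub>R q t) \<le> norm (q t)" for k
        by (auto simp: indicator_def)
      have "AE t in lborel. t \<noteq> (0::real)" "AE t in lborel. t \<noteq> x" by (rule AE_lborel_singleton)+
      then have "AE t in lborel. t \<in> {0..1} \<longrightarrow>
          (\<lambda>k. indicator {s k<..r k} t *\<^sub>R q t) \<longlonglongrightarrow> indicator {0..x} t *\<^sub>R q t"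
      proof eventually_elim
        case (elim t)
        show ?case
        proof
          assume t: "t \<in> {0..1}"
          show "(\<lambda>k. indicator {s k<..r k} t *\<^sub>R q t) \<longlonglongrightarrow> indicator {0..x} t *\<^sub>R q t"
          proof (cases "t < x")
            case True
            then have "eventually (\<lambda>k. s k < t) sequentially" "eventually (\<lambda>k. t < r k) sequentially"
              using order_tendstoD(2)[OF slim, of t] order_tendstoD(1)[OF rlim, of t] t elim by auto
            then have "eventually (\<lambda>k. indicator {s k<..r k} t *\<^sub>R q t = indicator {0..x} t *\<^sub>R q t) sequentially"
              by eventually_elim (use True t in \<open>auto simp: indicator_def\<close>)
            then show ?thesis by (rule tendsto_eventually)
          next
            case False
            then have "x < t" using elim by simp
            have e1: "indicator {s k<..r k} t = (0::real)" for k using rx[of k] \<open>x < t\<close> by (simp add: indicator_def)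
            have e2: "indicator {0..x} t = (0::real)" using \<open>x < t\<close> by (simp add: indicator_def)
            show ?thesis unfolding e1 e2 by simp
          qed
        qed
      qed
      then show "AE t in unit_interval. (\<lambda>k. indicator {s k<..r k} t *\<^sub>R q t) \<longlonglongrightarrow> indicator {0..x} t *\<^sub>R q t"
        unfolding unit_interval_def by (subst AE_restrict_space_iff) auto
    qed
    ultimately show ?thesis by simp
  qed
  ultimately have "p x - p 0 = (LINT t|unit_interval. indicator {0..x} t *\<^sub>R q t)" by (rule LIMSEQ_unique)
  then show ?thesis by (simp add: algebra_simps)
qed

text \<open>\<open>q\<close> is merely integrable, so the product rule is replaced by Fubini on the
  triangle t \<le> x: integrating \<open>h\<close> from \<open>t\<close> to 1 produces H 1 - H
  t.\<close>

lemma integration_by_parts: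
  fixes q H h :: "real \<Rightarrow> complex"
  defines "K \<equiv> \<lambda>x. LINT t|unit_interval. indicator {0..x} t *\<^sub>R q t"
  assumes q: "integrable unit_interval q"
    and H: "\<And>x. x \<in> {0..1} \<Longrightarrow> (H has_vector_derivative h x) (at x within {0..1})"
    and h: "continuous_on {0..1} h"
  shows "integrable unit_interval (\<lambda>x. K x * h x)"
    and "(LINT x|unit_interval. q x * H x) = (LINT x|unit_interval. q x) * H 1 - (LINT x|unit_interval. K x * h x)"
proof -
  interpret P: pair_prob_space unit_interval unit_interval
    by (intro pair_prob_space.intro pair_sigma_finite.intro UI.prob_space_axioms UI.sigma_finite_measure_axioms)
  have qm [measurable]: "q \<in> borel_measurable unit_interval" using q by auto
  have hm [measurable]: "h \<in> borel_measurable unit_interval"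
    using continuous_unit_interval_integrable[OF h] by auto
  have idm [measurable]: "(\<lambda>x. x) \<in> borel_measurable unit_interval" by (rule measurable_unit_interval) simp
  let ?f = "\<lambda>t x. (indicator {0..x} t *\<^sub>R q t) * h x"
  have fm: "(\<lambda>(t, x). ?f t x) \<in> borel_measurable (unit_interval \<Otimes>\<^sub>M unit_interval)"
  proof -
    have "(\<lambda>(t, x). (if t \<le> x then q t else 0) * h x) \<in> borel_measurable (unit_interval \<Otimes>\<^sub>M unit_interval)"
      by measurable
    then show ?thesis
      by (rule measurable_cong[THEN iffD1, rotated]) (auto simp: space_pair_measure indicator_def)
  qed
  obtain B where B: "\<And>x. x \<in> {0..1} \<Longrightarrow> norm (h x) \<le> B"
    using compact_imp_bounded[OF compact_continuous_image[OF h compact_Icc]] by (force simp: bounded_iff)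
  have bd: "norm (?f t x) \<le> norm (q t) * B" if "x \<in> {0..1}" for t x
    using B[OF that] order_trans[OF norm_ge_zero B[OF that]]
    by (auto simp: norm_mult indicator_def intro!: mult_left_mono mult_nonneg_nonneg)
  have fx: "integrable unit_interval (\<lambda>x. ?f t x)" if t: "t \<in> {0..1}" for t
  proof (rule UI.integrable_const_bound[where B = "norm (q t) * B"])
    show "AE x in unit_interval. norm (?f t x) \<le> norm (q t) * B" using bd by auto
    show "(\<lambda>x. ?f t x) \<in> borel_measurable unit_interval"
      using measurable_Pair2[OF fm, of t] t by simp
  qed
  have int: "integrable (unit_interval \<Otimes>\<^sub>M unit_interval) (\<lambda>(t, x). ?f t x)"
  proof (rule P.Fubini_integrable[OF fm])
    show "AE t in unit_interval. integrable unit_interval (\<lambda>x. case (t, x) of (t, x) \<Rightarrow> ?f t x)"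
      using fx by auto
    show "integrable unit_interval (\<lambda>t. LINT x|unit_interval. norm (case (t, x) of (t, x) \<Rightarrow> ?f t x))"
    proof (rule Bochner_Integration.integrable_bound)
      show "integrable unit_interval (\<lambda>t. norm (q t) * B)" using q by simp
      show "(\<lambda>t. LINT x|unit_interval. norm (case (t, x) of (t, x) \<Rightarrow> ?f t x)) \<in> borel_measurable unit_interval"
        using fm by measurable
      have "(LINT x|unit_interval. norm (?f t x)) \<le> norm (q t) * B" if t: "t \<in> {0..1}" for t
      proof -
        have "(LINT x|unit_interval. norm (?f t x)) \<le> (LINT x|unit_interval. norm (q t) * B)"
          using fx[OF t] bd by (intro integral_mono integrable_norm) auto
        then show ?thesis using UI.prob_space by simp
      qed
      then show "AE t in unit_interval. norm (LINT x|unit_interval. norm (case (t, x) of (t, x) \<Rightarrow> ?f t x)) \<le> norm (norm (q t) * B)"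
        by (auto intro!: order_trans[OF _ abs_ge_self])
    qed
  qed
  have Kh: "(LINT t|unit_interval. ?f t x) = K x * h x" for x
    unfolding K_def integral_mult_left_zero[symmetric] ..
  show "integrable unit_interval (\<lambda>x. K x * h x)"
    using P.integrable_snd[OF int] unfolding Kh .
  have qH: "(LINT x|unit_interval. ?f t x) = q t * (H 1 - H t)" if t: "t \<in> {0..1}" for t
  proof -
    have "(LINT x|unit_interval. ?f t x) = (LINT x|unit_interval. q t * (indicator {t..1} x *\<^sub>R h x))"
      using t by (intro Bochner_Integration.integral_cong) (auto simp: indicator_def)
    also have "\<dots> = q t * (LINT x|unit_interval. indicator {t..1} x *\<^sub>R h x)"
      by (rule integral_mult_right_zero)
    also have "(LINT x|unit_interval. indicator {t..1} x *\<^sub>R h x) = (LINT x|lborel. indicator {t..1} x *\<^sub>R h x)"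
      unfolding integral_unit_interval set_lebesgue_integral_def
      using t by (intro Bochner_Integration.integral_cong) (auto simp: indicator_def)
    also have "\<dots> = H 1 - H t"
    proof (rule integral_FTC_Icc)
      show "continuous_on {t..1} h" by (rule continuous_on_subset[OF h]) (use t in auto)
      show "(H has_vector_derivative h x) (at x within {t..1})" if "t \<le> x" "x \<le> 1" for x
        using H[of x] that t by (auto intro: has_vector_derivative_within_subset[of _ _ _ "{0..1}"])
    qed (use t in auto)
    finally show ?thesis .
  qed
  have qHint: "integrable unit_interval (\<lambda>t. q t * (H 1 - H t))"
  proof -
    have "integrable unit_interval (\<lambda>t. LINT x|unit_interval. ?f t x) \<longleftrightarrow> integrable unit_interval (\<lambda>t. q t * (H 1 - H t))"
      by (rule Bochner_Integration.integrable_cong[OF refl], rule qH) simp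
    with P.integrable_fst[OF int] show ?thesis by (simp only:)
  qed
  have "(LINT x|unit_interval. K x * h x) = (LINT t|unit_interval. LINT x|unit_interval. ?f t x)"
    using P.Fubini_integral[OF int] unfolding Kh .
  also have "\<dots> = (LINT t|unit_interval. q t * (H 1 - H t))"
    by (rule Bochner_Integration.integral_cong[OF refl], rule qH) simp
  finally have *: "(LINT x|unit_interval. K x * h x) = (LINT t|unit_interval. q t * (H 1 - H t))" .
  have "(LINT x|unit_interval. q x * H x) = (LINT x|unit_interval. q x * H 1 - q x * (H 1 - H x))"
    by (simp add: algebra_simps)
  also have "\<dots> = (LINT x|unit_interval. q x * H 1) - (LINT x|unit_interval. q x * (H 1 - H x))"
    using q qHint by (intro Bochner_Integration.integral_diff) auto
  finally show "(LINT x|unit_interval. q x * H x) = (LINT x|unit_interval. q x) * H 1 - (LINT x|unit_interval. K x * h x)"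
    using * by simp
qed

text \<open>Integration by parts against e(-a x); the boundary term p 1 e(-a) - p 0 vanishes by
  \<open>boundary\<close>.\<close>

lemma weak_derivative_coefficient:
  fixes p q :: "real \<Rightarrow> complex"
  assumes q: "integrable unit_interval q" and p: "continuous_on {0..1} p"
    and weak: "\<And>\<phi>. test_function \<phi> \<Longrightarrow>
      (LINT x|unit_interval. of_real (\<phi> x) * q x) = - (LINT x|unit_interval. of_real (deriv \<phi> x) * p x)"
    and boundary: "p 1 = ee a * p 0"
  shows "(LINT x|unit_interval. q x * cnj (ee (a * x))) =
    \<i> * 2 * of_real pi * of_real a * (LINT x|unit_interval. p x * cnj (ee (a * x)))"
proof -
  define H where "H x = ee (- a * x)" for x
  define h where "h x = \<i> * 2 * of_real pi * of_real (- a) * ee (- a * x)" for x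
  let ?K = "\<lambda>x. LINT t|unit_interval. indicator {0..x} t *\<^sub>R q t"
  have H: "(H has_vector_derivative h x) (at x within A)" for x A
    unfolding H_def h_def by (rule ee_has_vector_derivative)
  have hc: "continuous_on {0..1} h" unfolding h_def by (intro continuous_intros)
  note ibp = integration_by_parts[OF q H hc]
  have K: "?K x = p x - p 0" if "x \<in> {0..1}" for x
    using weak_derivative_FTC[OF q p weak that] by simp
  have K1: "(LINT x|unit_interval. q x) = p 1 - p 0"
  proof -
    have "(LINT x|unit_interval. q x) = ?K 1"
      by (intro Bochner_Integration.integral_cong) (auto simp: indicator_def)
    then show ?thesis using K[of 1] by simp
  qed
  have ph: "integrable unit_interval (\<lambda>x. p x * h x)" and hi: "integrable unit_interval h"
    using p hc by (auto intro!: continuous_unit_interval_integrable continuous_intros)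
  have "(LINT x|unit_interval. ?K x * h x) = (LINT x|unit_interval. p x * h x - p 0 * h x)"
    by (intro Bochner_Integration.integral_cong refl) (simp add: K left_diff_distrib)
  also have "\<dots> = (LINT x|unit_interval. p x * h x) - p 0 * (LINT x|unit_interval. h x)"
    using ph hi by simp
  also have "(LINT x|unit_interval. h x) = H 1 - H 0"
    by (rule integral_unit_interval_FTC[OF H hc])
  finally have "(LINT x|unit_interval. q x * H x) =
      (p 1 - p 0) * H 1 - ((LINT x|unit_interval. p x * h x) - p 0 * (H 1 - H 0))"
    using ibp(2) K1 by simp
  also have "\<dots> = p 1 * H 1 - p 0 - (LINT x|unit_interval. p x * h x)"
    by (simp add: H_def algebra_simps)
  also have "p 1 * H 1 = p 0" using boundary by (simp add: H_def mult.assoc mult.left_commute)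
  also have "(LINT x|unit_interval. p x * h x) =
      - (\<i> * 2 * of_real pi * of_real a) * (LINT x|unit_interval. p x * H x)"
    unfolding integral_mult_right_zero[symmetric] by (simp add: h_def H_def mult_ac)
  finally show ?thesis by (simp add: H_def cnj_ee)
qed

section \<open>The operator P and commutation\<close>

lemma continuous_L2:
  assumes "continuous_on {0..1} p" shows "p \<in> L2 unit_interval"
proof (rule L2_I)
  show "p \<in> borel_measurable unit_interval"
    using continuous_unit_interval_integrable[OF assms] by auto
  show "integrable unit_interval (\<lambda>x. (cmod (p x))\<^sup>2)"
    by (intro continuous_unit_interval_integrable continuous_intros assms)
qed

lemma test_function_facts:
  assumes "test_function \<phi>"
  shows "\<And>x. (\<phi> has_real_derivative deriv \<phi> x) (at x)"
    and "continuous_on A \<phi>" and "continuous_on A (deriv \<phi>)" and "\<phi> 0 = 0" and "\<phi> 1 = 0"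
proof -
  obtain \<Phi> :: "nat \<Rightarrow> real \<Rightarrow> real" where \<Phi>: "\<Phi> 0 = \<phi>" "\<And>n x. (\<Phi> n has_real_derivative \<Phi> (Suc n) x) (at x)"
    using assms unfolding test_function_def by blast
  have d: "deriv \<phi> = \<Phi> 1" using \<Phi>(2)[of 0] unfolding \<Phi>(1) by (auto intro!: DERIV_imp_deriv)
  show "(\<phi> has_real_derivative deriv \<phi> x) (at x)" for x
    using \<Phi>(2)[of 0 x] unfolding d \<Phi>(1) by simp
  have "continuous_on A (\<Phi> n)" for n
    using \<Phi>(2) by (meson DERIV_isCont continuous_at_imp_continuous_on)
  from this[of 0] this[of 1] show "continuous_on A \<phi>" "continuous_on A (deriv \<phi>)" unfolding d \<Phi>(1) by auto
  show "\<phi> 0 = 0" "\<phi> 1 = 0" using assms unfolding test_function_def by (auto)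
qed

text \<open>Full measure implies density; with continuity in norm this transfers an identity for
  almost all \<open>x\<close> to every point, in particular to the endpoints.\<close>

lemma unit_interval_AE_dense:
  assumes ae: "AE x in unit_interval. P x" and "0 \<le> a" "a < b" "b \<le> 1"
  shows "\<exists>x. a < x \<and> x < b \<and> P x"
proof (rule ccontr)
  assume neg: "\<not> (\<exists>x. a < x \<and> x < b \<and> P x)"
  have "AE x in lborel. x \<in> {0..1} \<longrightarrow> P x"
    using ae unfolding unit_interval_def by (subst (asm) AE_restrict_space_iff) auto
  then have "AE x in lborel. x \<notin> {a<..<b}"
    by eventually_elim (use neg assms in auto)
  moreover have "{x \<in> space lborel. \<not> x \<notin> {a<..<b}} = {a<..<b}" by auto
  ultimately have "emeasure lborel {a<..<b} = 0" using AE_iff_measurable[of "{a<..<b}" lborel] by auto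
  then show False using assms by simp
qed

context borel_prob_space
begin

lemma HH_section:
  assumes f: "f \<in> L2 (HH \<mu>)"
  shows "AE y in \<mu>. (\<lambda>x. f (x, y)) \<in> L2 unit_interval"
proof -
  have fm: "f \<in> borel_measurable (unit_interval \<Otimes>\<^sub>M \<mu>)" by (rule HH_D[OF f])
  have int: "integrable (unit_interval \<Otimes>\<^sub>M \<mu>) (\<lambda>(x, y). (cmod (f (x, y)))\<^sup>2)"
    using f by (simp add: L2_def HH_def split_beta')
  show ?thesis
    using pair.AE_integrable_snd[OF int]
  proof eventually_elim
    case (elim y)
    then show ?case using measurable_Pair1[OF fm, of y] by (intro L2_I) (simp_all add: space_mu)
  qed
qed

lemma AE_HH_fst:
  assumes "AE z in HH \<mu>. Q z" shows "AE x in unit_interval. AE y in \<mu>. Q (x, y)"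
  by (rule pair.AE_pair[OF assms[unfolded HH_def]])

lemma partial_integral_cong:
  assumes f: "f \<in> L2 (HH \<mu>)" "f' \<in> L2 (HH \<mu>)" "eqL2 (HH \<mu>) f f'" and w: "w \<in> L2 unit_interval"
  shows "eqL2 \<mu> (\<lambda>y. LINT x|unit_interval. f (x, y) * cnj (w x)) (\<lambda>y. LINT x|unit_interval. f' (x, y) * cnj (w x))"
proof -
  let ?d = "\<lambda>y. LINT x|unit_interval. (f (x, y) - f' (x, y)) * cnj (w x)"
  have d: "(\<lambda>z. f z - f' z) \<in> L2 (HH \<mu>)" using f by (intro L2_diff)
  have "normL2 (HH \<mu>) (\<lambda>z. f z - f' z) = 0" using f by (simp add: eqL2_iff_norm_diff)
  then have "normL2 \<mu> ?d \<le> 0" using partial_integral_L2(2)[OF d w] by simp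
  then have "normL2 \<mu> ?d = 0" using normL2_nonneg[of \<mu> ?d] by linarith
  then have "AE y in \<mu>. ?d y = 0"
    using normL2_eq_0_iff[OF partial_integral_L2(1)[OF d w]] by (simp add: eqL2_def)
  with HH_section[OF f(1)] HH_section[OF f(2)] show ?thesis
    unfolding eqL2_def
  proof eventually_elim
    case (elim y)
    have "?d y = (LINT x|unit_interval. f (x, y) * cnj (w x)) - (LINT x|unit_interval. f' (x, y) * cnj (w x))"
      unfolding left_diff_distrib
      by (rule Bochner_Integration.integral_diff[OF L2_inner_integrable[OF elim(1) w] L2_inner_integrable[OF elim(2) w]])
    with elim(3) show ?case by simp
  qed
qed

end

context spectral_pair
begin

lemma e_L2: "l \<in> \<Lambda> \<Longrightarrow> e_fun l \<in> L2 \<mu>"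
  by (rule onb_L2[OF onb])

lemma norm_e: "l \<in> \<Lambda> \<Longrightarrow> normL2 \<mu> (e_fun l) = 1"
proof -
  assume "l \<in> \<Lambda>"
  then have "innerL2 \<mu> (e_fun l) (e_fun l) = 1" using onb by (simp add: orthonormal_basis_def)
  then have "(normL2 \<mu> (e_fun l))\<^sup>2 = 1" by (simp add: normL2_sq_inner)
  then show ?thesis using normL2_nonneg[of \<mu> "e_fun l"] by (simp add: power2_eq_1_iff)
qed

lemma continuous_coefficient:
  assumes F: "continuous_representative \<mu> f F" and l: "l \<in> \<Lambda>"
  shows "continuous_on {0..1} (\<lambda>x. innerL2 \<mu> (F x) (e_fun l))"
  unfolding continuous_on_def
proof
  fix x :: real assume x: "x \<in> {0..1}"
  have FL: "F t \<in> L2 \<mu>" if "t \<in> {0..1}" for t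
    using F that by (simp add: continuous_representative_def)
  have lim: "((\<lambda>t. normL2 \<mu> (\<lambda>y. F t y - F x y)) \<longlongrightarrow> 0) (at x within {0..1})"
    using F x by (simp add: continuous_representative_def)
  show "((\<lambda>x. innerL2 \<mu> (F x) (e_fun l)) \<longlongrightarrow> innerL2 \<mu> (F x) (e_fun l)) (at x within {0..1})"
  proof (rule LIM_zero_cancel, rule Lim_null_comparison[OF _ lim])
    have "cmod (innerL2 \<mu> (F t) (e_fun l) - innerL2 \<mu> (F x) (e_fun l)) \<le> normL2 \<mu> (\<lambda>y. F t y - F x y)"
      if t: "t \<in> {0..1}" for t
      using Cauchy_Schwarz[OF L2_diff[OF FL[OF t] FL[OF x]] e_L2[OF l]]
      unfolding innerL2_diff_left[OF FL[OF t] FL[OF x] e_L2[OF l]] norm_e[OF l] by simp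
    then show "\<forall>\<^sub>F t in at x within {0..1}. cmod (innerL2 \<mu> (F t) (e_fun l) - innerL2 \<mu> (F x) (e_fun l))
        \<le> normL2 \<mu> (\<lambda>y. F t y - F x y)"
      by (auto simp: eventually_at_filter)
  qed
qed

text \<open>Replacing e_l by e(-t) U e_l lets unitarity cancel \<open>U\<close> on both sides, which
  gives the action of the adjoint on e_l without introducing an adjoint.\<close>

lemma inner_unitary_eigen:
  assumes unitary: "unitary_map \<mu> U" and eigen: "eqL2 \<mu> (U (e_fun l)) (\<lambda>y. ee t * e_fun l y)"
    and v: "v \<in> L2 \<mu>" and l: "l \<in> \<Lambda>"
  shows "innerL2 \<mu> (U v) (e_fun l) = ee t * innerL2 \<mu> v (e_fun l)"
proof -
  note el = e_L2[OF l]
  have UL: "U v \<in> L2 \<mu>" using unitary v by (simp add: unitary_map_def linear_map_def)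
  have "eqL2 \<mu> (e_fun l) (\<lambda>y. ee (- t) * U (e_fun l) y)"
    using eigen unfolding eqL2_def by eventually_elim (simp add: mult.assoc[symmetric])
  moreover have "U (e_fun l) \<in> L2 \<mu>" using unitary el by (simp add: unitary_map_def linear_map_def)
  ultimately have "innerL2 \<mu> (U v) (e_fun l) = innerL2 \<mu> (U v) (\<lambda>y. ee (- t) * U (e_fun l) y)"
    by (intro innerL2_cong UL el L2_cmult eqL2_refl)
  also have "\<dots> = ee t * innerL2 \<mu> (U v) (U (e_fun l))"
    by (simp add: innerL2_cmult_right cnj_ee)
  also have "innerL2 \<mu> (U v) (U (e_fun l)) = innerL2 \<mu> v (e_fun l)"
    using unitary v el by (simp add: unitary_map_def)
  finally show ?thesis .
qed

text \<open>Pairing with e_l in the second variable leaves a scalar weak derivative on (0,1) with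
  boundary condition p 1 = e(\<theta> l) p 0; the integer \<open>n\<close> does not affect it
  because e(n) = 1.\<close>

lemma P_op_subset_diag_op:
  assumes unitary: "unitary_map \<mu> U"
    and eigen: "\<And>l. l \<in> \<Lambda> \<Longrightarrow> eqL2 \<mu> (U (e_fun l)) (\<lambda>y. ee (\<theta> l) * e_fun l y)"
  shows "P_op \<mu> U \<subseteq> diag_op (HH \<mu>) (UNIV \<times> \<Lambda>) (product_basis \<theta>) (\<lambda>(n, l). \<theta> l + of_int n)"
proof (intro subrelI)
  fix f g assume "(f, g) \<in> P_op \<mu> U"
  then obtain f' F where f: "f \<in> L2 (HH \<mu>)" and g: "g \<in> L2 (HH \<mu>)" and f': "f' \<in> L2 (HH \<mu>)"
    and dist: "distributional_derivative \<mu> f f'" and F: "continuous_representative \<mu> f F"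
    and bc: "eqL2 \<mu> (F 1) (U (F 0))" and gf': "eqL2 (HH \<mu>) g (\<lambda>z. 1 / (\<i> * 2 * of_real pi) * f' z)"
    unfolding P_op_def by blast
  have FL: "F t \<in> L2 \<mu>" if "t \<in> {0..1}" for t
    using F that by (simp add: continuous_representative_def)
  have UL: "U v \<in> L2 \<mu>" if "v \<in> L2 \<mu>" for v
    using unitary that by (simp add: unitary_map_def linear_map_def)
  have one: "(\<lambda>x. 1) \<in> L2 unit_interval" by (rule continuous_L2) (intro continuous_intros)
  have "innerL2 (HH \<mu>) g (product_basis \<theta> (n, l)) = of_real (\<theta> l + of_int n) * innerL2 (HH \<mu>) f (product_basis \<theta> (n, l))"
    if l: "l \<in> \<Lambda>" for n l
  proof -
    define a where "a = \<theta> l + of_int n"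
    note el = e_L2[OF l]
    define q where "q x = (LINT y|\<mu>. f' (x, y) * cnj (e_fun l y))" for x
    define p where "p x = innerL2 \<mu> (F x) (e_fun l)" for x
    have q: "integrable unit_interval q"
      using inner_HH_tensor_fst(2)[OF f' one el] by (simp add: q_def[abs_def])
    have p: "continuous_on {0..1} p"
      unfolding p_def[abs_def] by (rule continuous_coefficient[OF F l])
    have "AE x in unit_interval. eqL2 \<mu> (\<lambda>y. f (x, y)) (F x)"
      using F by (simp add: continuous_representative_def)
    then have fp: "AE x in unit_interval. (LINT y|\<mu>. f (x, y) * cnj (e_fun l y)) = p x"
    proof (rule AE_mp, intro AE_I2 impI)
      fix x assume x: "x \<in> space unit_interval" and eq: "eqL2 \<mu> (\<lambda>y. f (x, y)) (F x)"
      have m: "(\<lambda>y. f (x, y)) \<in> borel_measurable \<mu>"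
        by (rule measurable_Pair2[OF HH_D[OF f] x])
      have "F x \<in> L2 \<mu>" using x by (intro FL) simp
      then have "(\<lambda>y. f (x, y)) \<in> L2 \<mu>" using L2_cong[OF _ m eqL2_sym[OF eq]] by blast
      then have "innerL2 \<mu> (\<lambda>y. f (x, y)) (e_fun l) = innerL2 \<mu> (F x) (e_fun l)"
        using \<open>F x \<in> L2 \<mu>\<close> eq el by (intro innerL2_cong) auto
      then show "(LINT y|\<mu>. f (x, y) * cnj (e_fun l y)) = p x" by (simp add: innerL2_def p_def)
    qed
    \<comment> \<open>Under an integral in \<open>x\<close> the section of \<open>f\<close> may be
      replaced by the continuous representative, whose coefficient \<open>p\<close> has meaningful
      values at 0 and 1.\<close>
    have fpw: "(LINT x|unit_interval. (LINT y|\<mu>. f (x, y) * cnj (e_fun l y)) * cnj (w x)) = (LINT x|unit_interval. p x * cnj (w x))"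
      if w: "w \<in> L2 unit_interval" for w
    proof (rule integral_cong_AE)
      show "AE x in unit_interval. (LINT y|\<mu>. f (x, y) * cnj (e_fun l y)) * cnj (w x) = p x * cnj (w x)"
        using fp by eventually_elim simp
      show "(\<lambda>x. (LINT y|\<mu>. f (x, y) * cnj (e_fun l y)) * cnj (w x)) \<in> borel_measurable unit_interval"
        using inner_HH_tensor_fst(2)[OF f w el] by auto
      show "(\<lambda>x. p x * cnj (w x)) \<in> borel_measurable unit_interval"
        using L2_inner_integrable[OF continuous_L2[OF p] w] by auto
    qed
    \<comment> \<open>The given equation holds in L2(\<mu>) after integration in \<open>x\<close>;
      pairing it with e_l and exchanging the order of integration yields the scalar one.\<close>
    have weak: "(LINT x|unit_interval. of_real (\<phi> x) * q x) = - (LINT x|unit_interval. of_real (deriv \<phi> x) * p x)"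
      if \<phi>: "test_function \<phi>" for \<phi>
    proof -
      let ?w = "\<lambda>x. complex_of_real (\<phi> x)" and ?w' = "\<lambda>x. complex_of_real (deriv \<phi> x)"
      have w: "?w \<in> L2 unit_interval" and w': "?w' \<in> L2 unit_interval"
        by (intro continuous_L2 continuous_on_of_real test_function_facts[OF \<phi>])+
      have "(LINT x|unit_interval. of_real (\<phi> x) * q x) = innerL2 (HH \<mu>) f' (tensor ?w (e_fun l))"
        unfolding inner_HH_tensor_fst(1)[OF f' w el] by (simp add: q_def mult.commute)
      also have "\<dots> = innerL2 \<mu> (\<lambda>y. LINT x|unit_interval. f' (x, y) * cnj (?w x)) (e_fun l)"
        unfolding inner_HH_tensor_snd[OF f' w el] by (simp add: innerL2_def)
      also have "\<dots> = innerL2 \<mu> (\<lambda>y. - 1 * (LINT x|unit_interval. f (x, y) * cnj (?w' x))) (e_fun l)"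
      proof (intro innerL2_cong partial_integral_L2(1) f' w el L2_cmult f w' eqL2_refl)
        have "eqL2 \<mu> (\<lambda>y. LINT x|unit_interval. of_real (\<phi> x) * f' (x, y))
          (\<lambda>y. - (LINT x|unit_interval. of_real (deriv \<phi> x) * f (x, y)))"
          using dist \<phi> by (simp add: distributional_derivative_def)
        then show "eqL2 \<mu> (\<lambda>y. LINT x|unit_interval. f' (x, y) * cnj (?w x))
          (\<lambda>y. - 1 * (LINT x|unit_interval. f (x, y) * cnj (?w' x)))"
          by (simp add: mult.commute)
      qed
      also have "\<dots> = - innerL2 (HH \<mu>) f (tensor ?w' (e_fun l))"
        unfolding innerL2_cmult_left inner_HH_tensor_snd[OF f w' el] by (simp add: innerL2_def)
      also have "\<dots> = - (LINT x|unit_interval. p x * cnj (?w' x))"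
        unfolding inner_HH_tensor_fst(1)[OF f w' el] fpw[OF w'] ..
      finally show ?thesis by (simp add: mult.commute)
    qed
    have boundary: "p 1 = ee a * p 0"
    proof -
      have F0: "F 0 \<in> L2 \<mu>" and F1: "F 1 \<in> L2 \<mu>" by (auto intro: FL)
      have "innerL2 \<mu> (F 1) (e_fun l) = innerL2 \<mu> (U (F 0)) (e_fun l)"
        by (intro innerL2_cong F1 UL F0 el bc eqL2_refl)
      also have "\<dots> = ee (\<theta> l) * innerL2 \<mu> (F 0) (e_fun l)"
        by (rule inner_unitary_eigen[OF unitary eigen[OF l] F0 l])
      finally show ?thesis by (simp add: p_def a_def ee_add)
    qed
    have "innerL2 (HH \<mu>) f' (product_basis \<theta> (n, l)) = (LINT x|unit_interval. q x * cnj (ee (a * x)))"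
      by (simp add: product_basis_def inner_HH_tensor_fst(1)[OF f' ee_L2 el] q_def a_def)
    also have "\<dots> = \<i> * 2 * of_real pi * of_real a * (LINT x|unit_interval. p x * cnj (ee (a * x)))"
      by (rule weak_derivative_coefficient[OF q p weak boundary])
    also have "(LINT x|unit_interval. p x * cnj (ee (a * x))) = innerL2 (HH \<mu>) f (product_basis \<theta> (n, l))"
      by (simp add: product_basis_def inner_HH_tensor_fst(1)[OF f ee_L2 el] a_def fpw[OF ee_L2])
    finally have *: "innerL2 (HH \<mu>) f' (product_basis \<theta> (n, l)) =
      \<i> * 2 * of_real pi * of_real a * innerL2 (HH \<mu>) f (product_basis \<theta> (n, l))" .
    have "innerL2 (HH \<mu>) g (product_basis \<theta> (n, l)) =
        innerL2 (HH \<mu>) (\<lambda>z. 1 / (\<i> * 2 * of_real pi) * f' z) (product_basis \<theta> (n, l))"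
      using l by (intro innerL2_cong g L2_cmult f' gf' eqL2_refl orthonormal_L2[OF product_basis_orthonormal]) auto
    also have "\<dots> = of_real a * innerL2 (HH \<mu>) f (product_basis \<theta> (n, l))"
      unfolding innerL2_cmult_left * by simp
    finally show ?thesis by (simp add: a_def)
  qed
  then show "(f, g) \<in> diag_op (HH \<mu>) (UNIV \<times> \<Lambda>) (product_basis \<theta>) (\<lambda>(n, l). \<theta> l + of_int n)"
    using f g by (auto simp: diag_op_def)
qed

section \<open>From commutation to eigenfunctions\<close>

lemma affine_section_in_P_op:
  assumes e: "e \<in> L2 \<mu>" and v: "v \<in> L2 \<mu>" and Ue: "eqL2 \<mu> v (U e)"
  shows "\<exists>g. (\<lambda>(x, y). of_real (1 - x) * e y + of_real x * v y, g) \<in> P_op \<mu> U"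
proof -
  define f where "f = (\<lambda>(x, y). complex_of_real (1 - x) * e y + complex_of_real x * v y)"
  define f' where "f' = (\<lambda>z. tensor (\<lambda>x. 1) v z - tensor (\<lambda>x. 1) e z)"
  define F where "F x = (\<lambda>y. complex_of_real (1 - x) * e y + complex_of_real x * v y)" for x
  have L: "(\<lambda>x. 1) \<in> L2 unit_interval" "(\<lambda>x. of_real (1 - x)) \<in> L2 unit_interval" "(\<lambda>x. of_real x) \<in> L2 unit_interval"
    by (intro continuous_L2 continuous_intros)+
  have "f = (\<lambda>z. tensor (\<lambda>x. of_real (1 - x)) e z + tensor (\<lambda>x. of_real x) v z)"
    by (auto simp: f_def tensor_def)
  then have f: "f \<in> L2 (HH \<mu>)" using L e v by (simp only:) (intro L2_add tensor_L2)
  have f': "f' \<in> L2 (HH \<mu>)" unfolding f'_def by (intro L2_diff tensor_L2 L e v)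
  have dist: "distributional_derivative \<mu> f f'"
    unfolding distributional_derivative_def
  proof (intro allI impI)
    fix \<phi> assume \<phi>: "test_function \<phi>"
    have "(LINT x|unit_interval. of_real (\<phi> x) * f' (x, y)) = - (LINT x|unit_interval. of_real (deriv \<phi> x) * f (x, y))" for y
    proof -
      let ?G = "\<lambda>x. of_real (\<phi> x) * F x y"
      let ?h1 = "\<lambda>x. of_real (\<phi> x) * (v y - e y)" and ?h2 = "\<lambda>x. of_real (deriv \<phi> x) * F x y"
      have Fc: "continuous_on {0..1} (\<lambda>x. F x y)" unfolding F_def by (intro continuous_intros)
      have h1: "continuous_on {0..1} ?h1" and h2: "continuous_on {0..1} ?h2"
        by (intro continuous_intros continuous_on_of_real test_function_facts[OF \<phi>] Fc)+
      have "(LINT x|unit_interval. ?h1 x + ?h2 x) = ?G 1 - ?G 0"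
      proof (rule integral_unit_interval_FTC)
        fix x :: real
        have D: "(\<phi> has_real_derivative deriv \<phi> x) (at x within {0..1})"
          by (rule has_field_derivative_at_within[OF test_function_facts(1)[OF \<phi>]])
        have "((\<lambda>x. F x y) has_vector_derivative (v y - e y)) (at x within {0..1})"
          unfolding F_def by (auto intro!: derivative_eq_intros)
        from has_vector_derivative_mult[OF has_vector_derivative_of_real[OF D] this]
        show "(?G has_vector_derivative ?h1 x + ?h2 x) (at x within {0..1})" by simp
      qed (intro continuous_intros h1 h2)
      also have "\<dots> = 0" using test_function_facts(4,5)[OF \<phi>] by simp
      also have "(LINT x|unit_interval. ?h1 x + ?h2 x) = (LINT x|unit_interval. ?h1 x) + (LINT x|unit_interval. ?h2 x)"
        by (intro Bochner_Integration.integral_add continuous_unit_interval_integrable h1 h2)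
      finally show ?thesis by (simp add: f_def f'_def F_def tensor_def add_eq_0_iff)
    qed
    then show "eqL2 \<mu> (\<lambda>y. LINT x|unit_interval. of_real (\<phi> x) * f' (x, y))
      (\<lambda>y. - (LINT x|unit_interval. of_real (deriv \<phi> x) * f (x, y)))" by simp
  qed
  have cont: "continuous_representative \<mu> f F"
    unfolding continuous_representative_def
  proof (intro conjI ballI)
    fix x :: real
    show "F x \<in> L2 \<mu>" unfolding F_def by (intro L2_add L2_cmult e v)
    have "normL2 \<mu> (\<lambda>y. F t y - F x y) = \<bar>t - x\<bar> * normL2 \<mu> (\<lambda>y. v y - e y)" for t
    proof -
      have "(\<lambda>y. F t y - F x y) = (\<lambda>y. of_real (t - x) * (v y - e y))" by (simp add: F_def algebra_simps)
      then show ?thesis by (simp only: normL2_cmult norm_of_real)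
    qed
    moreover have "((\<lambda>t. \<bar>t - x\<bar> * normL2 \<mu> (\<lambda>y. v y - e y)) \<longlongrightarrow> \<bar>x - x\<bar> * normL2 \<mu> (\<lambda>y. v y - e y)) (at x within {0..1})"
      by (intro tendsto_intros)
    ultimately show "((\<lambda>t. normL2 \<mu> (\<lambda>y. F t y - F x y)) \<longlongrightarrow> 0) (at x within {0..1})" by simp
  next
    show "AE x in unit_interval. eqL2 \<mu> (\<lambda>y. f (x, y)) (F x)" by (simp add: f_def F_def)
  qed
  have "F 0 = e" "F 1 = v" by (simp_all add: F_def)
  then have bc: "eqL2 \<mu> (F 1) (U (F 0))" using Ue by simp
  have "(f, \<lambda>z. 1 / (\<i> * 2 * of_real pi) * f' z) \<in> P_op \<mu> U"
    unfolding P_op_def mem_Collect_eq prod.case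
    using f f' dist cont bc L2_cmult[OF f'] eqL2_refl by blast
  then show ?thesis unfolding f_def by blast
qed

lemma eigenfunction_if_commute:
  assumes unitary: "unitary_map \<mu> U"
    and comm: "operators_commute (HH \<mu>) (P_op \<mu> U) (Q_op \<mu> \<Lambda>)" and l: "l \<in> \<Lambda>"
  shows "eigenfunction \<mu> U (e_fun l)"
proof -
  obtain E F where E: "spectral_measure (HH \<mu>) (P_op \<mu> U) E" and F: "spectral_measure (HH \<mu>) (Q_op \<mu> \<Lambda>) F"
    and EF: "\<And>S T f. S \<in> sets borel \<Longrightarrow> T \<in> sets borel \<Longrightarrow> f \<in> L2 (HH \<mu>) \<Longrightarrow> eqL2 (HH \<mu>) (E S (F T f)) (F T (E S f))"
    using comm unfolding operators_commute_def by blast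
  have pvmF: "projection_valued_measure (HH \<mu>) F" using F by (simp add: spectral_measure_def)
  have sl: "{m} \<in> sets borel" for m :: real by simp
  define e where "e = e_fun l"
  have e: "e \<in> L2 \<mu>" unfolding e_def by (rule e_L2[OF l])
  define v where "v = U e"
  have linU: "linear_map \<mu> U" using unitary by (simp add: unitary_map_def)
  have v: "v \<in> L2 \<mu>" using linU e by (simp add: v_def linear_map_def)
  define c where "c = innerL2 \<mu> v e"
  define f where "f = (\<lambda>(x, y). complex_of_real (1 - x) * e y + complex_of_real x * v y)"
  define s where "s x = complex_of_real (1 - x) + c * complex_of_real x" for x
  have L: "(\<lambda>x. of_real (1 - x)) \<in> L2 unit_interval" "(\<lambda>x. of_real x) \<in> L2 unit_interval"
    by (intro continuous_L2 continuous_intros)+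
  have sL: "s \<in> L2 unit_interval" unfolding s_def[abs_def] by (intro continuous_L2 continuous_intros)
  have f_eq: "f = (\<lambda>z. tensor (\<lambda>x. of_real (1 - x)) e z + tensor (\<lambda>x. of_real x) v z)"
    by (auto simp: f_def tensor_def)
  have fL: "f \<in> L2 (HH \<mu>)" unfolding f_eq by (intro L2_add tensor_L2 L e v)
  have fixed: "eqL2 (HH \<mu>) (F {m} (tensor w (e_fun m))) (tensor w (e_fun m))"
    if "w \<in> L2 unit_interval" "m \<in> \<Lambda>" for w m
    by (rule spectral_measure_eigenvector[OF F Q_tensor[OF that]]) (rule inner_Q[OF _ that])
  have killed: "eqL2 (HH \<mu>) (F {l} (tensor w (e_fun m))) (\<lambda>z. 0)"
    if w: "w \<in> L2 unit_interval" and m: "m \<in> \<Lambda>" "m \<noteq> l" for w m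
  proof -
    have t: "tensor w (e_fun m) \<in> L2 (HH \<mu>)" by (intro tensor_L2 w e_L2 m)
    have "eqL2 (HH \<mu>) (F {l} (tensor w (e_fun m))) (F {l} (F {m} (tensor w (e_fun m))))"
      by (intro pvm_cong[OF pvmF] sl t pvm_L2[OF pvmF] eqL2_sym[OF fixed[OF w m(1)]])
    also have "eqL2 (HH \<mu>) (F {l} (F {m} (tensor w (e_fun m)))) (F ({l} \<inter> {m}) (tensor w (e_fun m)))"
      by (intro eqL2_sym[OF pvm_Int[OF pvmF]] sl t)
    also have "{l} \<inter> {m} = {}" using m by simp
    also have "eqL2 (HH \<mu>) (F {} (tensor w (e_fun m))) (\<lambda>z. 0)" by (rule pvm_empty[OF pvmF t])
    finally show ?thesis .
  qed
  have Tf: "F {l} f \<in> L2 (HH \<mu>)" by (intro pvm_L2[OF pvmF] sl fL)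
  have sT: "tensor s e \<in> L2 (HH \<mu>)" by (intro tensor_L2 sL e)
  \<comment> \<open>\<open>F {l}\<close> is known on basis elements only, and selfadjointness moves
    it there; \<theta> = 0 gives a convenient basis.\<close>
  have proj: "eqL2 (HH \<mu>) (F {l} f) (tensor s e)"
  proof (rule onb_eqI[OF product_basis_onb[of "\<lambda>_. 0"] Tf sT])
    fix i :: "int \<times> real" assume "i \<in> UNIV \<times> \<Lambda>"
    then obtain n m where i: "i = (n, m)" and m: "m \<in> \<Lambda>" by auto
    let ?w = "\<lambda>x. ee ((0 + of_int n) * x)"
    have w: "?w \<in> L2 unit_interval" by (rule ee_L2)
    have t: "tensor ?w (e_fun m) \<in> L2 (HH \<mu>)" by (intro tensor_L2 w e_L2 m)
    have 1: "innerL2 (HH \<mu>) (F {l} f) (tensor ?w (e_fun m)) = innerL2 (HH \<mu>) f (F {l} (tensor ?w (e_fun m)))"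
      by (rule pvm_selfadjoint[OF pvmF sl fL t])
    have "innerL2 (HH \<mu>) f (F {l} (tensor ?w (e_fun m))) = innerL2 (HH \<mu>) (tensor s e) (tensor ?w (e_fun m))"
    proof (cases "m = l")
      case True
      have ee: "innerL2 \<mu> e e = 1" using onb l by (simp add: orthonormal_basis_def e_def)
      have "innerL2 (HH \<mu>) f (F {l} (tensor ?w (e_fun m))) = innerL2 (HH \<mu>) f (tensor ?w e)"
        using fixed[OF w l] True unfolding e_def
        by (intro innerL2_cong fL pvm_L2[OF pvmF] sl tensor_L2 w e_L2 m l) auto
      also have "\<dots> = innerL2 unit_interval (\<lambda>x. of_real (1 - x)) ?w * 1 + innerL2 unit_interval (\<lambda>x. of_real x) ?w * c"
        unfolding f_eq c_def ee[symmetric] inner_tensor[OF L(1) e w e, symmetric] inner_tensor[OF L(2) v w e, symmetric]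
        by (intro innerL2_add_left tensor_L2 L e v w)
      also have "\<dots> = innerL2 unit_interval s ?w"
      proof -
        have "innerL2 unit_interval s ?w = innerL2 unit_interval (\<lambda>x. of_real (1 - x)) ?w + innerL2 unit_interval (\<lambda>x. c * of_real x) ?w"
          unfolding s_def[abs_def] by (intro innerL2_add_left L2_cmult L w)
        then show ?thesis by (simp add: innerL2_cmult_left mult.commute)
      qed
      also have "\<dots> = innerL2 (HH \<mu>) (tensor s e) (tensor ?w e)"
        unfolding inner_tensor[OF sL e w e] ee by simp
      finally show ?thesis using True by (simp add: e_def)
    next
      case False
      have "innerL2 (HH \<mu>) f (F {l} (tensor ?w (e_fun m))) = innerL2 (HH \<mu>) f (\<lambda>z. 0)"
        by (intro innerL2_cong fL pvm_L2[OF pvmF] sl t L2_zero eqL2_refl killed w m False)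
      moreover have "innerL2 \<mu> e (e_fun m) = 0"
        using onb l m False by (auto simp: orthonormal_basis_def e_def)
      ultimately show ?thesis unfolding inner_tensor[OF sL e w e_L2[OF m]] by simp
    qed
    then show "innerL2 (HH \<mu>) (F {l} f) (product_basis (\<lambda>_. 0) i) = innerL2 (HH \<mu>) (tensor s e) (product_basis (\<lambda>_. 0) i)"
      unfolding i product_basis_def prod.case 1 .
  qed
  obtain g where g: "(f, g) \<in> P_op \<mu> U"
    using affine_section_in_P_op[OF e v, of U] unfolding v_def f_def by auto
  obtain g' where "(F {l} f, g') \<in> P_op \<mu> U"
    using domain_invariant[OF E pvm_projection[OF pvmF sl] _ g, of l] EF sl by blast
  then obtain G where G: "continuous_representative \<mu> (F {l} f) G" and bc: "eqL2 \<mu> (G 1) (U (G 0))"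
    unfolding P_op_def by blast
  have GL: "G t \<in> L2 \<mu>" if "t \<in> {0..1}" for t
    using G that by (simp add: continuous_representative_def)
  have se: "(\<lambda>y. s x * e y) \<in> L2 \<mu>" for x by (rule L2_cmult[OF e])
  have "AE x in unit_interval. eqL2 \<mu> (\<lambda>y. F {l} f (x, y)) (G x)"
    using G by (simp add: continuous_representative_def)
  moreover have "AE x in unit_interval. AE y in \<mu>. F {l} f (x, y) = tensor s e (x, y)"
    using AE_HH_fst proj unfolding eqL2_def by blast
  ultimately have ae: "AE x in unit_interval. eqL2 \<mu> (G x) (\<lambda>y. s x * e y)"
  proof eventually_elim
    case (elim x)
    have "eqL2 \<mu> (\<lambda>y. F {l} f (x, y)) (\<lambda>y. s x * e y)" using elim(2) by (simp add: eqL2_def tensor_def)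
    then show ?case using elim(1) eqL2_sym eqL2_trans by blast
  qed
  \<comment> \<open>The boundary condition concerns the continuous representative \<open>G\<close>,
    tied to the explicit function \<open>s x * e y\<close> only for almost all \<open>x\<close>;
    both depend continuously on \<open>x\<close>, so the identity extends to 0 and 1.\<close>
  have G_eq: "eqL2 \<mu> (G a) (\<lambda>y. s a * e y)" if a: "a \<in> {0..1}" for a
  proof -
    have "normL2 \<mu> (\<lambda>y. G a y - s a * e y) \<le> 0"
    proof (rule field_le_epsilon)
      fix \<epsilon> :: real assume \<epsilon>: "\<epsilon> > 0"
      have "((\<lambda>t. normL2 \<mu> (\<lambda>y. G t y - G a y) + cmod (s t - s a) * normL2 \<mu> e) \<longlongrightarrow> 0 + cmod (s a - s a) * normL2 \<mu> e) (at a within {0..1})"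
      proof (intro tendsto_intros)
        show "((\<lambda>t. normL2 \<mu> (\<lambda>y. G t y - G a y)) \<longlongrightarrow> 0) (at a within {0..1})"
          using G a by (simp add: continuous_representative_def)
        show "(s \<longlongrightarrow> s a) (at a within {0..1})" unfolding s_def by (intro tendsto_intros)
      qed
      then have "\<forall>\<^sub>F t in at a within {0..1}. normL2 \<mu> (\<lambda>y. G t y - G a y) + cmod (s t - s a) * normL2 \<mu> e < \<epsilon>"
        using order_tendstoD(2)[of _ _ _ \<epsilon>] \<epsilon> by simp
      then obtain d where d: "d > 0" and close: "\<And>t. t \<in> {0..1} \<Longrightarrow> t \<noteq> a \<Longrightarrow> dist t a < d \<Longrightarrow>
          normL2 \<mu> (\<lambda>y. G t y - G a y) + cmod (s t - s a) * normL2 \<mu> e < \<epsilon>"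
        unfolding eventually_at by blast
      \<comment> \<open>A nearby point of agreement is sought to the right of \<open>a\<close>, or
        to the left if \<open>a\<close> is 1.\<close>
      have "\<exists>t. t \<in> {0..1} \<and> t \<noteq> a \<and> dist t a < d \<and> eqL2 \<mu> (G t) (\<lambda>y. s t * e y)"
      proof (cases "a < 1")
        case True
        then obtain t where "a < t" "t < min 1 (a + d)" "eqL2 \<mu> (G t) (\<lambda>y. s t * e y)"
          using unit_interval_AE_dense[OF ae, of a "min 1 (a + d)"] a d by auto
        then show ?thesis using a by (intro exI[of _ t]) (auto simp: dist_real_def)
      next
        case False
        then obtain t where "max 0 (a - d) < t" "t < a" "eqL2 \<mu> (G t) (\<lambda>y. s t * e y)"
          using unit_interval_AE_dense[OF ae, of "max 0 (a - d)" a] a d by auto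
        then show ?thesis using a by (intro exI[of _ t]) (auto simp: dist_real_def)
      qed
      then obtain t where t: "t \<in> {0..1}" "t \<noteq> a" "dist t a < d" "eqL2 \<mu> (G t) (\<lambda>y. s t * e y)" by blast
      have "normL2 \<mu> (\<lambda>y. G a y - s a * e y) \<le> normL2 \<mu> (\<lambda>y. G a y - G t y) + normL2 \<mu> (\<lambda>y. G t y - s a * e y)"
        by (intro normL2_triangle_diff GL a t se)
      also have "normL2 \<mu> (\<lambda>y. G t y - s a * e y) = normL2 \<mu> (\<lambda>y. (s t - s a) * e y)"
        using t(4) by (intro normL2_cong L2_diff GL t se L2_cmult e) (auto simp: eqL2_def left_diff_distrib elim!: eventually_mono)
      also have "\<dots> = cmod (s t - s a) * normL2 \<mu> e" by (rule normL2_cmult)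
      also have "normL2 \<mu> (\<lambda>y. G a y - G t y) = normL2 \<mu> (\<lambda>y. G t y - G a y)" by (rule normL2_minus_commute)
      also have "normL2 \<mu> (\<lambda>y. G t y - G a y) + cmod (s t - s a) * normL2 \<mu> e \<le> 0 + \<epsilon>"
        using close[OF t(1-3)] by simp
      finally show "normL2 \<mu> (\<lambda>y. G a y - s a * e y) \<le> 0 + \<epsilon>" .
    qed
    then have "normL2 \<mu> (\<lambda>y. G a y - s a * e y) = 0" by (intro antisym) simp_all
    then show ?thesis using eqL2_iff_norm_diff[OF GL[OF a] se] by simp
  qed
  have G0: "eqL2 \<mu> (G 0) e" using G_eq[of 0] by (simp add: s_def)
  have G1: "eqL2 \<mu> (G 1) (\<lambda>y. c * e y)" using G_eq[of 1] by (simp add: s_def)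
  have "eqL2 \<mu> (U e) (U (G 0))"
    using linU e GL[of 0] eqL2_sym[OF G0] by (simp add: linear_map_def)
  then have "eqL2 \<mu> (U e) (\<lambda>y. c * e y)"
    using eqL2_sym[OF bc] G1 eqL2_trans by blast
  moreover have "\<not> eqL2 \<mu> e (\<lambda>y. 0)"
    using normL2_eq_0_iff[OF e] norm_e[OF l] by (simp add: e_def)
  ultimately show ?thesis using e unfolding eigenfunction_def e_def by blast
qed

end

section \<open>Selfadjointness of P by solving the resolvent equation\<close>

text \<open>As an element of \<open>L2 unit_interval\<close> this kernel turns the primitive of
  exp(-2 pi t) k(t, y) into a partial integral, so that norm estimates for primitives reduce to
  norms of kernels.\<close>

definition damped_indicator :: "real \<Rightarrow> real \<Rightarrow> complex" where
  "damped_indicator x t = of_real (indicator {0..x} t * exp (- 2 * pi * t))"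

lemma damped_indicator_measurable: "damped_indicator x \<in> borel_measurable unit_interval"
  unfolding damped_indicator_def by (rule measurable_unit_interval) measurable

lemma norm_damped_indicator_diff:
  assumes "0 \<le> t" shows "(cmod (damped_indicator x t - damped_indicator x' t))\<^sup>2 \<le> indicator {min x x'..max x x'} t"
proof -
  have e: "exp (- 2 * pi * t) \<le> 1" using assms by simp
  have "cmod (damped_indicator x t - damped_indicator x' t) = \<bar>indicator {0..x} t - indicator {0..x'} t\<bar> * exp (- 2 * pi * t)"
    unfolding damped_indicator_def of_real_diff[symmetric] norm_of_real left_diff_distrib[symmetric] abs_mult by simp
  also have "\<dots> \<le> \<bar>indicator {0..x} t - indicator {0..x'} t\<bar>" using e by (simp add: mult_left_le)
  also have "\<dots> \<le> indicator {min x x'..max x x'} t" using assms by (auto simp: indicator_def)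
  finally have "(cmod (damped_indicator x t - damped_indicator x' t))\<^sup>2 \<le> (indicator {min x x'..max x x'} t)\<^sup>2"
    by (rule power_mono) simp
  then show ?thesis by (cases "t \<in> {min x x'..max x x'}") (simp_all add: power_le_one)
qed

lemma damped_indicator_L2: "damped_indicator x \<in> L2 unit_interval"
proof (rule UI.L2_bounded[OF damped_indicator_measurable])
  fix t assume "t \<in> space unit_interval"
  then have "exp (- 2 * pi * t) \<le> 1" by simp
  then show "cmod (damped_indicator x t) \<le> 1" unfolding damped_indicator_def norm_of_real by (auto simp: indicator_def)
qed

text \<open>The two kernels differ by at most 1, and only on an interval of length |x - x'|. The
  damped primitive is accordingly Hoelder continuous of order 1/2 in norm.\<close>

lemma norm_damped_indicator_diff_le:
  assumes "x \<in> {0..1}" "x' \<in> {0..1}"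
  shows "normL2 unit_interval (\<lambda>t. damped_indicator x t - damped_indicator x' t) \<le> sqrt \<bar>x - x'\<bar>"
proof -
  let ?I = "indicator {min x x'..max x x'} :: real \<Rightarrow> real"
  have I: "integrable unit_interval ?I"
  proof (rule UI.integrable_const_bound[where B = 1])
    have "{min x x'..max x x'} \<in> sets borel" by simp
    then show "?I \<in> borel_measurable unit_interval"
      by (rule measurable_unit_interval[OF borel_measurable_indicator])
  qed (simp add: indicator_def)
  have "(LINT t|unit_interval. (cmod (damped_indicator x t - damped_indicator x' t))\<^sup>2) \<le> (LINT t|unit_interval. ?I t)"
    using norm_damped_indicator_diff L2_D(2)[OF L2_diff[OF damped_indicator_L2 damped_indicator_L2]] I by (intro integral_mono) auto
  also have "\<dots> = (LINT t|lborel. ?I t)"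
    unfolding integral_unit_interval set_lebesgue_integral_def
    using assms by (intro Bochner_Integration.integral_cong) (auto simp: indicator_def)
  also have "\<dots> = \<bar>x - x'\<bar>" by (auto simp: min_def max_def)
  finally show ?thesis unfolding normL2_def by (rule real_sqrt_le_mono)
qed

lemma norm_damped_indicator_0: "normL2 unit_interval (damped_indicator 0) = 0"
proof -
  have "damped_indicator 0 t = 0" if "t \<noteq> 0" for t using that by (simp add: damped_indicator_def)
  moreover have "AE t in unit_interval. t \<noteq> 0"
    unfolding unit_interval_def by (subst AE_restrict_space_iff) (use AE_lborel_singleton[of "0::real"] in \<open>auto elim: eventually_mono\<close>)
  ultimately have "eqL2 unit_interval (damped_indicator 0) (\<lambda>t. 0)" unfolding eqL2_def by (auto elim: eventually_mono)
  then show ?thesis using normL2_eq_0_iff[OF damped_indicator_L2] by simp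
qed

lemma norm_damped_indicator_le: "x \<in> {0..1} \<Longrightarrow> normL2 unit_interval (damped_indicator x) \<le> 1"
proof -
  assume x: "x \<in> {0..1}"
  have "normL2 unit_interval (\<lambda>t. damped_indicator x t - 0) \<le>
      normL2 unit_interval (\<lambda>t. damped_indicator x t - damped_indicator 0 t) + normL2 unit_interval (\<lambda>t. damped_indicator 0 t - 0)"
    by (intro normL2_triangle_diff damped_indicator_L2 L2_zero)
  also have "\<dots> \<le> sqrt \<bar>x - 0\<bar> + 0"
    using norm_damped_indicator_diff_le[of x 0] norm_damped_indicator_0 x by simp
  also have "\<dots> \<le> 1" using x by simp
  finally show ?thesis by simp
qed

definition damped_primitive :: "(real \<times> real \<Rightarrow> complex) \<Rightarrow> real \<Rightarrow> real \<Rightarrow> complex" where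
  "damped_primitive k x y = (LINT t|unit_interval. k (t, y) * cnj (damped_indicator x t))"

text \<open>By variation of constants, \<open>resolvent k w0\<close> solves \<open>1/(2 \<pi> \<i>) w' + \<i> w = k\<close> with \<open>w 0 = w0\<close>;
  \<open>resolvent_deriv\<close> is its derivative.\<close>

definition resolvent :: "(real \<times> real \<Rightarrow> complex) \<Rightarrow> (real \<Rightarrow> complex) \<Rightarrow> real \<Rightarrow> real \<Rightarrow> complex" where
  "resolvent k w0 x y = of_real (exp (2 * pi * x)) * (w0 y + \<i> * 2 * of_real pi * damped_primitive k x y)"

definition resolvent_deriv :: "(real \<times> real \<Rightarrow> complex) \<Rightarrow> (real \<Rightarrow> complex) \<Rightarrow> real \<times> real \<Rightarrow> complex" where
  "resolvent_deriv k w0 z = \<i> * 2 * of_real pi * k z + 2 * of_real pi * (case z of (x, y) \<Rightarrow> resolvent k w0 x y)"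

context spectral_pair
begin

section \<open>The solution of the resolvent equation and its regularity\<close>

lemma exp_HH_L2:
  assumes f: "f \<in> L2 (HH \<mu>)" shows "(\<lambda>(x, y). of_real (exp (2 * pi * x)) * f (x, y)) \<in> L2 (HH \<mu>)"
proof (rule L2_bound)
  have [measurable]: "f \<in> borel_measurable (unit_interval \<Otimes>\<^sub>M \<mu>)" by (rule HH_D[OF f])
  have [measurable]: "(\<lambda>x. x) \<in> borel_measurable unit_interval" by (rule measurable_unit_interval) simp
  show "(\<lambda>(x, y). of_real (exp (2 * pi * x)) * f (x, y)) \<in> borel_measurable (HH \<mu>)"
    unfolding HH_def split_beta' prod.collapse by measurable
  show "integrable (HH \<mu>) (\<lambda>z. (exp (2 * pi))\<^sup>2 * (cmod (f z))\<^sup>2)" using L2_D(2)[OF f] by simp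
  fix z assume "z \<in> space (HH \<mu>)"
  then obtain x y where z: "z = (x, y)" and x: "x \<in> {0..1}" by (auto simp: HH_def space_pair_measure)
  have "(exp (2 * pi * x))\<^sup>2 \<le> (exp (2 * pi))\<^sup>2" using x by (intro power_mono) auto
  then have "(exp (2 * pi * x))\<^sup>2 * (cmod (f z))\<^sup>2 \<le> (exp (2 * pi))\<^sup>2 * (cmod (f z))\<^sup>2" by (rule mult_right_mono) simp
  then show "(cmod (case z of (x, y) \<Rightarrow> of_real (exp (2 * pi * x)) * f (x, y)))\<^sup>2 \<le> (exp (2 * pi))\<^sup>2 * (cmod (f z))\<^sup>2"
    unfolding z prod.case norm_mult norm_of_real by (simp add: power_mult_distrib)
qed

context
  fixes k :: "real \<times> real \<Rightarrow> complex"
  assumes k: "k \<in> L2 (HH \<mu>)"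
begin

lemma damped_primitive_L2: "damped_primitive k x \<in> L2 \<mu>" and norm_damped_primitive_le: "x \<in> {0..1} \<Longrightarrow> normL2 \<mu> (damped_primitive k x) \<le> normL2 (HH \<mu>) k"
proof -
  have 1: "normL2 \<mu> (damped_primitive k x) \<le> normL2 unit_interval (damped_indicator x) * normL2 (HH \<mu>) k"
    unfolding damped_primitive_def by (rule partial_integral_L2(2)[OF k damped_indicator_L2])
  show "damped_primitive k x \<in> L2 \<mu>" unfolding damped_primitive_def by (rule partial_integral_L2(1)[OF k damped_indicator_L2])
  assume "x \<in> {0..1}"
  then have "normL2 unit_interval (damped_indicator x) * normL2 (HH \<mu>) k \<le> 1 * normL2 (HH \<mu>) k"
    by (intro mult_right_mono norm_damped_indicator_le) auto
  with 1 show "normL2 \<mu> (damped_primitive k x) \<le> normL2 (HH \<mu>) k" by simp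
qed

lemma damped_primitive_diff:
  assumes "x \<in> {0..1}" "x' \<in> {0..1}"
  shows "normL2 \<mu> (\<lambda>y. damped_primitive k x y - damped_primitive k x' y) \<le> sqrt \<bar>x - x'\<bar> * normL2 (HH \<mu>) k"
proof -
  let ?w = "\<lambda>t. damped_indicator x t - damped_indicator x' t"
  have w: "?w \<in> L2 unit_interval" by (intro L2_diff damped_indicator_L2)
  have "eqL2 \<mu> (\<lambda>y. damped_primitive k x y - damped_primitive k x' y) (\<lambda>y. LINT t|unit_interval. k (t, y) * cnj (?w t))"
    unfolding eqL2_def using HH_section[OF k]
  proof eventually_elim
    case (elim y)
    show ?case unfolding damped_primitive_def complex_cnj_diff right_diff_distrib
      by (rule Bochner_Integration.integral_diff[OF L2_inner_integrable[OF elim damped_indicator_L2] L2_inner_integrable[OF elim damped_indicator_L2], symmetric])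
  qed
  then have "normL2 \<mu> (\<lambda>y. damped_primitive k x y - damped_primitive k x' y) = normL2 \<mu> (\<lambda>y. LINT t|unit_interval. k (t, y) * cnj (?w t))"
    by (intro normL2_cong L2_diff damped_primitive_L2 partial_integral_L2(1) k w)
  also have "\<dots> \<le> normL2 unit_interval ?w * normL2 (HH \<mu>) k" by (rule partial_integral_L2(2)[OF k w])
  also have "\<dots> \<le> sqrt \<bar>x - x'\<bar> * normL2 (HH \<mu>) k"
    by (intro mult_right_mono norm_damped_indicator_diff_le assms) auto
  finally show ?thesis .
qed

lemma damped_primitive_measurable: "(\<lambda>(x, y). damped_primitive k x y) \<in> borel_measurable (unit_interval \<Otimes>\<^sub>M \<mu>)"
proof -
  have km [measurable]: "k \<in> borel_measurable (unit_interval \<Otimes>\<^sub>M \<mu>)" by (rule HH_D[OF k])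
  have id [measurable]: "(\<lambda>x. x) \<in> borel_measurable unit_interval" by (rule measurable_unit_interval) simp
  \<comment> \<open>On the unit interval t \<ge> 0, so membership in {0..x} is the jointly
    measurable condition t \<le> x.\<close>
  have "(\<lambda>z. LINT t|unit_interval. k (t, snd z) * of_real (if t \<le> fst z then exp (- 2 * pi * t) else 0))
      \<in> borel_measurable (unit_interval \<Otimes>\<^sub>M \<mu>)"
    by measurable
  moreover have "(LINT t|unit_interval. k (t, snd z) * of_real (if t \<le> fst z then exp (- 2 * pi * t) else 0)) = damped_primitive k (fst z) (snd z)" for z
    unfolding damped_primitive_def by (intro Bochner_Integration.integral_cong refl) (auto simp: damped_indicator_def indicator_def)
  ultimately show ?thesis by (simp add: split_beta')
qed

lemma damped_primitive_HH_L2: "(\<lambda>(x, y). damped_primitive k x y) \<in> L2 (HH \<mu>)"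
proof (rule L2_I)
  note [measurable] = damped_primitive_measurable
  show "(\<lambda>(x, y). damped_primitive k x y) \<in> borel_measurable (HH \<mu>)" unfolding HH_def by measurable
  show "integrable (HH \<mu>) (\<lambda>z. (cmod (case z of (x, y) \<Rightarrow> damped_primitive k x y))\<^sup>2)"
    unfolding HH_def
  proof (rule pair.Fubini_integrable)
    show "AE x in unit_interval. integrable \<mu> (\<lambda>y. (cmod (case (x, y) of (x, y) \<Rightarrow> damped_primitive k x y))\<^sup>2)"
      using L2_D(2)[OF damped_primitive_L2] by simp
    show "integrable unit_interval (\<lambda>x. LINT y|\<mu>. norm ((cmod (case (x, y) of (x, y) \<Rightarrow> damped_primitive k x y))\<^sup>2))"
    proof (rule UI.integrable_const_bound[where B = "(normL2 (HH \<mu>) k)\<^sup>2"])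
      have "norm (LINT y|\<mu>. (cmod (damped_primitive k x y))\<^sup>2) \<le> (normL2 (HH \<mu>) k)\<^sup>2" if "x \<in> {0..1}" for x
        using power_mono[OF norm_damped_primitive_le[OF that] normL2_nonneg, of 2] by (simp add: normL2_sq)
      then show "AE x in unit_interval. norm (LINT y|\<mu>. norm ((cmod (case (x, y) of (x, y) \<Rightarrow> damped_primitive k x y))\<^sup>2)) \<le> (normL2 (HH \<mu>) k)\<^sup>2"
        by (intro AE_I2) simp
    qed measurable
  qed measurable
qed

end

context
  fixes k :: "real \<times> real \<Rightarrow> complex" and w0 :: "real \<Rightarrow> complex"
  assumes k: "k \<in> L2 (HH \<mu>)" and w0: "w0 \<in> L2 \<mu>"
begin

lemma resolvent_section_L2: "resolvent k w0 x \<in> L2 \<mu>"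
  unfolding resolvent_def by (intro L2_cmult L2_add w0 damped_primitive_L2[OF k])

lemma resolvent_HH_L2: "(\<lambda>(x, y). resolvent k w0 x y) \<in> L2 (HH \<mu>)"
proof -
  have one: "(\<lambda>x. 1) \<in> L2 unit_interval" by (rule continuous_L2) (intro continuous_intros)
  have "(\<lambda>z. tensor (\<lambda>x. 1) w0 z + \<i> * 2 * of_real pi * (case z of (x, y) \<Rightarrow> damped_primitive k x y)) \<in> L2 (HH \<mu>)"
    by (intro L2_add L2_cmult tensor_L2 one w0 damped_primitive_HH_L2[OF k])
  from exp_HH_L2[OF this] show ?thesis by (simp add: tensor_def resolvent_def)
qed

lemma resolvent_deriv_L2: "resolvent_deriv k w0 \<in> L2 (HH \<mu>)"
  unfolding resolvent_deriv_def by (intro L2_add L2_cmult k resolvent_HH_L2)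

text \<open>For almost every \<open>y\<close> the growth factor exp(2 pi x) is moved from the
  solution to the test function. The resulting \<open>H\<close> vanishes at both ends, so
  integration by parts of the primitive leaves no boundary term.\<close>

lemma resolvent_distributional_derivative: "distributional_derivative \<mu> (\<lambda>(x, y). resolvent k w0 x y) (resolvent_deriv k w0)"
  unfolding distributional_derivative_def eqL2_def
proof (intro allI impI)
  fix \<phi> assume \<phi>: "test_function \<phi>"
  note tf = test_function_facts[OF \<phi>]
  have \<phi>L: "(\<lambda>x. complex_of_real (\<phi> x)) \<in> L2 unit_interval" "(\<lambda>x. complex_of_real (deriv \<phi> x)) \<in> L2 unit_interval"
    by (intro continuous_L2 continuous_on_of_real tf)+
  show "AE y in \<mu>. (LINT x|unit_interval. of_real (\<phi> x) * resolvent_deriv k w0 (x, y)) =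
      - (LINT x|unit_interval. of_real (deriv \<phi> x) * (case (x, y) of (x, y) \<Rightarrow> resolvent k w0 x y))"
    using HH_section[OF k] HH_section[OF resolvent_HH_L2] HH_section[OF resolvent_deriv_L2]
  proof eventually_elim
    case (elim y)
    define q where "q t = of_real (exp (- 2 * pi * t)) * k (t, y)" for t
    define H where "H x = complex_of_real (\<phi> x * exp (2 * pi * x))" for x
    define h where "h x = complex_of_real (deriv \<phi> x * exp (2 * pi * x) + \<phi> x * (exp (2 * pi * x) * (2 * pi)))" for x
    have ec: "(\<lambda>t. complex_of_real (exp (- 2 * pi * t))) \<in> L2 unit_interval"
      by (intro continuous_L2 continuous_intros)
    have q: "integrable unit_interval q"
      using L2_inner_integrable[OF elim(1) ec] by (simp add: q_def[abs_def] mult.commute)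
    have Hh: "(H has_vector_derivative h x) (at x within {0..1})" for x
    proof -
      have "((\<lambda>x. \<phi> x * exp (2 * pi * x)) has_real_derivative
          (deriv \<phi> x * exp (2 * pi * x) + \<phi> x * (exp (2 * pi * x) * (2 * pi)))) (at x within {0..1})"
        by (auto intro!: derivative_eq_intros has_field_derivative_at_within[OF tf(1)])
      then show ?thesis unfolding H_def h_def by (rule has_vector_derivative_of_real)
    qed
    have hc: "continuous_on {0..1} h" unfolding h_def
      by (intro continuous_on_of_real continuous_intros tf)
    have H01: "H 0 = 0" "H 1 = 0" using tf by (simp_all add: H_def)
    have prim_q: "(LINT t|unit_interval. indicator {0..x} t *\<^sub>R q t) = damped_primitive k x y" for x
      unfolding damped_primitive_def by (intro Bochner_Integration.integral_cong refl) (auto simp: q_def damped_indicator_def indicator_def)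
    note ibp = integration_by_parts[OF q Hh hc, unfolded prim_q H01]
    have hint: "(LINT x|unit_interval. h x) = 0"
      using integral_unit_interval_FTC[OF Hh hc] by (simp add: H01)
    have hi: "integrable unit_interval h" by (rule continuous_unit_interval_integrable[OF hc])
    have qH: "integrable unit_interval (\<lambda>x. q x * H x)"
    proof -
      have "q x * H x = k (x, y) * cnj (of_real (\<phi> x))" for x
      proof -
        have "complex_of_real (exp (- 2 * pi * x)) * of_real (exp (2 * pi * x)) = 1"
          by (simp add: exp_minus flip: of_real_mult)
        then show ?thesis unfolding q_def H_def of_real_mult by (simp add: mult_ac)
      qed
      then show ?thesis using L2_inner_integrable[OF elim(1) \<phi>L(1)] by simp
    qed
    have i1: "integrable unit_interval (\<lambda>x. of_real (\<phi> x) * resolvent_deriv k w0 (x, y))"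
      using L2_inner_integrable[OF elim(3) \<phi>L(1)] by (simp add: mult.commute)
    have i2: "integrable unit_interval (\<lambda>x. of_real (deriv \<phi> x) * resolvent k w0 x y)"
      using L2_inner_integrable[OF elim(2) \<phi>L(2)] by (simp add: mult.commute)
    \<comment> \<open>The source term becomes \<open>q x * H x\<close>, and the two terms with the
      solution combine to \<open>h\<close> times the bracket in \<open>resolvent\<close>. The
      integral of \<open>h\<close> is 0, and \<open>ibp\<close> cancels the other two
      integrals.\<close>
    have eq: "of_real (\<phi> x) * resolvent_deriv k w0 (x, y) + of_real (deriv \<phi> x) * resolvent k w0 x y =
      \<i> * 2 * of_real pi * (q x * H x) + (w0 y * h x + \<i> * 2 * of_real pi * (damped_primitive k x y * h x))" for x
    proof -
      define E where "E = complex_of_real (exp (2 * pi * x))"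
      have "complex_of_real (exp (- 2 * pi * x)) * E = 1"
        by (simp add: E_def exp_minus flip: of_real_mult)
      then have qHx: "q x * H x = of_real (\<phi> x) * k (x, y)"
        unfolding q_def H_def E_def of_real_mult by (simp add: mult_ac)
      have hx: "h x = of_real (deriv \<phi> x) * E + of_real (\<phi> x) * (E * (2 * of_real pi))"
        by (simp add: h_def E_def)
      show ?thesis unfolding qHx hx resolvent_deriv_def prod.case resolvent_def E_def[symmetric]
        by (simp add: algebra_simps)
    qed
    have "(LINT x|unit_interval. of_real (\<phi> x) * resolvent_deriv k w0 (x, y)) + (LINT x|unit_interval. of_real (deriv \<phi> x) * resolvent k w0 x y) =
      (LINT x|unit_interval. of_real (\<phi> x) * resolvent_deriv k w0 (x, y) + of_real (deriv \<phi> x) * resolvent k w0 x y)"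
      by (rule Bochner_Integration.integral_add[OF i1 i2, symmetric])
    also have "\<dots> = \<i> * 2 * of_real pi * (LINT x|unit_interval. q x * H x) +
        (w0 y * (LINT x|unit_interval. h x) + \<i> * 2 * of_real pi * (LINT x|unit_interval. damped_primitive k x y * h x))"
      unfolding eq using qH hi ibp(1) by simp
    also have "\<dots> = 0" unfolding hint ibp(2) by simp
    finally show ?case by (simp add: add_eq_0_iff)
  qed
qed

lemma resolvent_continuous_representative: "continuous_representative \<mu> (\<lambda>(x, y). resolvent k w0 x y) (resolvent k w0)"
  unfolding continuous_representative_def
proof (intro conjI ballI)
  fix x :: real assume x: "x \<in> {0..1}"
  show "resolvent k w0 x \<in> L2 \<mu>" by (rule resolvent_section_L2)
  let ?N = "normL2 (HH \<mu>) k"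
  define C where "C = normL2 \<mu> w0 + 2 * pi * ?N"
  \<comment> \<open>In the first summand the exponential factor varies and the bracket has norm at
    most \<open>C\<close>; in the second the primitive varies at the fixed factor exp(2 pi
    x).\<close>
  define A where "A t = \<bar>exp (2 * pi * t) - exp (2 * pi * x)\<bar> * C + exp (2 * pi * x) * (2 * pi * (sqrt \<bar>t - x\<bar> * ?N))" for t
  have bd: "normL2 \<mu> (\<lambda>y. resolvent k w0 t y - resolvent k w0 x y) \<le> A t" if t: "t \<in> {0..1}" for t
  proof -
    let ?u = "\<lambda>y. w0 y + \<i> * 2 * of_real pi * damped_primitive k t y"
    have u: "?u \<in> L2 \<mu>" by (intro L2_add L2_cmult w0 damped_primitive_L2[OF k])
    have nu: "normL2 \<mu> ?u \<le> C"
    proof -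
      have "normL2 \<mu> ?u \<le> normL2 \<mu> w0 + normL2 \<mu> (\<lambda>y. \<i> * 2 * of_real pi * damped_primitive k t y)"
        by (intro normL2_triangle L2_cmult w0 damped_primitive_L2[OF k])
      also have "normL2 \<mu> (\<lambda>y. \<i> * 2 * of_real pi * damped_primitive k t y) = 2 * pi * normL2 \<mu> (damped_primitive k t)"
        unfolding normL2_cmult by (simp add: norm_mult)
      also have "normL2 \<mu> w0 + 2 * pi * normL2 \<mu> (damped_primitive k t) \<le> C"
        unfolding C_def using norm_damped_primitive_le[OF k t] by simp
      finally show ?thesis .
    qed
    have "(\<lambda>y. resolvent k w0 t y - resolvent k w0 x y) = (\<lambda>y. of_real (exp (2 * pi * t) - exp (2 * pi * x)) * ?u y
        + (of_real (exp (2 * pi * x)) * (\<i> * 2 * of_real pi)) * (damped_primitive k t y - damped_primitive k x y))"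
      by (simp add: resolvent_def algebra_simps)
    then have "normL2 \<mu> (\<lambda>y. resolvent k w0 t y - resolvent k w0 x y) \<le> normL2 \<mu> (\<lambda>y. of_real (exp (2 * pi * t) - exp (2 * pi * x)) * ?u y)
        + normL2 \<mu> (\<lambda>y. (of_real (exp (2 * pi * x)) * (\<i> * 2 * of_real pi)) * (damped_primitive k t y - damped_primitive k x y))"
      by (simp only:) (intro normL2_triangle L2_cmult L2_diff u damped_primitive_L2[OF k])
    also have "\<dots> = \<bar>exp (2 * pi * t) - exp (2 * pi * x)\<bar> * normL2 \<mu> ?u
        + exp (2 * pi * x) * (2 * pi * normL2 \<mu> (\<lambda>y. damped_primitive k t y - damped_primitive k x y))"
      unfolding normL2_cmult norm_mult norm_of_real by simp
    also have "\<dots> \<le> A t" unfolding A_def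
      by (intro add_mono mult_left_mono nu damped_primitive_diff[OF k] t x) auto
    finally show ?thesis .
  qed
  have "(A \<longlongrightarrow> A x) (at x within {0..1})" unfolding A_def by (intro tendsto_intros)
  then have A0: "(A \<longlongrightarrow> 0) (at x within {0..1})" by (simp add: A_def)
  show "((\<lambda>t. normL2 \<mu> (\<lambda>y. resolvent k w0 t y - resolvent k w0 x y)) \<longlongrightarrow> 0) (at x within {0..1})"
    by (rule Lim_null_comparison[OF _ A0]) (use bd in \<open>auto simp: eventually_at_filter\<close>)
next
  show "AE x in unit_interval. eqL2 \<mu> (\<lambda>y. case (x, y) of (x, y) \<Rightarrow> resolvent k w0 x y) (resolvent k w0 x)" by simp
qed

lemma resolvent_0: "eqL2 \<mu> (resolvent k w0 0) w0"
proof -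
  have "normL2 \<mu> (damped_primitive k 0) \<le> normL2 unit_interval (damped_indicator 0) * normL2 (HH \<mu>) k"
    unfolding damped_primitive_def by (rule partial_integral_L2(2)[OF k damped_indicator_L2])
  then have "normL2 \<mu> (damped_primitive k 0) = 0" using norm_damped_indicator_0 normL2_nonneg[of \<mu> "damped_primitive k 0"] by simp
  then have "eqL2 \<mu> (damped_primitive k 0) (\<lambda>y. 0)" using normL2_eq_0_iff[OF damped_primitive_L2[OF k]] by simp
  then show ?thesis unfolding eqL2_def by eventually_elim (simp add: resolvent_def)
qed

end

text \<open>The solution of the resolvent equation agrees with the given \<open>f\<close> only
  almost everywhere, so membership in \<open>P_op\<close> must pass to other
  representatives.\<close>

lemma P_op_cong:
  assumes P: "(f, g) \<in> P_op \<mu> U" and f': "f' \<in> L2 (HH \<mu>)" "eqL2 (HH \<mu>) f f'" and g': "g' \<in> L2 (HH \<mu>)" "eqL2 (HH \<mu>) g g'"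
  shows "(f', g') \<in> P_op \<mu> U"
proof -
  obtain d F where f: "f \<in> L2 (HH \<mu>)" and d: "d \<in> L2 (HH \<mu>)" and dist: "distributional_derivative \<mu> f d"
    and F: "continuous_representative \<mu> f F" and bc: "eqL2 \<mu> (F 1) (U (F 0))"
    and gd: "eqL2 (HH \<mu>) g (\<lambda>z. 1 / (\<i> * 2 * of_real pi) * d z)"
    using P unfolding P_op_def by blast
  have "distributional_derivative \<mu> f' d"
    unfolding distributional_derivative_def
  proof (intro allI impI)
    fix \<phi> assume \<phi>: "test_function \<phi>"
    have w: "(\<lambda>x. complex_of_real (deriv \<phi> x)) \<in> L2 unit_interval"
      by (intro continuous_L2 continuous_on_of_real test_function_facts[OF \<phi>])
    have 1: "eqL2 \<mu> (\<lambda>y. LINT x|unit_interval. of_real (\<phi> x) * d (x, y))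
        (\<lambda>y. - (LINT x|unit_interval. of_real (deriv \<phi> x) * f (x, y)))"
      using dist \<phi> by (simp add: distributional_derivative_def)
    have "eqL2 \<mu> (\<lambda>y. LINT x|unit_interval. f (x, y) * cnj (of_real (deriv \<phi> x)))
        (\<lambda>y. LINT x|unit_interval. f' (x, y) * cnj (of_real (deriv \<phi> x)))"
      by (rule partial_integral_cong[OF f f' w])
    then have 2: "eqL2 \<mu> (\<lambda>y. - (LINT x|unit_interval. of_real (deriv \<phi> x) * f (x, y)))
        (\<lambda>y. - (LINT x|unit_interval. of_real (deriv \<phi> x) * f' (x, y)))"
      by (simp add: eqL2_def mult.commute)
    show "eqL2 \<mu> (\<lambda>y. LINT x|unit_interval. of_real (\<phi> x) * d (x, y))
        (\<lambda>y. - (LINT x|unit_interval. of_real (deriv \<phi> x) * f' (x, y)))"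
      by (rule eqL2_trans[OF 1 2])
  qed
  moreover have "continuous_representative \<mu> f' F"
  proof -
    have "AE x in unit_interval. AE y in \<mu>. f (x, y) = f' (x, y)"
      using f'(2) unfolding eqL2_def by (rule AE_HH_fst)
    moreover have "AE x in unit_interval. eqL2 \<mu> (\<lambda>y. f (x, y)) (F x)"
      using F by (simp add: continuous_representative_def)
    ultimately have "AE x in unit_interval. eqL2 \<mu> (\<lambda>y. f' (x, y)) (F x)"
    proof eventually_elim
      case (elim x)
      have "eqL2 \<mu> (\<lambda>y. f' (x, y)) (\<lambda>y. f (x, y))" using elim(1) by (auto simp: eqL2_def elim: eventually_mono)
      then show ?case using elim(2) by (rule eqL2_trans)
    qed
    with F show ?thesis by (simp add: continuous_representative_def)
  qed
  moreover have "eqL2 (HH \<mu>) g' (\<lambda>z. 1 / (\<i> * 2 * of_real pi) * d z)"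
    by (rule eqL2_trans[OF eqL2_sym[OF g'(2)] gd])
  ultimately show ?thesis
    unfolding P_op_def mem_Collect_eq prod.case using f' g' d bc by blast
qed

text \<open>The resolvent equation \<open>(P_U + \<i>) w = k\<close> is solvable for every \<open>k\<close>, so the symmetric
  operator \<open>P_U\<close> has no proper extension to a diagonal operator with real eigenvalues.\<close>

lemma diag_op_subset_P_op:
  assumes unitary: "unitary_map \<mu> U"
    and eigen: "\<And>l. l \<in> \<Lambda> \<Longrightarrow> eqL2 \<mu> (U (e_fun l)) (\<lambda>y. ee (\<theta> l) * e_fun l y)"
  shows "diag_op (HH \<mu>) (UNIV \<times> \<Lambda>) (product_basis \<theta>) (\<lambda>(n, l). \<theta> l + of_int n) \<subseteq> P_op \<mu> U"
proof (intro subrelI)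
  let ?D = "diag_op (HH \<mu>) (UNIV \<times> \<Lambda>) (product_basis \<theta>) (\<lambda>(n, l). \<theta> l + of_int n)"
  let ?b = "product_basis \<theta>" and ?ev = "\<lambda>(n, l). \<theta> l + of_int n"
  fix f g assume fg: "(f, g) \<in> ?D"
  then have f: "f \<in> L2 (HH \<mu>)" and g: "g \<in> L2 (HH \<mu>)"
    and fg_coeff: "\<And>i. i \<in> UNIV \<times> \<Lambda> \<Longrightarrow> innerL2 (HH \<mu>) g (?b i) = of_real (?ev i) * innerL2 (HH \<mu>) f (?b i)"
    unfolding diag_op_def by blast+
  have linU: "linear_map \<mu> U" using unitary by (simp add: unitary_map_def)
  have UL: "U v \<in> L2 \<mu>" if "v \<in> L2 \<mu>" for v using linU that by (simp add: linear_map_def)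
  \<comment> \<open>The right-hand side for which \<open>f\<close> ought to solve the resolvent
    equation; \<open>f\<close> will be recovered as the solution that meets the boundary
    condition.\<close>
  define k where "k z = g z + \<i> * f z" for z
  have k: "k \<in> L2 (HH \<mu>)" unfolding k_def by (intro L2_add L2_cmult f g)
  define r where "r = exp (2 * pi)"
  \<comment> \<open>Obtained by solving r (w + 2 pi i K) = e(\<theta> l) w for the coefficient w of
    the initial value, where K is the coefficient of the primitive at 1. Since e(\<theta> l) has
    modulus 1 and r > 1, the multiplier is bounded uniformly in \<open>l\<close>.\<close>
  define \<beta> where "\<beta> l = \<i> * 2 * of_real pi * of_real r / (ee (\<theta> l) - of_real r)" for l
  have r1: "r > 1" unfolding r_def by simp
  have den: "r - 1 \<le> cmod (ee (\<theta> l) - of_real r)" for l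
    using norm_triangle_ineq2[of "complex_of_real r" "ee (\<theta> l)"] r1 by (simp add: norm_minus_commute)
  have den0: "ee (\<theta> l) - of_real r \<noteq> 0" for l using den[of l] r1 by auto
  have "cmod (\<beta> l) \<le> 2 * pi * r / (r - 1)" for l
  proof -
    have "cmod (\<beta> l) = 2 * pi * r / cmod (ee (\<theta> l) - of_real r)"
      unfolding \<beta>_def norm_divide norm_mult using r1 by simp
    also have "\<dots> \<le> 2 * pi * r / (r - 1)" using den[of l] r1 by (intro divide_left_mono mult_pos_pos) auto
    finally show ?thesis .
  qed
  then obtain w0 where w0: "w0 \<in> L2 \<mu>"
    and w0_coeff: "\<And>l. l \<in> \<Lambda> \<Longrightarrow> innerL2 \<mu> w0 (e_fun l) = \<beta> l * innerL2 \<mu> (damped_primitive k 1) (e_fun l)"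
    using coefficient_multiplier[OF onb damped_primitive_L2[OF k], of \<beta> "2 * pi * r / (r - 1)" 1] by blast
  let ?W = "\<lambda>(x, y). resolvent k w0 x y"
  have WL: "?W \<in> L2 (HH \<mu>)" by (rule resolvent_HH_L2[OF k w0])
  note s0 = resolvent_0[OF k w0] and sL = resolvent_section_L2[OF k w0]
  have bc: "eqL2 \<mu> (resolvent k w0 1) (U (resolvent k w0 0))"
  proof (rule onb_eqI[OF onb sL UL[OF sL]])
    fix l assume l: "l \<in> \<Lambda>"
    note el = e_L2[OF l]
    let ?K = "innerL2 \<mu> (damped_primitive k 1) (e_fun l)"
    have "innerL2 \<mu> (U (resolvent k w0 0)) (e_fun l) = ee (\<theta> l) * innerL2 \<mu> (resolvent k w0 0) (e_fun l)"
      by (rule inner_unitary_eigen[OF unitary eigen[OF l] sL l])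
    also have "innerL2 \<mu> (resolvent k w0 0) (e_fun l) = innerL2 \<mu> w0 (e_fun l)"
      by (intro innerL2_cong sL w0 el s0 eqL2_refl)
    also have "\<dots> = \<beta> l * ?K" by (rule w0_coeff[OF l])
    finally have 1: "innerL2 \<mu> (U (resolvent k w0 0)) (e_fun l) = ee (\<theta> l) * (\<beta> l * ?K)" .
    have "innerL2 \<mu> (resolvent k w0 1) (e_fun l) = of_real r * (innerL2 \<mu> w0 (e_fun l) + \<i> * 2 * of_real pi * ?K)"
      unfolding resolvent_def r_def
      using w0 damped_primitive_L2[OF k] el by (simp add: innerL2_cmult_left innerL2_add_left L2_cmult)
    also have "\<dots> = of_real r * \<beta> l * ?K + \<i> * 2 * of_real pi * of_real r * ?K"
      unfolding w0_coeff[OF l] by (simp add: algebra_simps)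
    also have "\<i> * 2 * of_real pi * of_real r = \<beta> l * (ee (\<theta> l) - of_real r)"
      using den0[of l] by (simp add: \<beta>_def)
    also have "of_real r * \<beta> l * ?K + \<beta> l * (ee (\<theta> l) - of_real r) * ?K = ee (\<theta> l) * (\<beta> l * ?K)"
      by (simp add: algebra_simps)
    finally show "innerL2 \<mu> (resolvent k w0 1) (e_fun l) = innerL2 \<mu> (U (resolvent k w0 0)) (e_fun l)" using 1 by simp
  qed
  let ?h = "\<lambda>z. k z - \<i> * ?W z"
  have hL: "?h \<in> L2 (HH \<mu>)" by (intro L2_diff L2_cmult k WL)
  have h_eq: "?h = (\<lambda>z. 1 / (\<i> * 2 * of_real pi) * resolvent_deriv k w0 z)"
    by (auto simp: resolvent_deriv_def fun_eq_iff field_simps)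
  have WP: "(?W, ?h) \<in> P_op \<mu> U"
    unfolding P_op_def mem_Collect_eq prod.case
    using WL hL resolvent_deriv_L2[OF k w0] resolvent_distributional_derivative[OF k w0] resolvent_continuous_representative[OF k w0] bc
      eqL2_refl[of "HH \<mu>" ?h, unfolded h_eq] unfolding h_eq by blast
  then have "(?W, ?h) \<in> ?D" using P_op_subset_diag_op[OF unitary eigen] by blast
  then have W_coeff: "\<And>i. i \<in> UNIV \<times> \<Lambda> \<Longrightarrow> innerL2 (HH \<mu>) ?h (?b i) = of_real (?ev i) * innerL2 (HH \<mu>) ?W (?b i)"
    unfolding diag_op_def by blast
  \<comment> \<open>Both \<open>f\<close> and the solution satisfy the diagonal equation with
    right-hand side \<open>k\<close>, and a real eigenvalue plus i is never 0.\<close>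
  have Wf: "eqL2 (HH \<mu>) ?W f"
  proof (rule onb_eqI[OF product_basis_onb[of \<theta>] WL f])
    fix i :: "int \<times> real" assume i: "i \<in> UNIV \<times> \<Lambda>"
    have b: "?b i \<in> L2 (HH \<mu>)" by (rule onb_L2[OF product_basis_onb i])
    have "innerL2 (HH \<mu>) ?h (?b i) = innerL2 (HH \<mu>) k (?b i) - \<i> * innerL2 (HH \<mu>) ?W (?b i)"
      using innerL2_diff_left[OF k L2_cmult[OF WL] b, of \<i>] by (simp only: innerL2_cmult_left)
    also have "innerL2 (HH \<mu>) k (?b i) = innerL2 (HH \<mu>) g (?b i) + \<i> * innerL2 (HH \<mu>) f (?b i)"
      unfolding k_def using innerL2_add_left[OF g L2_cmult[OF f] b, of \<i>] by (simp only: innerL2_cmult_left)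
    finally have "(of_real (?ev i) + \<i>) * innerL2 (HH \<mu>) ?W (?b i) = (of_real (?ev i) + \<i>) * innerL2 (HH \<mu>) f (?b i)"
      unfolding W_coeff[OF i] fg_coeff[OF i] by (simp add: algebra_simps)
    moreover have "complex_of_real (?ev i) + \<i> \<noteq> 0" by (simp add: complex_eq_iff)
    ultimately show "innerL2 (HH \<mu>) ?W (?b i) = innerL2 (HH \<mu>) f (?b i)" by simp
  qed
  have hg: "eqL2 (HH \<mu>) ?h g"
    using Wf unfolding eqL2_def by eventually_elim (simp add: k_def)
  show "(f, g) \<in> P_op \<mu> U" by (rule P_op_cong[OF WP f Wf g hg])
qed

lemma commute_if_eigenfunctions:
  assumes unitary: "unitary_map \<mu> U"
    and eigen: "\<And>l. l \<in> \<Lambda> \<Longrightarrow> eigenfunction \<mu> U (e_fun l)"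
  shows "operators_commute (HH \<mu>) (P_op \<mu> U) (Q_op \<mu> \<Lambda>)"
proof -
  \<comment> \<open>Unitarity gives the eigenvalue modulus 1, so it has the form
    \<open>ee t\<close>, which defines the phase \<open>\<theta>\<close>.\<close>
  have "\<exists>t. eqL2 \<mu> (U (e_fun l)) (\<lambda>y. ee t * e_fun l y)" if l: "l \<in> \<Lambda>" for l
  proof -
    note el = e_L2[OF l]
    obtain c where c: "eqL2 \<mu> (U (e_fun l)) (\<lambda>y. c * e_fun l y)"
      using eigen[OF l] by (auto simp: eigenfunction_def)
    have UL: "U (e_fun l) \<in> L2 \<mu>" using unitary el by (simp add: unitary_map_def linear_map_def)
    have "innerL2 \<mu> (U (e_fun l)) (U (e_fun l)) = innerL2 \<mu> (e_fun l) (e_fun l)"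
      using unitary el by (simp add: unitary_map_def)
    then have "normL2 \<mu> (U (e_fun l)) = normL2 \<mu> (e_fun l)"
      using normL2_sq_inner[of \<mu>] by (metis normL2_nonneg power2_eq_iff_nonneg)
    moreover have "normL2 \<mu> (U (e_fun l)) = cmod c * normL2 \<mu> (e_fun l)"
      using normL2_cong[OF UL L2_cmult[OF el] c] by (simp only: normL2_cmult)
    ultimately have "cmod c = 1" using norm_e[OF l] by simp
    then obtain t where "c = Complex (cos t) (sin t)" by (rule complex_unimodular_polar)
    then have "c = ee (t / (2 * pi))" by (simp add: ee_cis complex_eq_iff)
    with c show ?thesis by blast
  qed
  then obtain \<theta> where \<theta>: "\<And>l. l \<in> \<Lambda> \<Longrightarrow> eqL2 \<mu> (U (e_fun l)) (\<lambda>y. ee (\<theta> l) * e_fun l y)" by metis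
  let ?b = "product_basis \<theta>" and ?ev = "\<lambda>(n::int, l). \<theta> l + of_int n" and ?I = "UNIV \<times> \<Lambda>"
  interpret H: prob_space "HH \<mu>" by (rule prob_space_HH)
  have P: "P_op \<mu> U = diag_op (HH \<mu>) ?I ?b ?ev"
    using P_op_subset_diag_op[OF unitary \<theta>] diag_op_subset_P_op[OF unitary \<theta>] by blast
  note onb' = product_basis_onb[of \<theta>]
  \<comment> \<open>Both projections multiply coefficients in the same basis, so the order is
    immaterial; this is where Q has to be diagonal in the basis dictated by
    \<open>U\<close>.\<close>
  have "eqL2 (HH \<mu>) (diag_proj (HH \<mu>) ?I ?b ?ev S (diag_proj (HH \<mu>) ?I ?b snd T f))
      (diag_proj (HH \<mu>) ?I ?b snd T (diag_proj (HH \<mu>) ?I ?b ?ev S f))" if f: "f \<in> L2 (HH \<mu>)" for S T f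
    using f by (intro H.diag_proj_eqI[OF onb']) (simp_all add: H.diag_proj_L2[OF onb'] H.diag_proj_coeff[OF onb'])
  then show ?thesis
    unfolding operators_commute_def P Q_op_eq_diag_op[of \<theta>]
    using H.spectral_measure_diag_op[OF onb'] by blast
qed

end

theorem theorem5p8:
  fixes \<mu> :: "real measure" and \<Lambda> :: "real set"
    and U :: "(real \<Rightarrow> complex) \<Rightarrow> (real \<Rightarrow> complex)"
  assumes "prob_space \<mu>" and "sets \<mu> = sets borel"
    and "orthonormal_basis \<mu> \<Lambda> e_fun"
    and "unitary_map \<mu> U"
  shows "operators_commute (HH \<mu>) (P_op \<mu> U) (Q_op \<mu> \<Lambda>) \<longleftrightarrow>
         (\<forall>l\<in>\<Lambda>. eigenfunction \<mu> U (e_fun l))"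
proof -
  interpret prob_space \<mu> by (rule assms(1))
  interpret spectral_pair \<mu> \<Lambda> by unfold_locales (rule assms(2,3))+
  show ?thesis
    using eigenfunction_if_commute[OF assms(4)] commute_if_eigenfunctions[OF assms(4)] by blast
qed

end
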